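(* Let $V$ be a complete discrete valuation ring of mixed characteristic $p$ with maximal ideal $pV$ and perfect residue field. Let $C$ be a complete local domain in mixed characteristic and $R=V[[X_1,\dots,X_{n-1}]]\hookrightarrow C$ be such that $C$ is a module finite extension of $R$. Let $m$ denote the maximal ideal of $R$, let $\widehat\Omega_{C/V}$ denote the $m$-adic completion of $\Omega_{C/V}$, and let $T$ be the torsion submodule of the $C$-module $\widehat\Omega_{C/V}$. Then for any $\omega\in\widehat\Omega_{C/V}$, $$\omega\in T\iff \tilde D_i(\omega)=0\ \text{ for } 1\le i\le n-1,$$ where $\tilde D_i:\widehat\Omega_{C/V}\to Q(C)$ is the $C$-linear map induced by the extension $D_i:C\to Q(C)$ of the derivation $\partial/\partial X_i:R\to R$, $\partial/\partial X_i(X_j)=\delta_{ij}$.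
   Context: $Q(C)$ is the field of fractions of $C$. $\Omega_{C/V}$ is the module of Kähler differentials. Since $Q(C)/Q(R)$ is finite separable, $\partial/\partial X_i$ extends uniquely to a derivation of $Q(C)$, whose restriction $D_i:C\to Q(C)$ induces a $C$-linear map $\Omega_{C/V}\to Q(C)$, $c\,db\mapsto cD_i(b)$; its image lies in a finitely generated $C$-submodule, so it extends (uniquely by continuity) to $\tilde D_i:\widehat\Omega_{C/V}\to Q(C)$. *)

theory Defs
  imports
    "HOL-Algebra.Algebraic_Closure_Type"
    "HOL-Algebra.Ideal_Product"
    "HOL-Algebra.Ring_Divisibility"
    "HOL-Algebra.Module"
    "HOL-Library.Poly_Mapping"
begin

text \<open>
  Rings are HOL-Algebra records.  A ring given by a type (such as the domain whose field of
  fractions is the type \<open>'c fract\<close>) is turned into a record by \<^const>\<open>ring_of_type_algebra\<close>.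
  Modules are HOL-Algebra \<open>module\<close> records, whose inherited fields \<open>mult\<close> and \<open>one\<close> carry no
  meaning and are left \<^const>\<open>undefined\<close>.
\<close>

section \<open>Local rings, completeness, characteristic\<close>

definition local_ring :: "('a, 'b) ring_scheme \<Rightarrow> 'a set \<Rightarrow> bool" where
  "local_ring R M \<longleftrightarrow> cring R \<and> {I. maximalideal I R} = {M}"

text \<open>The power is taken in the monoid of ideals, so the zeroth power is the unit ideal.\<close>

abbreviation ideal_power :: "('a, 'b) ring_scheme \<Rightarrow> 'a set \<Rightarrow> nat \<Rightarrow> 'a set" where
  "ideal_power R I k \<equiv> I [^]\<^bsub>ideals_set R\<^esub> k"

text \<open>The canonical map from \<open>R\<close> to the inverse limit of the rings \<open>R/I\<^sup>k\<close> is injective (first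
  conjunct) and surjective (second conjunct).\<close>

definition adically_complete :: "('a, 'b) ring_scheme \<Rightarrow> 'a set \<Rightarrow> bool" where
  "adically_complete R I \<longleftrightarrow>
     (\<Inter>k. ideal_power R I k) = {\<zero>\<^bsub>R\<^esub>} \<and>
     (\<forall>x. (\<forall>k. x k \<in> carrier R \<and> x (Suc k) \<ominus>\<^bsub>R\<^esub> x k \<in> ideal_power R I k) \<longrightarrow>
          (\<exists>y\<in>carrier R. \<forall>k. y \<ominus>\<^bsub>R\<^esub> x k \<in> ideal_power R I k))"

definition has_char :: "('a, 'b) ring_scheme \<Rightarrow> nat \<Rightarrow> bool" where
  "has_char R q \<longleftrightarrow> (\<forall>k::nat. [k] \<cdot>\<^bsub>R\<^esub> \<one>\<^bsub>R\<^esub> = \<zero>\<^bsub>R\<^esub> \<longleftrightarrow> q dvd k)"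

definition mixed_char :: "('a, 'b) ring_scheme \<Rightarrow> 'a set \<Rightarrow> nat \<Rightarrow> bool" where
  "mixed_char R M p \<longleftrightarrow> Factorial_Ring.prime p \<and> has_char R 0 \<and> has_char (R Quot M) p"

text \<open>Perfectness of a field of positive characteristic \<open>q\<close>.\<close>

definition perfect_field :: "('a, 'b) ring_scheme \<Rightarrow> nat \<Rightarrow> bool" where
  "perfect_field K q \<longleftrightarrow> field K \<and> Factorial_Ring.prime q \<and> has_char K q \<and>
     (\<lambda>x. x [^]\<^bsub>K\<^esub> q) ` carrier K = carrier K"

definition discrete_valuation_ring :: "('a, 'b) ring_scheme \<Rightarrow> 'a set \<Rightarrow> bool" where
  "discrete_valuation_ring V M \<longleftrightarrow> principal_domain V \<and> local_ring V M \<and> \<not> field V"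

section \<open>Formal power series in several variables\<close>

text \<open>Power series over \<open>V\<close> in the variables \<open>X\<^sub>i\<close>, \<open>i \<in> I\<close>, as coefficient functions on
  exponent vectors.\<close>

definition mps_ring :: "('v, 'b) ring_scheme \<Rightarrow> nat set \<Rightarrow> ((nat \<Rightarrow>\<^sub>0 nat) \<Rightarrow> 'v) ring" where
  "mps_ring V I = \<lparr>
     carrier = {f. (\<forall>\<alpha>. f \<alpha> \<in> carrier V) \<and> (\<forall>\<alpha>. \<not> Poly_Mapping.keys \<alpha> \<subseteq> I \<longrightarrow> f \<alpha> = \<zero>\<^bsub>V\<^esub>)},
     monoid.mult = (\<lambda>f g \<alpha>. finsum V (\<lambda>(\<beta>, \<gamma>). f \<beta> \<otimes>\<^bsub>V\<^esub> g \<gamma>) {(\<beta>, \<gamma>). \<beta> + \<gamma> = \<alpha>}),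
     one = (\<lambda>\<alpha>. if \<alpha> = 0 then \<one>\<^bsub>V\<^esub> else \<zero>\<^bsub>V\<^esub>),
     ring.zero = (\<lambda>\<alpha>. \<zero>\<^bsub>V\<^esub>),
     add = (\<lambda>f g \<alpha>. f \<alpha> \<oplus>\<^bsub>V\<^esub> g \<alpha>)\<rparr>"

definition mps_const :: "('v, 'b) ring_scheme \<Rightarrow> 'v \<Rightarrow> (nat \<Rightarrow>\<^sub>0 nat) \<Rightarrow> 'v" where
  "mps_const V v = (\<lambda>\<alpha>. if \<alpha> = 0 then v else \<zero>\<^bsub>V\<^esub>)"

text \<open>The formal partial derivative with respect to \<open>X\<^sub>i\<close>.\<close>

definition mps_deriv ::
    "('v, 'b) ring_scheme \<Rightarrow> nat \<Rightarrow> ((nat \<Rightarrow>\<^sub>0 nat) \<Rightarrow> 'v) \<Rightarrow> (nat \<Rightarrow>\<^sub>0 nat) \<Rightarrow> 'v" where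
  "mps_deriv V i f = (\<lambda>\<alpha>.
     [(Poly_Mapping.lookup \<alpha> i + 1)] \<cdot>\<^bsub>V\<^esub> f (\<alpha> + Poly_Mapping.single i 1))"

section \<open>Modules\<close>

definition gen_submodule ::
    "('a, 'r) ring_scheme \<Rightarrow> ('a, 'b, 'm) module_scheme \<Rightarrow> 'b set \<Rightarrow> 'b set" where
  "gen_submodule R M S = \<Inter>{N. submodule N R M \<and> S \<subseteq> N}"

definition fin_gen_module :: "('a, 'r) ring_scheme \<Rightarrow> ('a, 'b, 'm) module_scheme \<Rightarrow> bool" where
  "fin_gen_module R M \<longleftrightarrow> (\<exists>S. finite S \<and> S \<subseteq> carrier M \<and> gen_submodule R M S = carrier M)"

definition module_hom ::
    "('a, 'r) ring_scheme \<Rightarrow> ('a, 'b, 'm) module_scheme \<Rightarrow> ('a, 'd, 'n) module_scheme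
     \<Rightarrow> ('b \<Rightarrow> 'd) set" where
  "module_hom R M N = {F \<in> carrier M \<rightarrow>\<^sub>E carrier N.
     (\<forall>x\<in>carrier M. \<forall>y\<in>carrier M. F (x \<oplus>\<^bsub>M\<^esub> y) = F x \<oplus>\<^bsub>N\<^esub> F y) \<and>
     (\<forall>a\<in>carrier R. \<forall>x\<in>carrier M. F (a \<odot>\<^bsub>M\<^esub> x) = a \<odot>\<^bsub>N\<^esub> F x)}"

definition quot_module :: "('a, 'b, 'm) module_scheme \<Rightarrow> 'b set \<Rightarrow> ('a, 'b set) module" where
  "quot_module M N = \<lparr>
     carrier = a_rcosets\<^bsub>M\<^esub> N,
     monoid.mult = undefined, one = undefined,
     ring.zero = N,
     add = (\<lambda>A B. A <+>\<^bsub>M\<^esub> B),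
     module.smult = (\<lambda>a A. \<Union>x\<in>A. N +>\<^bsub>M\<^esub> (a \<odot>\<^bsub>M\<^esub> x))\<rparr>"

definition free_module :: "('a, 'r) ring_scheme \<Rightarrow> 'b set \<Rightarrow> ('a, 'b \<Rightarrow> 'a) module" where
  "free_module R B = \<lparr>
     carrier = {g. (\<forall>b. g b \<in> carrier R) \<and> finite {b. g b \<noteq> \<zero>\<^bsub>R\<^esub>} \<and> (\<forall>b. b \<notin> B \<longrightarrow> g b = \<zero>\<^bsub>R\<^esub>)},
     monoid.mult = undefined, one = undefined,
     ring.zero = (\<lambda>b. \<zero>\<^bsub>R\<^esub>),
     add = (\<lambda>g h b. g b \<oplus>\<^bsub>R\<^esub> h b),
     module.smult = (\<lambda>a g b. a \<otimes>\<^bsub>R\<^esub> g b)\<rparr>"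

definition free_gen :: "('a, 'r) ring_scheme \<Rightarrow> 'b \<Rightarrow> 'b \<Rightarrow> 'a" where
  "free_gen R b = (\<lambda>x. if x = b then \<one>\<^bsub>R\<^esub> else \<zero>\<^bsub>R\<^esub>)"

text \<open>\<open>C\<close> as a module over \<open>R\<close> along a ring homomorphism \<open>\<phi>\<close>.\<close>

definition restrict_scalars :: "('a \<Rightarrow> 'c) \<Rightarrow> ('c, 'k) ring_scheme \<Rightarrow> ('a, 'c) module" where
  "restrict_scalars \<phi> C = \<lparr>
     carrier = carrier C,
     monoid.mult = undefined, one = undefined,
     ring.zero = \<zero>\<^bsub>C\<^esub>,
     add = (\<lambda>x y. x \<oplus>\<^bsub>C\<^esub> y),
     module.smult = (\<lambda>r x. \<phi> r \<otimes>\<^bsub>C\<^esub> x)\<rparr>"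

definition torsion_submodule ::
    "('a, 'r) ring_scheme \<Rightarrow> ('a, 'b, 'm) module_scheme \<Rightarrow> 'b set" where
  "torsion_submodule R M =
     {x \<in> carrier M. \<exists>a\<in>carrier R. a \<noteq> \<zero>\<^bsub>R\<^esub> \<and> a \<odot>\<^bsub>M\<^esub> x = \<zero>\<^bsub>M\<^esub>}"

section \<open>Adic completion\<close>

text \<open>The filtration \<open>m\<^sup>k M\<close> of a \<open>C\<close>-module \<open>M\<close>, for an ideal \<open>m\<close> of \<open>R\<close> acting on \<open>M\<close>
  through \<open>\<phi> : R \<rightarrow> C\<close>.  The \<open>R\<close>-submodule generated by the products is automatically a
  \<open>C\<close>-submodule, so it does not matter that submodules over \<open>C\<close> are used here.\<close>

definition adic_filtration ::
    "('a, 'r) ring_scheme \<Rightarrow> 'a set \<Rightarrow> ('a \<Rightarrow> 'c) \<Rightarrow> ('c, 'k) ring_scheme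
     \<Rightarrow> ('c, 'b, 'm) module_scheme \<Rightarrow> nat \<Rightarrow> 'b set" where
  "adic_filtration R m \<phi> C M k =
     gen_submodule C M {\<phi> a \<odot>\<^bsub>M\<^esub> x | a x. a \<in> ideal_power R m k \<and> x \<in> carrier M}"

text \<open>The inverse limit of the quotients \<open>M / F k\<close>.  The transition map sends a coset of
  \<open>F (Suc k)\<close> to the coset of \<open>F k\<close> containing it.\<close>

definition completion :: "('a, 'b, 'm) module_scheme \<Rightarrow> (nat \<Rightarrow> 'b set)
     \<Rightarrow> ('a, nat \<Rightarrow> 'b set) module" where
  "completion M F = \<lparr>
     carrier = {\<omega>. (\<forall>k. \<omega> k \<in> carrier (quot_module M (F k))) \<and> (\<forall>k. \<omega> (Suc k) \<subseteq> \<omega> k)},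
     monoid.mult = undefined, one = undefined,
     ring.zero = (\<lambda>k. \<zero>\<^bsub>quot_module M (F k)\<^esub>),
     add = (\<lambda>\<omega> \<eta> k. \<omega> k \<oplus>\<^bsub>quot_module M (F k)\<^esub> \<eta> k),
     module.smult = (\<lambda>a \<omega> k. a \<odot>\<^bsub>quot_module M (F k)\<^esub> \<omega> k)\<rparr>"

definition completion_map :: "('a, 'b, 'm) module_scheme \<Rightarrow> (nat \<Rightarrow> 'b set)
     \<Rightarrow> 'b \<Rightarrow> nat \<Rightarrow> 'b set" where
  "completion_map M F x = (\<lambda>k. F k +>\<^bsub>M\<^esub> x)"

section \<open>Kaehler differentials\<close>

text \<open>The relations, in the free \<open>C\<close>-module on symbols \<open>db\<close>, \<open>b \<in> C\<close>, that define the
  differentials of the algebra \<open>f : A \<rightarrow> C\<close>.\<close>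

definition kaehler_relations ::
    "('a, 'r) ring_scheme \<Rightarrow> ('c, 'k) ring_scheme \<Rightarrow> ('a \<Rightarrow> 'c) \<Rightarrow> ('c \<Rightarrow> 'c) set" where
  "kaehler_relations A C f =
     (let F = free_module C (carrier C); d = free_gen C in
       {d (a \<oplus>\<^bsub>C\<^esub> b) \<ominus>\<^bsub>F\<^esub> (d a \<oplus>\<^bsub>F\<^esub> d b) | a b. a \<in> carrier C \<and> b \<in> carrier C} \<union>
       {d (a \<otimes>\<^bsub>C\<^esub> b) \<ominus>\<^bsub>F\<^esub> (a \<odot>\<^bsub>F\<^esub> d b \<oplus>\<^bsub>F\<^esub> b \<odot>\<^bsub>F\<^esub> d a) | a b. a \<in> carrier C \<and> b \<in> carrier C} \<union>
       {d (f v) | v. v \<in> carrier A})"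

definition kaehler_kernel ::
    "('a, 'r) ring_scheme \<Rightarrow> ('c, 'k) ring_scheme \<Rightarrow> ('a \<Rightarrow> 'c) \<Rightarrow> ('c \<Rightarrow> 'c) set" where
  "kaehler_kernel A C f =
     gen_submodule C (free_module C (carrier C)) (kaehler_relations A C f)"

definition kaehler ::
    "('a, 'r) ring_scheme \<Rightarrow> ('c, 'k) ring_scheme \<Rightarrow> ('a \<Rightarrow> 'c) \<Rightarrow> ('c, ('c \<Rightarrow> 'c) set) module" where
  "kaehler A C f = quot_module (free_module C (carrier C)) (kaehler_kernel A C f)"

definition kaehler_d ::
    "('a, 'r) ring_scheme \<Rightarrow> ('c, 'k) ring_scheme \<Rightarrow> ('a \<Rightarrow> 'c) \<Rightarrow> 'c \<Rightarrow> ('c \<Rightarrow> 'c) set" where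
  "kaehler_d A C f b = kaehler_kernel A C f +>\<^bsub>free_module C (carrier C)\<^esub> free_gen C b"

section \<open>Extending the partial derivatives\<close>

definition derivation :: "('a::comm_ring_1 \<Rightarrow> 'a) \<Rightarrow> bool" where
  "derivation D \<longleftrightarrow> (\<forall>x y. D (x + y) = D x + D y) \<and> (\<forall>x y. D (x * y) = x * D y + y * D x)"

definition to_frac :: "'c::idom \<Rightarrow> 'c fract" where
  "to_frac c = Fraction_Field.Fract c 1"

definition frac_module :: "('c::idom, 'c fract) module" where
  "frac_module = \<lparr>
     carrier = UNIV,
     monoid.mult = undefined, one = undefined,
     ring.zero = 0,
     add = (\<lambda>x y. x + y),
     module.smult = (\<lambda>c x. to_frac c * x)\<rparr>"

text \<open>The derivation of \<open>Q(C)\<close> extending the partial derivative with respect to \<open>X\<^sub>i\<close> on the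
  power series ring in the variables indexed by \<open>I\<close>.\<close>

definition frac_deriv :: "('v, 'b) ring_scheme \<Rightarrow> nat set \<Rightarrow> (((nat \<Rightarrow>\<^sub>0 nat) \<Rightarrow> 'v) \<Rightarrow> 'c::idom)
     \<Rightarrow> nat \<Rightarrow> 'c fract \<Rightarrow> 'c fract" where
  "frac_deriv V I \<phi> i = (THE D. derivation D \<and>
     (\<forall>r\<in>carrier (mps_ring V I). D (to_frac (\<phi> r)) = to_frac (\<phi> (mps_deriv V i r))))"

definition D_map :: "('v, 'b) ring_scheme \<Rightarrow> nat set \<Rightarrow> (((nat \<Rightarrow>\<^sub>0 nat) \<Rightarrow> 'v) \<Rightarrow> 'c::idom)
     \<Rightarrow> nat \<Rightarrow> 'c \<Rightarrow> 'c fract" where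
  "D_map V I \<phi> i c = frac_deriv V I \<phi> i (to_frac c)"

text \<open>The linear map on differentials sending \<open>c db\<close> to \<open>c \<cdot> \<delta> b\<close>.\<close>

definition induced_map :: "('a, 'r) ring_scheme \<Rightarrow> ('c, 'k) ring_scheme \<Rightarrow> ('a \<Rightarrow> 'c)
     \<Rightarrow> ('c, 'd, 'n) module_scheme \<Rightarrow> ('c \<Rightarrow> 'd) \<Rightarrow> ('c \<Rightarrow> 'c) set \<Rightarrow> 'd" where
  "induced_map A C f N \<delta> = (THE F. F \<in> module_hom C (kaehler A C f) N \<and>
     (\<forall>c\<in>carrier C. \<forall>b\<in>carrier C.
        F (c \<odot>\<^bsub>kaehler A C f\<^esub> kaehler_d A C f b) = c \<odot>\<^bsub>N\<^esub> \<delta> b))"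

text \<open>Continuity of a linear map on the \<open>m\<close>-adic completion of \<open>M\<close>: the values lie in a finitely
  generated submodule \<open>L\<close> of \<open>N\<close>, which carries its own \<open>m\<close>-adic topology.  (The \<open>m\<close>-adic
  topology of \<open>Q(C)\<close> itself is indiscrete.)  As the map is linear, continuity at \<open>0\<close> suffices;
  the neighbourhoods of \<open>0\<close> in the completion are the kernels of the projections to
  \<open>M / m\<^sup>j M\<close>.\<close>

definition adic_continuous ::
    "('a, 'r) ring_scheme \<Rightarrow> 'a set \<Rightarrow> ('a \<Rightarrow> 'c) \<Rightarrow> ('c, 'k) ring_scheme
     \<Rightarrow> ('c, 'b, 'm) module_scheme \<Rightarrow> ('c, 'd, 'n) module_scheme
     \<Rightarrow> ((nat \<Rightarrow> 'b set) \<Rightarrow> 'd) \<Rightarrow> bool" where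
  "adic_continuous R m \<phi> C M N G \<longleftrightarrow>
     (let \<F> = adic_filtration R m \<phi> C M; Mhat = completion M \<F> in
      \<exists>L. submodule L C N \<and> fin_gen_module C (N\<lparr>carrier := L\<rparr>) \<and> G ` carrier Mhat \<subseteq> L \<and>
        (\<forall>k. \<exists>j. \<forall>\<omega>\<in>carrier Mhat. \<omega> j = \<zero>\<^bsub>quot_module M (\<F> j)\<^esub> \<longrightarrow>
             G \<omega> \<in> adic_filtration R m \<phi> C (N\<lparr>carrier := L\<rparr>) k))"

definition continuous_extension ::
    "('a, 'r) ring_scheme \<Rightarrow> 'a set \<Rightarrow> ('a \<Rightarrow> 'c) \<Rightarrow> ('c, 'k) ring_scheme
     \<Rightarrow> ('c, 'b, 'm) module_scheme \<Rightarrow> ('c, 'd, 'n) module_scheme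
     \<Rightarrow> ('b \<Rightarrow> 'd) \<Rightarrow> (nat \<Rightarrow> 'b set) \<Rightarrow> 'd" where
  "continuous_extension R m \<phi> C M N F =
     (let \<F> = adic_filtration R m \<phi> C M in
      THE G. G \<in> module_hom C (completion M \<F>) N \<and>
        (\<forall>x\<in>carrier M. G (completion_map M \<F> x) = F x) \<and>
        adic_continuous R m \<phi> C M N G)"

section \<open>The differentials of \<open>C\<close> over \<open>V\<close>\<close>

text \<open>\<open>C\<close> is a \<open>V\<close>-algebra through the constant power series.\<close>

definition Omega :: "('v, 'b) ring_scheme \<Rightarrow> ('c, 'k) ring_scheme
     \<Rightarrow> (((nat \<Rightarrow>\<^sub>0 nat) \<Rightarrow> 'v) \<Rightarrow> 'c) \<Rightarrow> ('c, ('c \<Rightarrow> 'c) set) module" where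
  "Omega V C \<phi> = kaehler V C (\<lambda>v. \<phi> (mps_const V v))"

definition Omega_hat :: "('v, 'b) ring_scheme \<Rightarrow> nat set \<Rightarrow> ((nat \<Rightarrow>\<^sub>0 nat) \<Rightarrow> 'v) set
     \<Rightarrow> ('c, 'k) ring_scheme \<Rightarrow> (((nat \<Rightarrow>\<^sub>0 nat) \<Rightarrow> 'v) \<Rightarrow> 'c)
     \<Rightarrow> ('c, nat \<Rightarrow> ('c \<Rightarrow> 'c) set set) module" where
  "Omega_hat V I m C \<phi> =
     completion (Omega V C \<phi>) (adic_filtration (mps_ring V I) m \<phi> C (Omega V C \<phi>))"

definition D_tilde :: "('v, 'b) ring_scheme \<Rightarrow> nat set \<Rightarrow> ((nat \<Rightarrow>\<^sub>0 nat) \<Rightarrow> 'v) set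
     \<Rightarrow> ('c::idom, 'k) ring_scheme \<Rightarrow> (((nat \<Rightarrow>\<^sub>0 nat) \<Rightarrow> 'v) \<Rightarrow> 'c) \<Rightarrow> nat
     \<Rightarrow> (nat \<Rightarrow> ('c \<Rightarrow> 'c) set set) \<Rightarrow> 'c fract" where
  "D_tilde V I m C \<phi> i =
     continuous_extension (mps_ring V I) m \<phi> C (Omega V C \<phi>) frac_module
       (induced_map V C (\<lambda>v. \<phi> (mps_const V v)) frac_module (D_map V I \<phi> i))"

end

theory Submission
  imports "Jordan_Normal_Form.Char_Poly" Defs
begin

text \<open>
  Torsion elements are killed because \<open>Q(C)\<close> is torsion-free.  For the converse, choose \<open>a \<noteq> 0\<close> in
  \<open>C\<close> with \<open>a D\<^sub>i(C) \<subseteq> C\<close> for all \<open>i\<close>.  The derivation \<open>c \<mapsto> a dc - \<Sum> a D\<^sub>i(c) dX\<^sub>i\<close> from \<open>C\<close> to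
  \<open>\<Omega>\<close> vanishes on the constants and on the variables, and writing \<open>r = r(0) + \<Sum> X\<^sub>i g\<^sub>i\<close> repeatedly
  shows that it maps \<open>R\<close> into \<open>\<Inter> m\<^sup>k \<Omega>\<close>.  As \<open>C\<close> is finite and separable over \<open>R\<close>, some \<open>b \<noteq> 0\<close>
  moves the whole image into this intersection (apply the derivation to \<open>f(c) = 0\<close> for a polynomial \<open>f\<close>
  over \<open>R\<close> of minimal degree and multiply by \<open>f'(c) \<noteq> 0\<close> for each of finitely many generators \<open>c\<close>).
  So \<open>ba \<omega>\<close> is determined by the \<open>D\<^sub>i(\<omega>)\<close> in every quotient \<open>\<Omega> / m\<^sup>k \<Omega>\<close>, and it is zero if they vanish.
  The extension of \<open>D\<^sub>i\<close> to the completion exists because the values of \<open>D\<^sub>i\<close> lie in \<open>a\<^sup>-\<^sup>1 C\<close> and \<open>C\<close>,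
  being finite over the complete ring \<open>R\<close>, is \<open>m\<close>-adically complete.
\<close>

section \<open>Integrality over a subring\<close>

text \<open>Before completion, \<open>Omega\<close> is in general neither finitely generated nor
  \<open>m\<close>-adically separated, and \<open>d\<close> does not commute with infinite sums. A
  derivation that kills the constants and the variables therefore need not kill \<open>R\<close>;
  its values on \<open>R\<close> are only known to lie in every m^k Omega, and that is all the
  completion can see. The field of fractions of \<open>R\<close> is avoided: polynomials have
  coefficients in a subring of \<open>C\<close>, leading coefficients are cleared by multiplication,
  and separability enters as characteristic 0. One torsion lemma for derivations modulo a submodule
  N serves three purposes: N = 0 gives uniqueness of D_i on Q(C), N = C inside Q(C) gives the
  denominator a, and the intersection of all m^k Omega gives the factor b. Uniqueness of the
  extension to the completion comes from bounded denominators: a finitely generated submodule of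
  Q(C) is carried into \<open>C\<close> by one nonzero b, and in \<open>C\<close> the m-adic
  topology is separated. The ideal \<open>m\<close> is given only as a maximal ideal. Integrality
  forces it into the maximal ideal of \<open>C\<close>, and this identifies it with the ideal
  generated by p and the X_i, whose powers are explicit.\<close>

definition is_subring :: "'a::comm_ring_1 set \<Rightarrow> bool" where
  "is_subring S \<longleftrightarrow> 1 \<in> S \<and> (\<forall>x\<in>S. \<forall>y\<in>S. x - y \<in> S \<and> x * y \<in> S)"

definition poly_over :: "'a::comm_ring_1 set \<Rightarrow> 'a Polynomial.poly set" where
  "poly_over S = {f. \<forall>i. Polynomial.coeff f i \<in> S}"

context
  fixes S :: "'a::comm_ring_1 set"
  assumes S: "is_subring S"
begin

lemma is_subring_one: "1 \<in> S"
  and is_subring_diff: "x \<in> S \<Longrightarrow> y \<in> S \<Longrightarrow> x - y \<in> S"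
  and is_subring_mult: "x \<in> S \<Longrightarrow> y \<in> S \<Longrightarrow> x * y \<in> S"
  using S by (auto simp: is_subring_def)

lemma is_subring_zero: "0 \<in> S"
  using is_subring_diff[OF is_subring_one is_subring_one] by simp

lemma is_subring_uminus: "x \<in> S \<Longrightarrow> - x \<in> S"
  using is_subring_diff[OF is_subring_zero, of x] by simp

lemma is_subring_add: "x \<in> S \<Longrightarrow> y \<in> S \<Longrightarrow> x + y \<in> S"
  using is_subring_diff[OF _ is_subring_uminus, of x y] by simp

lemma is_subring_sum: "(\<And>i. i \<in> I \<Longrightarrow> f i \<in> S) \<Longrightarrow> sum f I \<in> S"
  by (induction I rule: infinite_finite_induct)
    (auto intro: is_subring_zero is_subring_add)

lemma is_subring_prod: "(\<And>i. i \<in> I \<Longrightarrow> f i \<in> S) \<Longrightarrow> prod f I \<in> S"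
  by (induction I rule: infinite_finite_induct)
    (auto intro: is_subring_one is_subring_mult)

lemma is_subring_of_nat: "of_nat k \<in> S"
  by (induction k) (auto intro: is_subring_zero is_subring_one is_subring_add)

text \<open>Leibniz formula. It is applied with \<open>poly_over S\<close> as the subring, to place
  a characteristic polynomial over \<open>S\<close>.\<close>

lemma is_subring_det:
  assumes "A \<in> carrier_mat n n" "\<And>i j. i < n \<Longrightarrow> j < n \<Longrightarrow> A $$ (i, j) \<in> S"
  shows "Determinant.det A \<in> S"
proof -
  have "signof p \<in> S" for p :: "nat \<Rightarrow> nat"
    by (auto simp: sign_def is_subring_one is_subring_uminus)
  moreover have "A $$ (i, p i) \<in> S" if "p permutes {0..<n}" "i \<in> {0..<n}" for p i
    using that permutes_in_image[OF that(1), of i] by (intro assms(2)) auto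
  ultimately show ?thesis
    unfolding det_def'[OF assms(1)]
    by (intro is_subring_sum is_subring_mult is_subring_prod) auto
qed

lemma poly_over_diff: "f \<in> poly_over S \<Longrightarrow> g \<in> poly_over S \<Longrightarrow> f - g \<in> poly_over S"
  and poly_over_add: "f \<in> poly_over S \<Longrightarrow> g \<in> poly_over S \<Longrightarrow> f + g \<in> poly_over S"
  and poly_over_mult: "f \<in> poly_over S \<Longrightarrow> g \<in> poly_over S \<Longrightarrow> f * g \<in> poly_over S"
  and poly_over_smult: "f \<in> poly_over S \<Longrightarrow> a \<in> S \<Longrightarrow> Polynomial.smult a f \<in> poly_over S"
  and poly_over_pCons: "a \<in> S \<Longrightarrow> f \<in> poly_over S \<Longrightarrow> pCons a f \<in> poly_over S"
  and poly_over_zero: "0 \<in> poly_over S"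
  by (auto simp: poly_over_def coeff_mult coeff_pCons split: nat.split
      intro!: is_subring_diff is_subring_add is_subring_mult is_subring_sum is_subring_zero)

lemma is_subring_poly_over: "is_subring (poly_over S)"
proof -
  have "1 \<in> poly_over S"
    by (auto simp: one_pCons intro!: poly_over_pCons poly_over_zero is_subring_one)
  then show ?thesis
    by (auto simp: is_subring_def poly_over_diff poly_over_mult)
qed

end

lemma poly_over_mono: "S \<subseteq> T \<Longrightarrow> poly_over S \<subseteq> poly_over T"
  by (auto simp: poly_over_def)

text \<open>\<open>S\<close> stands for the image of \<open>R\<close> in \<open>C\<close>, and
  \<open>B\<close> for a finite set of module generators, not necessarily a basis. The last
  assumption, characteristic 0, is the source of separability.\<close>

locale finite_subring_extension =
  fixes S B :: "'c::idom set"
  assumes subring: "is_subring S"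
    and finite_B: "finite B"
    and span: "\<exists>r. (\<forall>b\<in>B. r b \<in> S) \<and> c = (\<Sum>b\<in>B. r b * b)"
    and char_0: "of_nat k = (0::'c) \<Longrightarrow> k = 0"
begin

text \<open>Determinant trick: multiplication by \<open>c\<close> acts on the generators through a
  matrix \<open>A\<close> over \<open>S\<close>, so the vector of generators lies in the kernel of c
  - A. Over a domain a nonzero kernel vector makes the determinant vanish, and this determinant is
  the monic characteristic polynomial of \<open>A\<close> evaluated at \<open>c\<close>.\<close>

lemma integral:
  obtains f where "f \<in> poly_over S" "Polynomial.lead_coeff f = 1" "poly f c = 0"
proof -
  obtain bs where bs: "set bs = B" "distinct bs"
    using finite_distinct_list[OF finite_B] by blast
  define n where "n = length bs"
  have sumB: "sum h B = (\<Sum>j<n. h (bs ! j))" for h :: "'c \<Rightarrow> 'c"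
    using bs sum.reindex_bij_betw[OF bij_betw_nth[OF bs(2)], of "{..<n}" B h]
    by (simp add: n_def)
  define r where "r c' = (SOME r. (\<forall>b\<in>B. r b \<in> S) \<and> c' = (\<Sum>b\<in>B. r b * b))" for c'
  have r: "\<forall>b\<in>B. r c' b \<in> S" "c' = (\<Sum>b\<in>B. r c' b * b)" for c'
    using someI_ex[OF span[of c']] unfolding r_def by auto
  \<comment> \<open>Row i holds chosen coefficients of c b_i in terms of the generators.\<close>
  define A where "A = mat n n (\<lambda>(i,j). r (c * bs ! i) (bs ! j))"
  define v where "v = vec n (\<lambda>i. bs ! i)"
  have v: "v \<in> carrier_vec n" by (simp add: v_def)
  have A: "A \<in> carrier_mat n n" by (simp add: A_def)
  define E where "E = mat n n (\<lambda>(i,j). (if i = j then c else 0) - A $$ (i,j))"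
  have E: "E \<in> carrier_mat n n" by (simp add: E_def)
  have "E *\<^sub>v v = 0\<^sub>v n"
  proof (rule eq_vecI)
    fix i assume i: "i < dim_vec (0\<^sub>v n :: 'c vec)"
    have "(E *\<^sub>v v) $ i = (\<Sum>j<n. ((if i = j then c else 0) - A $$ (i,j)) * bs ! j)"
      using i by (simp add: E_def v_def scalar_prod_def lessThan_atLeast0)
    also have "\<dots> = c * bs ! i - (\<Sum>j<n. r (c * bs ! i) (bs ! j) * bs ! j)"
      using i by (simp add: left_diff_distrib sum_subtractf A_def if_distrib[of "\<lambda>x. x * _"]
          cong: if_cong)
    also have "\<dots> = 0"
      using r(2)[of "c * bs ! i"] by (simp add: sumB)
    finally show "(E *\<^sub>v v) $ i = 0\<^sub>v n $ i" using i by simp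
  qed (simp add: E_def)
  \<comment> \<open>If all generators were 0, the expansion of 1 would give 1 = 0.\<close>
  moreover have "v \<noteq> 0\<^sub>v n"
  proof
    assume "v = 0\<^sub>v n"
    then have "bs ! j = 0" if "j < n" for j
      using that by (metis v_def index_vec index_zero_vec(1))
    then have "(\<Sum>b\<in>B. r 1 b * b) = 0"
      by (simp add: sumB)
    then show False using r(2)[of 1] by simp
  qed
  ultimately have "Determinant.det E = 0"
    using det_0_iff_vec_prod_zero[OF E] v by blast
  moreover have "poly (char_poly A) c = Determinant.det E"
    unfolding char_poly_def
    by (rule poly_det_cong[of _ n]) (use A E in \<open>auto simp: char_poly_matrix_def E_def\<close>)
  moreover have "char_poly A \<in> poly_over S"
    unfolding char_poly_def
  proof (rule is_subring_det[OF is_subring_poly_over[OF subring], of _ n])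
    show "char_poly_matrix A $$ (i, j) \<in> poly_over S" if "i < n" "j < n" for i j
    proof -
      have "A $$ (i, j) \<in> S" using that r(1) bs by (auto simp: A_def n_def)
      then show ?thesis
        using that A by (auto simp: char_poly_matrix_def intro!: poly_over_pCons[OF subring] poly_over_zero[OF subring]
            is_subring_zero[OF subring] is_subring_one[OF subring]
            is_subring_uminus[OF subring] is_subring_one[OF is_subring_poly_over[OF subring]])
    qed
  qed (use A in simp)
  moreover have "Polynomial.lead_coeff (char_poly A) = 1"
    using degree_monic_char_poly[OF A] by auto
  ultimately show thesis using that by metis
qed

text \<open>Integrality of the inverse \<open>s\<close>: a monic equation of degree d for
  \<open>s\<close>, multiplied by r^(d-1), expresses \<open>s\<close> through elements of
  \<open>S\<close>. This is what later makes the inclusion of \<open>R\<close> into \<open>C\<close>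
  a local map.\<close>

lemma unit_of_subring:
  assumes r: "r \<in> S" and s: "r * s = 1"
  shows "s \<in> S"
proof -
  obtain f where f: "f \<in> poly_over S" "Polynomial.lead_coeff f = 1" "poly f s = 0"
    using integral by blast
  define d where "d = Polynomial.degree f"
  have "d \<noteq> 0"
  proof
    assume "d = 0"
    then obtain a where "f = [:a:]" using degree_eq_zeroE d_def by metis
    with f show False by simp
  qed
  then obtain e where e: "d = Suc e" by (cases d) auto
  have rs: "r ^ i * s ^ i = 1" for i
    by (metis power_mult_distrib power_one s)
  have pw: "r ^ i \<in> S" for i
    using is_subring_prod[OF subring, of "{..<i}" "\<lambda>_. r"] r by simp
  \<comment> \<open>With e = d - 1, the factor r^e absorbs every power of s up to s^e and turns the
    leading term s^d into s.\<close>
  have "0 = r ^ e * (\<Sum>i\<le>d. Polynomial.coeff f i * s ^ i)"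
    using f(3) by (simp add: poly_altdef d_def)
  also have "\<dots> = r ^ e * (\<Sum>i\<le>e. Polynomial.coeff f i * s ^ i) + r ^ e * s ^ d"
    using f(2) by (simp add: e algebra_simps flip: d_def)
  also have "r ^ e * s ^ d = s" using rs[of e] by (simp add: e algebra_simps)
  finally have s_eq: "s = - (\<Sum>i\<le>e. Polynomial.coeff f i * (r ^ e * s ^ i))"
    by (simp add: eq_neg_iff_add_eq_0 sum_distrib_left algebra_simps)
  have "r ^ e * s ^ i \<in> S" if "i \<le> e" for i
  proof -
    have "r ^ e * s ^ i = r ^ (e - i) * (r ^ i * s ^ i)"
      using that by (simp flip: power_add mult.assoc)
    with rs pw show ?thesis by simp
  qed
  then have "- (\<Sum>i\<le>e. Polynomial.coeff f i * (r ^ e * s ^ i)) \<in> S"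
    using f(1) unfolding poly_over_def
    by (intro is_subring_uminus[OF subring] is_subring_sum[OF subring]
        is_subring_mult[OF subring, of "Polynomial.coeff f _" "r ^ e * s ^ _"]) auto
  with s_eq show ?thesis by metis
qed

text \<open>In characteristic 0 the derivative of a nonconstant polynomial is nonzero and of smaller
  degree, so by minimality it cannot vanish at \<open>c\<close>. The ring \<open>A\<close> between
  \<open>S\<close> and \<open>C\<close> is left free because derivations are extended by adjoining
  one generator after another.\<close>

lemma separable_min_poly:
  assumes A: "is_subring A" "S \<subseteq> A"
  obtains f where "f \<in> poly_over A" "f \<noteq> 0" "poly f c = 0" "poly (pderiv f) c \<noteq> 0"
    "\<And>g. g \<in> poly_over A \<Longrightarrow> g \<noteq> 0 \<Longrightarrow> poly g c = 0 \<Longrightarrow>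
      Polynomial.degree f \<le> Polynomial.degree g"
proof -
  define P where "P f \<longleftrightarrow> f \<in> poly_over A \<and> f \<noteq> 0 \<and> poly f c = 0" for f
  obtain f0 where "f0 \<in> poly_over S" "Polynomial.lead_coeff f0 = 1" "poly f0 c = 0"
    by (rule integral)
  then have "P f0" using poly_over_mono[OF A(2)] by (auto simp: P_def)
  then obtain f where f: "P f" and min: "\<And>g. P g \<Longrightarrow> Polynomial.degree f \<le> Polynomial.degree g"
    using exists_least_iff[of "\<lambda>k. \<exists>f. P f \<and> Polynomial.degree f = k"]
    by (metis leI)
  have "Polynomial.degree f \<noteq> 0"
  proof
    assume "Polynomial.degree f = 0"
    then obtain a where "f = [:a:]" using degree_eq_zeroE by metis
    with f show False by (simp add: P_def)
  qed
  then obtain e where e: "Polynomial.degree f = Suc e" by (cases "Polynomial.degree f") auto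
  have "Polynomial.coeff (pderiv f) e = of_nat (Suc e) * Polynomial.lead_coeff f"
    by (simp add: coeff_pderiv e)
  moreover have "of_nat (Suc e) \<noteq> (0::'c)" using char_0 by blast
  ultimately have nz: "pderiv f \<noteq> 0"
    using f by (metis P_def coeff_0 leading_coeff_0_iff mult_eq_0_iff)
  have "pderiv f \<in> poly_over A"
    using f is_subring_mult[OF A(1)] is_subring_of_nat[OF A(1)]
    unfolding P_def poly_over_def mem_Collect_eq coeff_pderiv by blast
  moreover have "Polynomial.degree (pderiv f) < Polynomial.degree f"
    using degree_pderiv_le[of f] e by simp
  ultimately have "poly (pderiv f) c \<noteq> 0"
    using min[of "pderiv f"] nz by (auto simp: P_def)
  with f min show thesis by (intro that[of f]) (auto simp: P_def)
qed

end

section \<open>Extending derivations to the field of fractions\<close>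

lemma to_frac_eq_to_fract: "to_frac = to_fract"
  by (auto simp: to_frac_def to_fract_def)

lemma to_frac_simps [simp]:
  "to_frac 0 = 0" "to_frac 1 = 1" "to_frac (x + y) = to_frac x + to_frac y"
  "to_frac (x - y) = to_frac x - to_frac y" "to_frac (x * y) = to_frac x * to_frac y"
  "to_frac (- x) = - to_frac x"
  "to_frac x = 0 \<longleftrightarrow> x = 0" "to_frac x = to_frac y \<longleftrightarrow> x = y"
  by (simp_all add: to_frac_eq_to_fract)

text \<open>The arguments lie in \<open>C\<close> but the values in Q(C), since D_i does not map
  \<open>C\<close> into itself. Values outside \<open>A\<close> are irrelevant.\<close>

definition derivation_on :: "'c::idom set \<Rightarrow> ('c \<Rightarrow> 'c fract) \<Rightarrow> bool" where
  "derivation_on A D \<longleftrightarrow> (\<forall>x\<in>A. \<forall>y\<in>A.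
     D (x + y) = D x + D y \<and> D (x * y) = to_frac x * D y + to_frac y * D x)"

lemma derivation_onD:
  assumes "derivation_on A D" "x \<in> A" "y \<in> A"
  shows "D (x + y) = D x + D y" "D (x * y) = to_frac x * D y + to_frac y * D x"
  using assms by (auto simp: derivation_on_def)

text \<open>Extends a derivation \<open>D\<close> of \<open>A\<close> to \<open>A[X]\<close>, with values in the field of fractions taken at
  \<open>X = c\<close>, by prescribing the value \<open>u\<close> at \<open>X\<close>.\<close>

definition poly_derivation :: "('c::idom \<Rightarrow> 'c fract) \<Rightarrow> 'c \<Rightarrow> 'c fract \<Rightarrow> 'c Polynomial.poly \<Rightarrow> 'c fract" where
  "poly_derivation D c u g = poly (map_poly D g) (to_frac c) + to_frac (poly (pderiv g) c) * u"

context
  fixes A :: "'c::idom set" and D and c :: 'c and u :: "'c fract"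
  assumes A: "is_subring A" and D: "derivation_on A D"
begin

lemma derivation_on_zero: "D 0 = 0"
  using derivation_onD(2)[OF D, of 0 0] is_subring_zero[OF A] by simp

lemma poly_derivation_0: "poly_derivation D c u 0 = 0"
  by (simp add: poly_derivation_def)

lemma poly_derivation_pCons:
  "poly_derivation D c u (pCons a g) =
     D a + to_frac c * poly_derivation D c u g + to_frac (poly g c) * u"
  by (simp add: poly_derivation_def Polynomial.map_poly_pCons[of D, OF derivation_on_zero] pderiv_pCons algebra_simps)

lemma poly_derivation_add:
  assumes "g \<in> poly_over A" "h \<in> poly_over A"
  shows "poly_derivation D c u (g + h) = poly_derivation D c u g + poly_derivation D c u h"
proof -
  have "map_poly D (g + h) = map_poly D g + map_poly D h"
    using assms by (intro poly_eqI)
      (auto simp: coeff_map_poly derivation_on_zero poly_over_def intro!: derivation_onD[OF D])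
  then show ?thesis by (simp add: poly_derivation_def pderiv_add algebra_simps)
qed

lemma poly_over_pConsE:
  assumes "pCons a g \<in> poly_over A"
  shows "a \<in> A" "g \<in> poly_over A"
  using assms by (auto simp: poly_over_def coeff_pCons split: nat.splits)

lemma poly_derivation_smult:
  assumes "a \<in> A" "g \<in> poly_over A"
  shows "poly_derivation D c u (Polynomial.smult a g) =
    to_frac a * poly_derivation D c u g + to_frac (poly g c) * D a"
  using assms(2)
proof (induction g)
  case 0
  then show ?case by (simp add: poly_derivation_0)
next
  case (pCons b g)
  then have "b \<in> A" "g \<in> poly_over A" using poly_over_pConsE by blast+
  with pCons derivation_onD(2)[OF D assms(1) \<open>b \<in> A\<close>] show ?case
    by (simp add: poly_derivation_pCons algebra_simps)
qed

lemma poly_derivation_mult: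
  assumes "g \<in> poly_over A" "h \<in> poly_over A"
  shows "poly_derivation D c u (g * h) =
    to_frac (poly g c) * poly_derivation D c u h + to_frac (poly h c) * poly_derivation D c u g"
  using assms(1)
proof (induction g)
  case 0
  then show ?case by (simp add: poly_derivation_0)
next
  case (pCons a g)
  then have a: "a \<in> A" and g: "g \<in> poly_over A" using poly_over_pConsE by blast+
  have "pCons 0 (g * h) \<in> poly_over A"
    by (intro poly_over_pCons poly_over_mult A g assms is_subring_zero)
  with pCons g a assms A show ?case
    by (simp add: poly_derivation_add poly_over_smult poly_derivation_smult
        poly_derivation_pCons derivation_on_zero algebra_simps)
qed

text \<open>Pseudo-division by a polynomial of minimal degree, one leading term at a time.\<close>

lemma poly_derivation_eq_0:
  assumes f: "f \<in> poly_over A" "f \<noteq> 0" "poly f c = 0" "poly_derivation D c u f = 0"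
    and min: "\<And>g. g \<in> poly_over A \<Longrightarrow> g \<noteq> 0 \<Longrightarrow> poly g c = 0 \<Longrightarrow>
      Polynomial.degree f \<le> Polynomial.degree g"
    and g: "g \<in> poly_over A" "poly g c = 0"
  shows "poly_derivation D c u g = 0"
  using g
proof (induction "Polynomial.degree g" arbitrary: g rule: less_induct)
  case less
  show ?case
  proof (cases "g = 0")
    case False
    \<comment> \<open>The multiple of \<open>f\<close> whose leading term cancels that of lead(f) g;
      the factor lead(f) replaces division by it.\<close>
    define q where "q = Polynomial.monom (Polynomial.lead_coeff g) (Polynomial.degree g - Polynomial.degree f)"
    have le: "Polynomial.degree f \<le> Polynomial.degree g" using min less.prems False by blast
    have lf: "Polynomial.lead_coeff f \<in> A" using f(1) by (simp add: poly_over_def)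
    have q: "q \<in> poly_over A"
      using less.prems is_subring_zero[OF A] by (auto simp: q_def poly_over_def)
    define h where "h = Polynomial.smult (Polynomial.lead_coeff f) g - q * f"
    have h: "h \<in> poly_over A" "poly h c = 0"
      using q lf less.prems f A by (auto simp: h_def intro!: poly_over_diff poly_over_mult poly_over_smult)
    have decomp: "Polynomial.smult (Polynomial.lead_coeff f) g = h + q * f" by (simp add: h_def)
    \<comment> \<open>If \<open>g\<close> is constant its degree cannot drop any further; then
      \<open>f\<close> is constant too and the cancellation is complete.\<close>
    have "poly_derivation D c u h = 0"
    proof (cases "Polynomial.degree g = 0")
      case True
      then obtain a b where "g = [:a:]" "f = [:b:]" using le degree_eq_zeroE by (metis le_zero_eq)
      then have "h = 0" by (simp add: h_def q_def monom_0)
      then show ?thesis by (simp add: poly_derivation_0)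
    next
      case nz: False
      have "Polynomial.degree h < Polynomial.degree g"
      proof (rule degree_lessI)
        have "Polynomial.degree (q * f) \<le> Polynomial.degree g"
          using degree_mult_le[of q f] le
            degree_monom_le[of "Polynomial.lead_coeff g" "Polynomial.degree g - Polynomial.degree f"]
          unfolding q_def by linarith
        then have "Polynomial.coeff h k = 0" if "k > Polynomial.degree g" for k
          using that by (simp add: h_def coeff_eq_0)
        moreover have "Polynomial.coeff h (Polynomial.degree g) = 0"
          using le by (simp add: h_def q_def coeff_monom_mult)
        ultimately show "\<forall>k\<ge>Polynomial.degree g. Polynomial.coeff h k = 0"
          by (metis le_neq_implies_less)
      qed (use nz in simp)
      then show ?thesis using less.hyps h by blast
    qed
    \<comment> \<open>The product \<open>q * f\<close> contributes nothing because both
      \<open>f\<close> and its derivation value vanish at \<open>c\<close>. Afterwards lead(f) can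
      be cancelled, as the other term of the product rule carries the factor g(c) = 0.\<close>
    then have "poly_derivation D c u (Polynomial.smult (Polynomial.lead_coeff f) g) = 0"
      unfolding decomp using h q f A
      by (simp add: poly_derivation_add poly_over_mult poly_derivation_mult)
    then show ?thesis
      using poly_derivation_smult[OF lf less.prems(1)] less.prems(2) f(2) by simp
  qed (simp add: poly_derivation_0)
qed

end

text \<open>This image is the ring A[c] obtained by adjoining \<open>c\<close>.\<close>

lemma is_subring_image_poly:
  assumes A: "is_subring A"
  shows "is_subring ((\<lambda>g. poly g c) ` poly_over A)"
proof -
  have "1 \<in> (\<lambda>g. poly g c) ` poly_over A"
    by (rule image_eqI[of _ _ 1]) (use is_subring_one[OF is_subring_poly_over[OF A]] in auto)
  moreover have "poly g c - poly h c \<in> (\<lambda>g. poly g c) ` poly_over A"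
    "poly g c * poly h c \<in> (\<lambda>g. poly g c) ` poly_over A"
    if "g \<in> poly_over A" "h \<in> poly_over A" for g h
    using poly_over_diff[OF A that] poly_over_mult[OF A that]
    by (metis (mono_tags, lifting) poly_diff rev_image_eqI, metis (mono_tags, lifting) poly_mult rev_image_eqI)
  ultimately show ?thesis by (auto simp: is_subring_def)
qed

text \<open>The value at \<open>c\<close> is forced by differentiating f(c) = 0 and exists because
  f'(c) is nonzero. With this value the derivation of A[X] kills every polynomial over
  \<open>A\<close> that vanishes at \<open>c\<close>, so it descends to A[c].\<close>

lemma derivation_on_adjoin:
  assumes A: "is_subring A" and D: "derivation_on A D"
    and f: "f \<in> poly_over A" "f \<noteq> 0" "poly f c = 0" "poly (pderiv f) c \<noteq> 0"
    and min: "\<And>g. g \<in> poly_over A \<Longrightarrow> g \<noteq> 0 \<Longrightarrow> poly g c = 0 \<Longrightarrow>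
      Polynomial.degree f \<le> Polynomial.degree g"
  obtains D' where "derivation_on ((\<lambda>g. poly g c) ` poly_over A) D'" "\<And>x. x \<in> A \<Longrightarrow> D' x = D x"
proof -
  \<comment> \<open>The solution of f^D(c) + f'(c) u = 0, where f^D has the coefficients of
    \<open>f\<close> differentiated.\<close>
  define u where "u = - poly (map_poly D f) (to_frac c) / to_frac (poly (pderiv f) c)"
  let ?\<Delta> = "poly_derivation D c u"
  have fu: "?\<Delta> f = 0" using f(4) by (simp add: poly_derivation_def u_def)
  define D' where "D' x = ?\<Delta> (SOME g. g \<in> poly_over A \<and> poly g c = x)" for x
  have D': "D' (poly g c) = ?\<Delta> g" if g: "g \<in> poly_over A" for g
  proof -
    define h where "h = (SOME h. h \<in> poly_over A \<and> poly h c = poly g c)"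
    have h: "h \<in> poly_over A" "poly h c = poly g c"
      using someI[of "\<lambda>h. h \<in> poly_over A \<and> poly h c = poly g c" g, folded h_def] g by blast+
    have "?\<Delta> (h - g) = 0"
    proof (rule poly_derivation_eq_0[OF A D f(1-3) fu])
      show "h - g \<in> poly_over A" using h g by (intro poly_over_diff[OF A])
      show "poly (h - g) c = 0" using h by (simp only: poly_diff diff_self)
    qed (rule min)
    moreover have "?\<Delta> h = ?\<Delta> ((h - g) + g)" by simp
    moreover have "\<dots> = ?\<Delta> (h - g) + ?\<Delta> g"
      using h g by (intro poly_derivation_add[OF A D] poly_over_diff[OF A])
    ultimately show ?thesis unfolding D'_def h_def[symmetric] by simp
  qed
  have "derivation_on ((\<lambda>g. poly g c) ` poly_over A) D'"
    unfolding derivation_on_def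
  proof safe
    fix g h assume gh: "g \<in> poly_over A" "h \<in> poly_over A"
    show "D' (poly g c + poly h c) = D' (poly g c) + D' (poly h c)"
      using D'[OF poly_over_add[OF A gh]] D' gh by (simp add: poly_derivation_add[OF A D])
    show "D' (poly g c * poly h c) = to_frac (poly g c) * D' (poly h c) + to_frac (poly h c) * D' (poly g c)"
      using D'[OF poly_over_mult[OF A gh]] D' gh by (simp add: poly_derivation_mult[OF A D])
  qed
  moreover have "D' x = D x" if "x \<in> A" for x
  proof -
    have "[:x:] \<in> poly_over A" using that A by (intro poly_over_pCons poly_over_zero)
    from D'[OF this] show ?thesis
      by (simp add: poly_derivation_pCons[OF A D] poly_derivation_0[OF A D])
  qed
  ultimately show thesis using that by blast
qed

text \<open>Quotient rule. Independence of the representing fraction follows by differentiating the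
  cross-multiplied equation a b' = a' b and combining the result with the equation itself.\<close>

lemma derivation_fract_ex:
  assumes D: "derivation_on (UNIV :: 'c::idom set) D"
  obtains D' where "derivation D'" "\<And>c. D' (to_frac c) = D c"
proof -
  note [simp] = derivation_onD[OF D UNIV_I UNIV_I]
  define N where "N a b = (to_frac b * D a - to_frac a * D b) / (to_frac b * to_frac b)" for a b
  have N_eq: "N a b = N a' b'" if "b \<noteq> 0" "b' \<noteq> 0" "a * b' = a' * b" for a b a' b'
  proof -
    have "to_frac (a * b') = to_frac (a' * b)" using that(3) by (rule arg_cong)
    then have 1: "to_frac a * to_frac b' = to_frac a' * to_frac b" by simp
    have "D (a * b') = D (a' * b)" using that(3) by (rule arg_cong)
    then have 2: "to_frac a * D b' + to_frac b' * D a = to_frac a' * D b + to_frac b * D a'" by simp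
    define x y x' y' where "x = to_frac a" "y = to_frac b" "x' = to_frac a'" "y' = to_frac b'"
    note xy = this
    have "y \<noteq> 0" "y' \<noteq> 0" using that by (auto simp: xy)
    have 1: "x * y' = x' * y" using 1 by (simp add: xy)
    have 2: "x * D b' + y' * D a = x' * D b + y * D a'" using 2 by (simp add: xy)
    have "(y * D a - x * D b) * (y' * y') = (y' * D a' - x' * D b') * (y * y)"
    proof -
      have "(y * D a - x * D b) * (y' * y') =
          y * y' * (x * D b' + y' * D a) - y * (x * y') * D b' - (x * y') * y' * D b"
        by (simp add: algebra_simps)
      also have "\<dots> = y * y' * (x' * D b + y * D a') - y * (x' * y) * D b' - (x' * y) * y' * D b"
        unfolding 1 2 ..
      also have "\<dots> = (y' * D a' - x' * D b') * (y * y)"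
        by (simp add: algebra_simps)
      finally show ?thesis .
    qed
    then show ?thesis
      using \<open>y \<noteq> 0\<close> \<open>y' \<noteq> 0\<close> unfolding N_def xy[symmetric] by (simp add: frac_eq_eq)
  qed
  define num where "num x = fst (SOME (a, b). b \<noteq> 0 \<and> x = to_frac a / to_frac b)" for x :: "'c fract"
  define den where "den x = snd (SOME (a, b). b \<noteq> 0 \<and> x = to_frac a / to_frac b)" for x :: "'c fract"
  have nd: "den x \<noteq> 0" "x = to_frac (num x) / to_frac (den x)" for x
  proof -
    have "\<exists>ab. case ab of (a, b) \<Rightarrow> b \<noteq> 0 \<and> x = to_frac a / to_frac b"
      by (cases x) (auto simp: to_frac_def)
    from someI_ex[OF this] show "den x \<noteq> 0" "x = to_frac (num x) / to_frac (den x)"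
      by (auto simp: num_def den_def split: prod.splits)
  qed
  define D' where "D' x = N (num x) (den x)" for x
  have D': "D' (to_frac a / to_frac b) = N a b" if "b \<noteq> 0" for a b
  proof -
    let ?x = "to_frac a / to_frac b"
    have "to_frac a / to_frac b = to_frac (num ?x) / to_frac (den ?x)" using nd(2) .
    then have "to_frac (a * den ?x) = to_frac (num ?x * b)"
      using nd(1)[of ?x] that by (simp add: frac_eq_eq)
    then have "a * den ?x = num ?x * b" by (simp only: to_frac_simps(8))
    then show ?thesis unfolding D'_def using N_eq[OF that nd(1), of a ?x] by metis
  qed
  have "D' (x + y) = D' x + D' y" "D' (x * y) = x * D' y + y * D' x" for x y
  proof -
    define a b c d where "a = num x" "b = den x" "c = num y" "d = den y"
    have x: "x = to_frac a / to_frac b" "b \<noteq> 0" and y: "y = to_frac c / to_frac d" "d \<noteq> 0"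
      using nd unfolding a_b_c_d_def by auto
    have 1: "x + y = to_frac (a * d + c * b) / to_frac (b * d)"
      and 2: "x * y = to_frac (a * c) / to_frac (b * d)"
      using x y by (simp_all add: field_simps)
    have bd: "b * d \<noteq> 0" using x y by simp
    have D1: "D' (x + y) = N (a * d + c * b) (b * d)" and D2: "D' (x * y) = N (a * c) (b * d)"
      and Dx: "D' x = N a b" and Dy: "D' y = N c d"
      using D'[OF bd] D'[OF x(2)] D'[OF y(2)] unfolding 1 2 by (simp_all only: x(1) y(1))
    show "D' (x + y) = D' x + D' y"
      using x(2) y(2) unfolding D1 Dx Dy N_def
      by (simp add: divide_simps) (simp add: algebra_simps)
    show "D' (x * y) = x * D' y + y * D' x"
      using x(2) y(2) unfolding D2 Dx Dy N_def unfolding x(1) y(1)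
      by (simp add: divide_simps) (simp add: algebra_simps)
  qed
  then have "derivation D'" by (simp add: derivation_def)
  \<comment> \<open>The quotient rule at c/1 gives back \<open>D c\<close> only because the
    derivation vanishes at 1.\<close>
  moreover have "D 1 = D 1 + D 1"
    using derivation_onD(2)[OF D UNIV_I UNIV_I, of 1 1] by (simp only: to_frac_simps mult_1)
  then have "D 1 = 0" by (metis add_cancel_right_right)
  then have "D' (to_frac c) = D c" for c using D'[of 1 c] by (simp add: N_def)
  ultimately show thesis using that by blast
qed

context finite_subring_extension
begin

text \<open>The finitely many generators are adjoined one at a time; a subring containing
  \<open>S\<close> and \<open>B\<close> contains every \<open>S\<close>-linear combination of
  \<open>B\<close>, hence is all of \<open>C\<close>.\<close>

lemma derivation_on_extend:
  assumes D: "derivation_on S D"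
  obtains D' where "derivation_on UNIV D'" "\<And>x. x \<in> S \<Longrightarrow> D' x = D x"
proof -
  have "\<exists>A D'. is_subring A \<and> S \<union> B' \<subseteq> A \<and> derivation_on A D' \<and> (\<forall>x\<in>S. D' x = D x)"
    if "finite B'" for B'
    using that
  proof induction
    case empty
    then show ?case using subring D by auto
  next
    case (insert c B')
    then obtain A D' where A: "is_subring A" "S \<union> B' \<subseteq> A"
      and D': "derivation_on A D'" "\<forall>x\<in>S. D' x = D x" by blast
    have SA: "S \<subseteq> A" using A by blast
    obtain f where f: "f \<in> poly_over A" "f \<noteq> 0" "poly f c = 0" "poly (pderiv f) c \<noteq> 0"
      "\<And>g. g \<in> poly_over A \<Longrightarrow> g \<noteq> 0 \<Longrightarrow> poly g c = 0 \<Longrightarrow>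
        Polynomial.degree f \<le> Polynomial.degree g"
      using separable_min_poly[OF A(1) SA, of c] by blast
    let ?A = "(\<lambda>g. poly g c) ` poly_over A"
    obtain D'' where "derivation_on ?A D''" "\<And>x. x \<in> A \<Longrightarrow> D'' x = D' x"
      using derivation_on_adjoin[OF A(1) D'(1) f] by metis
    moreover have "A \<subseteq> ?A"
    proof
      fix x assume "x \<in> A"
      then have "[:x:] \<in> poly_over A" using A by (intro poly_over_pCons poly_over_zero)
      then show "x \<in> ?A" by (intro image_eqI[of _ _ "[:x:]"]) auto
    qed
    moreover have "c \<in> ?A"
    proof (rule image_eqI[of _ _ "[:0,1:]"])
      show "[:0,1:] \<in> poly_over A"
        using A by (intro poly_over_pCons poly_over_zero is_subring_one is_subring_zero)
    qed simp
    ultimately show ?case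
      using A SA D'(2) is_subring_image_poly[OF A(1), of c]
      by (intro exI[of _ ?A] exI[of _ D'']) auto
  qed
  from this[OF finite_B] obtain A D' where A: "is_subring A" "S \<union> B \<subseteq> A"
    and D': "derivation_on A D'" "\<forall>x\<in>S. D' x = D x" by blast
  have "c \<in> A" for c
  proof -
    obtain r where "\<forall>b\<in>B. r b \<in> S" "c = (\<Sum>b\<in>B. r b * b)" using span by blast
    with A show ?thesis
      by (auto intro!: is_subring_sum[OF A(1)] is_subring_mult[OF A(1)])
  qed
  then have "A = UNIV" by blast
  with D' show thesis by (intro that[of D']) auto
qed

end

section \<open>Modules and their quotients\<close>

context module
begin

lemma submodule_abelian_subgroup: "submodule N R M \<Longrightarrow> abelian_subgroup N M"
  by (intro abelian_subgroupI3 additive_subgroup.intro submodule.axioms abelian_group_axioms)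

lemma submodule_zero: "submodule N R M \<Longrightarrow> \<zero>\<^bsub>M\<^esub> \<in> N"
  using submodule_abelian_subgroup abelian_subgroup.axioms(1) additive_subgroup.zero_closed by blast

lemma submodule_minus: "submodule N R M \<Longrightarrow> x \<in> N \<Longrightarrow> y \<in> N \<Longrightarrow> x \<ominus>\<^bsub>M\<^esub> y \<in> N"
  unfolding a_minus_def by (intro submoduleE(3,5))

lemma submodule_gen:
  assumes "S \<subseteq> carrier M"
  shows "submodule (gen_submodule R M S) R M"
proof (rule submoduleI)
  show "gen_submodule R M S \<subseteq> carrier M"
    using assms carrier_is_submodule by (auto simp: gen_submodule_def)
qed (auto simp: gen_submodule_def submodule_zero intro: submoduleE)

lemma gen_submodule_incl: "S \<subseteq> gen_submodule R M S"
  by (auto simp: gen_submodule_def)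

lemma gen_submodule_minimal: "submodule N R M \<Longrightarrow> S \<subseteq> N \<Longrightarrow> gen_submodule R M S \<subseteq> N"
  by (auto simp: gen_submodule_def)

lemma quot_carrier: "carrier (quot_module M N) = (\<lambda>x. N +>\<^bsub>M\<^esub> x) ` carrier M"
  by (auto simp: quot_module_def A_RCOSETS_def')

context
  fixes N
  assumes N: "submodule N R M"
begin

interpretation N: abelian_subgroup N M
  using N by (rule submodule_abelian_subgroup)

lemma mem_coset_iff:
  "x \<in> carrier M \<Longrightarrow> y \<in> carrier M \<Longrightarrow> x \<in> N +>\<^bsub>M\<^esub> y \<longleftrightarrow> x \<ominus>\<^bsub>M\<^esub> y \<in> N"
  unfolding a_minus_def by (rule N.a_rcos_module)

lemma coset_eq_iff:
  assumes "x \<in> carrier M" "y \<in> carrier M"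
  shows "N +>\<^bsub>M\<^esub> x = N +>\<^bsub>M\<^esub> y \<longleftrightarrow> x \<ominus>\<^bsub>M\<^esub> y \<in> N"
  using assms N.a_rcos_self N.a_repr_independence' mem_coset_iff
  by (metis submodule.axioms(1)[OF N] a_repr_independence)

lemma coset_eq_zero_iff: "x \<in> carrier M \<Longrightarrow> N +>\<^bsub>M\<^esub> x = N \<longleftrightarrow> x \<in> N"
  using a_coset_join1 a_coset_join2 submodule.axioms(1)[OF N] by blast

lemma quot_zero: "\<zero>\<^bsub>quot_module M N\<^esub> = N"
  by (simp add: quot_module_def)

lemma quot_add:
  "x \<in> carrier M \<Longrightarrow> y \<in> carrier M \<Longrightarrow>
    (N +>\<^bsub>M\<^esub> x) \<oplus>\<^bsub>quot_module M N\<^esub> (N +>\<^bsub>M\<^esub> y) = N +>\<^bsub>M\<^esub> (x \<oplus>\<^bsub>M\<^esub> y)"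
  by (simp add: quot_module_def N.a_rcos_sum)

text \<open>The scalar action on cosets is encoded as a union over all representatives. It collapses
  to a single coset because two representatives differ by an element of \<open>N\<close>, and
  \<open>N\<close> is stable under scalars.\<close>

lemma quot_smult:
  assumes a: "a \<in> carrier R" and x: "x \<in> carrier M"
  shows "a \<odot>\<^bsub>quot_module M N\<^esub> (N +>\<^bsub>M\<^esub> x) = N +>\<^bsub>M\<^esub> (a \<odot>\<^bsub>M\<^esub> x)"
proof -
  have "N +>\<^bsub>M\<^esub> (a \<odot>\<^bsub>M\<^esub> y) = N +>\<^bsub>M\<^esub> (a \<odot>\<^bsub>M\<^esub> x)" if y: "y \<in> N +>\<^bsub>M\<^esub> x" for y
  proof -
    have yc: "y \<in> carrier M" using N.a_elemrcos_carrier x y by blast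
    have "a \<odot>\<^bsub>M\<^esub> (y \<ominus>\<^bsub>M\<^esub> x) \<in> N"
      using y yc x a submoduleE(4)[OF N] mem_coset_iff by blast
    moreover have "a \<odot>\<^bsub>M\<^esub> (y \<ominus>\<^bsub>M\<^esub> x) = a \<odot>\<^bsub>M\<^esub> y \<ominus>\<^bsub>M\<^esub> a \<odot>\<^bsub>M\<^esub> x"
      using a x yc by (simp add: a_minus_def smult_r_distr smult_r_minus)
    ultimately show ?thesis using a x yc coset_eq_iff by auto
  qed
  moreover have "x \<in> N +>\<^bsub>M\<^esub> x" using N.a_rcos_self x by blast
  ultimately have "(\<Union>y\<in>N +>\<^bsub>M\<^esub> x. N +>\<^bsub>M\<^esub> (a \<odot>\<^bsub>M\<^esub> y)) = N +>\<^bsub>M\<^esub> (a \<odot>\<^bsub>M\<^esub> x)"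
    by (intro UN_constant_eq ballI)
  then show ?thesis by (simp add: quot_module_def)
qed

lemma module_quot: "module R (quot_module M N)"
proof -
  let ?Q = "quot_module M N"
  have N_eq: "N = N +>\<^bsub>M\<^esub> \<zero>\<^bsub>M\<^esub>"
    using submodule_zero[OF N] coset_eq_zero_iff[of "\<zero>\<^bsub>M\<^esub>"] by simp
  have cases: P if "A \<in> carrier ?Q" "\<And>x. x \<in> carrier M \<Longrightarrow> A = N +>\<^bsub>M\<^esub> x \<Longrightarrow> P" for A P
    using that unfolding quot_carrier by (elim imageE)
  have cl: "N +>\<^bsub>M\<^esub> x \<in> carrier ?Q" if "x \<in> carrier M" for x
    using that unfolding quot_carrier by (rule imageI)
  have "abelian_group ?Q"
  proof (rule abelian_groupI)
    fix A assume A: "A \<in> carrier ?Q"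
    show "\<exists>A'\<in>carrier ?Q. A' \<oplus>\<^bsub>?Q\<^esub> A = \<zero>\<^bsub>?Q\<^esub>"
    proof (rule cases[OF A])
      fix x assume x: "x \<in> carrier M" "A = N +>\<^bsub>M\<^esub> x"
      show ?thesis
        using x N_eq by (intro bexI[of _ "N +>\<^bsub>M\<^esub> (\<ominus>\<^bsub>M\<^esub> x)"] cl) (simp_all add: quot_add quot_zero M.l_neg)
    qed
    show "\<zero>\<^bsub>?Q\<^esub> \<oplus>\<^bsub>?Q\<^esub> A = A"
    proof (rule cases[OF A])
      fix x assume x: "x \<in> carrier M" "A = N +>\<^bsub>M\<^esub> x"
      show ?thesis unfolding quot_zero
        by (subst N_eq) (simp add: x quot_add)
    qed
  next
    show "\<zero>\<^bsub>?Q\<^esub> \<in> carrier ?Q" unfolding quot_zero by (subst N_eq) (simp add: cl)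
  qed (elim cases; simp add: quot_add cl M.a_ac)+
  then show ?thesis
    by (intro moduleI R.cring_axioms; (elim cases)?)
      (simp_all add: quot_add quot_smult cl smult_l_distr smult_r_distr smult_assoc1)
qed

end

end

lemma module_free:
  fixes R :: "('a, 'r) ring_scheme" and B :: "'b set"
  assumes "cring R"
  shows "module R (free_module R B)"
proof -
  interpret cring R by fact
  have add: "finite {b. g b \<oplus>\<^bsub>R\<^esub> h b \<noteq> \<zero>\<^bsub>R\<^esub>}"
    if "finite {b. g b \<noteq> \<zero>\<^bsub>R\<^esub>}" "finite {b. h b \<noteq> \<zero>\<^bsub>R\<^esub>}" for g h :: "'b \<Rightarrow> 'a"
    by (rule finite_subset[OF _ finite_UnI[OF that]]) auto
  have smult: "finite {b. a \<otimes>\<^bsub>R\<^esub> g b \<noteq> \<zero>\<^bsub>R\<^esub>}"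
    if "finite {b. g b \<noteq> \<zero>\<^bsub>R\<^esub>}" "a \<in> carrier R" for a and g :: "'b \<Rightarrow> 'a"
    by (rule finite_subset[OF _ that(1)]) (use that in auto)
  show ?thesis
  proof (rule moduleI)
    show "abelian_group (free_module R B)"
    proof (rule abelian_groupI)
      show "\<exists>h\<in>carrier (free_module R B). h \<oplus>\<^bsub>free_module R B\<^esub> g = \<zero>\<^bsub>free_module R B\<^esub>"
        if "g \<in> carrier (free_module R B)" for g
        using that smult[of g "\<ominus>\<^bsub>R\<^esub> \<one>\<^bsub>R\<^esub>"]
        by (intro bexI[of _ "\<lambda>b. (\<ominus>\<^bsub>R\<^esub> \<one>\<^bsub>R\<^esub>) \<otimes>\<^bsub>R\<^esub> g b"]) (auto simp: free_module_def l_minus l_neg)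
    qed (auto simp: free_module_def add a_ac)
  qed (auto simp: free_module_def add smult l_distr r_distr m_assoc intro: assms)
qed

section \<open>Rings and modules over types\<close>

abbreviation type_ring :: "'a::comm_ring_1 ring" where
  "type_ring \<equiv> ring_of_type_algebra"

lemma type_ring_simps [simp]:
  "carrier type_ring = UNIV" "x \<otimes>\<^bsub>type_ring\<^esub> y = x * y" "\<one>\<^bsub>type_ring\<^esub> = 1"
  "\<zero>\<^bsub>type_ring\<^esub> = 0" "x \<oplus>\<^bsub>type_ring\<^esub> y = x + y"
  by (simp_all add: ring_of_type_algebra_def)

lemma cring_type_ring: "cring (type_ring :: 'a::comm_ring_1 ring)"
  by (rule cring_from_type_algebra)

lemma type_ring_minus [simp]:
  fixes x y :: "'a::comm_ring_1"
  shows "\<ominus>\<^bsub>type_ring\<^esub> x = - x" "x \<ominus>\<^bsub>type_ring\<^esub> y = x - y"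
proof -
  interpret cring "type_ring :: 'a ring" by (rule cring_type_ring)
  show "\<ominus>\<^bsub>type_ring\<^esub> x = - x" for x :: 'a
    using add.inv_equality[of "- x" x] by (simp add: a_inv_def)
  then show "x \<ominus>\<^bsub>type_ring\<^esub> y = x - y" by (simp add: a_minus_def)
qed

lemma type_ring_nat_mult [simp]: "[k] \<cdot>\<^bsub>type_ring\<^esub> x = of_nat k * (x::'a::comm_ring_1)"
proof -
  interpret cring "type_ring :: 'a ring" by (rule cring_type_ring)
  show ?thesis by (induction k) (simp_all add: algebra_simps)
qed

lemma type_ring_finsum [simp]: "finsum type_ring f A = (sum f A :: 'a::comm_ring_1)"
proof -
  interpret cring "type_ring :: 'a ring" by (rule cring_type_ring)
  show ?thesis by (induction A rule: infinite_finite_induct) simp_all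
qed

lemma frac_module_simps [simp]:
  "carrier frac_module = UNIV" "\<zero>\<^bsub>frac_module\<^esub> = 0" "x \<oplus>\<^bsub>frac_module\<^esub> y = x + y"
  "a \<odot>\<^bsub>frac_module\<^esub> x = to_frac a * x"
  by (simp_all add: frac_module_def)

lemma module_frac_module: "module type_ring (frac_module :: ('c::idom, 'c fract) module)"
  by (auto intro!: moduleI abelian_groupI cring_type_ring exI[of _ "- _"] simp: algebra_simps)

lemma submodule_frac_moduleI:
  assumes "0 \<in> H" "\<And>x y. x \<in> H \<Longrightarrow> y \<in> H \<Longrightarrow> x + y \<in> H"
    "\<And>c x. x \<in> H \<Longrightarrow> to_frac c * x \<in> H"
  shows "submodule H type_ring (frac_module :: ('c::idom, 'c fract) module)"
proof -
  interpret module "type_ring :: 'c ring" "frac_module :: ('c, 'c fract) module"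
    by (rule module_frac_module)
  show ?thesis
  proof (rule submoduleI)
    show "\<ominus>\<^bsub>frac_module\<^esub> x \<in> H" if "x \<in> H" for x
      using assms(3)[OF that, of "-1"] smult_l_minus[of 1 x] by simp
  qed (use assms in auto)
qed

lemma submodule_range_to_frac:
  "submodule (range to_frac) type_ring (frac_module :: ('c::idom, 'c fract) module)"
proof (rule submodule_frac_moduleI)
  show "0 \<in> range to_frac" by (rule range_eqI[of _ _ 0]) simp
  show "x + y \<in> range to_frac" if "x \<in> range to_frac" "y \<in> range to_frac" for x y :: "'c fract"
    using that to_frac_simps(3)[symmetric] by blast
  show "to_frac c * x \<in> range to_frac" if "x \<in> range to_frac" for c and x :: "'c fract"
    using that to_frac_simps(5)[symmetric] by blast
qed

section \<open>Derivations into modules\<close>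

text \<open>No base ring is built in. What happens on constants, or on the subring \<open>S\<close>,
  is stated separately as a condition on the values there.\<close>

definition module_derivation :: "('c::comm_ring_1, 'b, 'm) module_scheme \<Rightarrow> ('c \<Rightarrow> 'b) \<Rightarrow> bool" where
  "module_derivation M \<delta> \<longleftrightarrow> (\<forall>x. \<delta> x \<in> carrier M) \<and>
     (\<forall>x y. \<delta> (x + y) = \<delta> x \<oplus>\<^bsub>M\<^esub> \<delta> y) \<and>
     (\<forall>x y. \<delta> (x * y) = x \<odot>\<^bsub>M\<^esub> \<delta> y \<oplus>\<^bsub>M\<^esub> y \<odot>\<^bsub>M\<^esub> \<delta> x)"

lemma module_derivationD:
  assumes "module_derivation M \<delta>"
  shows "\<delta> x \<in> carrier M" "\<delta> (x + y) = \<delta> x \<oplus>\<^bsub>M\<^esub> \<delta> y"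
    "\<delta> (x * y) = x \<odot>\<^bsub>M\<^esub> \<delta> y \<oplus>\<^bsub>M\<^esub> y \<odot>\<^bsub>M\<^esub> \<delta> x"
  using assms by (auto simp: module_derivation_def)

text \<open>Chain rule modulo \<open>N\<close>: the derivatives of the coefficients lie in
  \<open>N\<close>, so only the term f'(c) dc survives outside it.\<close>

lemma module_derivation_poly:
  fixes S :: "'c::idom set"
  assumes "module type_ring M" and N: "submodule N type_ring M"
    and \<delta>: "module_derivation M \<delta>" "\<delta> ` S \<subseteq> N"
    and f: "f \<in> poly_over S" and S: "is_subring S"
  shows "\<exists>y\<in>N. \<delta> (poly f c) = poly (pderiv f) c \<odot>\<^bsub>M\<^esub> \<delta> c \<oplus>\<^bsub>M\<^esub> y"
  using f
proof (induction f)
  interpret M: module "type_ring :: 'c ring" M by fact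
  note \<delta>_simps = module_derivationD[OF \<delta>(1)]
  note N_closed = M.submoduleE(4,5)[OF N]
  case 0
  have "\<delta> 0 \<in> N" using \<delta>(2) is_subring_zero[OF S] by blast
  then show ?case using \<delta>_simps(1) M.smult_l_null[of "\<delta> c"] by (intro bexI[of _ "\<delta> 0"]) simp_all
next
  interpret M: module "type_ring :: 'c ring" M by fact
  note \<delta>_simps = module_derivationD[OF \<delta>(1)]
  note N_closed = M.submoduleE(4,5)[OF N]
  case (pCons a f)
  have a: "a \<in> S" and f: "f \<in> poly_over S"
    using pCons.prems by (auto simp: poly_over_def coeff_pCons split: nat.splits)
  obtain y where y: "y \<in> N" "\<delta> (poly f c) = poly (pderiv f) c \<odot>\<^bsub>M\<^esub> \<delta> c \<oplus>\<^bsub>M\<^esub> y"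
    using pCons.IH[OF f] by blast
  have yc: "y \<in> carrier M" using M.submoduleE(1)[OF N] y by blast
  have sm: "c \<odot>\<^bsub>M\<^esub> (x \<odot>\<^bsub>M\<^esub> \<delta> c) = (c * x) \<odot>\<^bsub>M\<^esub> \<delta> c" for x
    using M.smult_assoc1[of c x "\<delta> c"] \<delta>_simps(1) by simp
  have "\<delta> (poly (pCons a f) c) =
      \<delta> a \<oplus>\<^bsub>M\<^esub> ((c * poly (pderiv f) c) \<odot>\<^bsub>M\<^esub> \<delta> c \<oplus>\<^bsub>M\<^esub> c \<odot>\<^bsub>M\<^esub> y \<oplus>\<^bsub>M\<^esub> poly f c \<odot>\<^bsub>M\<^esub> \<delta> c)"
    using \<delta>_simps(1) yc by (simp add: \<delta>_simps(2,3) y(2) M.smult_r_distr sm)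
  also have "\<dots> = ((poly f c + c * poly (pderiv f) c) \<odot>\<^bsub>M\<^esub> \<delta> c) \<oplus>\<^bsub>M\<^esub> (\<delta> a \<oplus>\<^bsub>M\<^esub> c \<odot>\<^bsub>M\<^esub> y)"
    using M.smult_l_distr[of "poly f c" "c * poly (pderiv f) c" "\<delta> c"] \<delta>_simps(1) yc
    by (simp add: M.M.a_ac)
  finally show ?case
    using a \<delta>(2) y N_closed by (intro bexI[of _ "\<delta> a \<oplus>\<^bsub>M\<^esub> c \<odot>\<^bsub>M\<^esub> y"]) (auto simp: pderiv_pCons)
qed

text \<open>For a single \<open>c\<close> the chain rule applied to f(c) = 0 shows that f'(c) moves
  its derivative into \<open>N\<close>. The submodule \<open>N\<close> is kept general so that the
  same argument covers uniqueness of derivations, common denominators and the intersection of the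
  filtration.\<close>

lemma (in finite_subring_extension) module_derivation_torsion:
  assumes "module type_ring M" and N: "submodule N type_ring M"
    and \<delta>: "module_derivation M \<delta>" "\<delta> ` S \<subseteq> N"
  obtains b where "b \<noteq> 0" "\<And>c. b \<odot>\<^bsub>M\<^esub> \<delta> c \<in> N"
proof -
  interpret M: module "type_ring :: 'c ring" M by fact
  note \<delta>_simps = module_derivationD[OF \<delta>(1)]
  note N_closed = M.submoduleE(4,5)[OF N]
  have zero: "\<delta> 0 \<in> N" using \<delta>(2) is_subring_zero[OF subring] by blast
  have assoc: "x \<odot>\<^bsub>M\<^esub> (y \<odot>\<^bsub>M\<^esub> z) = (x * y) \<odot>\<^bsub>M\<^esub> z" if "z \<in> carrier M" for x y z
    using M.smult_assoc1[of x y z] that by simp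
  have "\<exists>b. b \<noteq> 0 \<and> b \<odot>\<^bsub>M\<^esub> \<delta> c \<in> N" for c
  proof -
    obtain f where f: "f \<in> poly_over S" "poly f c = 0" "poly (pderiv f) c \<noteq> 0"
      using separable_min_poly[OF subring order_refl, of c] by blast
    obtain y where y: "y \<in> N" "\<delta> 0 = poly (pderiv f) c \<odot>\<^bsub>M\<^esub> \<delta> c \<oplus>\<^bsub>M\<^esub> y"
      using module_derivation_poly[OF assms f(1) subring, of c] f(2) by auto
    have yc: "y \<in> carrier M" using M.submoduleE(1)[OF N] y by blast
    have "poly (pderiv f) c \<odot>\<^bsub>M\<^esub> \<delta> c = \<delta> 0 \<ominus>\<^bsub>M\<^esub> y"
      unfolding y(2) a_minus_def using \<delta>_simps(1) yc by (simp add: M.M.a_assoc M.M.r_neg)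
    also have "\<dots> \<in> N" using zero y by (intro M.submodule_minus[OF N])
    finally show ?thesis using f(3) by blast
  qed
  then obtain d where d: "d c \<noteq> 0" "d c \<odot>\<^bsub>M\<^esub> \<delta> c \<in> N" for c by metis
  \<comment> \<open>A common multiple of the factors found for the generators.\<close>
  define b where "b = prod d B"
  \<comment> \<open>By the Leibniz rule this set is closed under sums and products, and it contains
    \<open>S\<close> and \<open>B\<close>; so it is all of \<open>C\<close>.\<close>
  define A where "A = {c. b \<odot>\<^bsub>M\<^esub> \<delta> c \<in> N}"
  have "S \<subseteq> A" using \<delta>(2) N_closed by (auto simp: A_def)
  moreover have "B \<subseteq> A"
  proof
    fix c assume c: "c \<in> B"
    have "b \<odot>\<^bsub>M\<^esub> \<delta> c = prod d (B - {c}) \<odot>\<^bsub>M\<^esub> (d c \<odot>\<^bsub>M\<^esub> \<delta> c)"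
      using prod.remove[OF finite_B c, of d] by (simp add: assoc \<delta>_simps b_def mult.commute)
    with d(2) N_closed show "c \<in> A" by (simp add: A_def)
  qed
  note SB = calculation this
  have add: "x + y \<in> A" if "x \<in> A" "y \<in> A" for x y
    using that N_closed by (simp add: A_def \<delta>_simps M.smult_r_distr)
  have mult: "x * y \<in> A" if "x \<in> A" "y \<in> A" for x y
  proof -
    have "b \<odot>\<^bsub>M\<^esub> \<delta> (x * y) = x \<odot>\<^bsub>M\<^esub> (b \<odot>\<^bsub>M\<^esub> \<delta> y) \<oplus>\<^bsub>M\<^esub> y \<odot>\<^bsub>M\<^esub> (b \<odot>\<^bsub>M\<^esub> \<delta> x)"
      by (simp add: \<delta>_simps M.smult_r_distr assoc mult.commute)
    with that N_closed show ?thesis by (simp add: A_def)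
  qed
  have AS: "0 \<in> A" "S \<subseteq> A" "B \<subseteq> A" using zero N_closed SB by (auto simp: A_def)
  have sum: "(\<Sum>b\<in>B'. r b * b) \<in> A" if "finite B'" "B' \<subseteq> B" "\<forall>b\<in>B. r b \<in> S" for r B'
    using that
  proof induction
    case (insert b B')
    then have "r b * b \<in> A" "(\<Sum>b\<in>B'. r b * b) \<in> A" using AS by (auto intro: mult)
    with insert show ?case by (simp add: add)
  qed (use AS in simp)
  have "c \<in> A" for c
    using span[of c] sum[OF finite_B order_refl] by auto
  then show thesis using d(1) finite_B by (intro that[of b]) (auto simp: A_def b_def)
qed

section \<open>Linear maps into the field of fractions\<close>

lemma mem_type_ring: "x \<in> carrier type_ring"
  by simp

lemma module_homD:
  assumes "F \<in> module_hom R M N"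
  shows "x \<in> carrier M \<Longrightarrow> F x \<in> carrier N"
    and "x \<in> carrier M \<Longrightarrow> y \<in> carrier M \<Longrightarrow> F (x \<oplus>\<^bsub>M\<^esub> y) = F x \<oplus>\<^bsub>N\<^esub> F y"
    and "a \<in> carrier R \<Longrightarrow> x \<in> carrier M \<Longrightarrow> F (a \<odot>\<^bsub>M\<^esub> x) = a \<odot>\<^bsub>N\<^esub> F x"
    and "F \<in> extensional (carrier M)"
  using assms by (auto simp: module_hom_def PiE_def)

context
  fixes M :: "('c::idom, 'b, 'm) module_scheme"
  assumes M: "module type_ring M"
begin

interpretation M: module type_ring M by (rule M)

lemma module_hom_frac_zero:
  assumes "F \<in> module_hom type_ring M frac_module"
  shows "F \<zero>\<^bsub>M\<^esub> = 0"
  using module_homD(3)[OF assms, of 0 "\<zero>\<^bsub>M\<^esub>"] M.smult_r_null[of 0] by simp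

lemma module_hom_frac_uminus:
  assumes "F \<in> module_hom type_ring M frac_module" "x \<in> carrier M"
  shows "F (\<ominus>\<^bsub>M\<^esub> x) = - F x"
  using module_homD(2)[OF assms(1), of x "\<ominus>\<^bsub>M\<^esub> x"] assms(2) module_hom_frac_zero[OF assms(1)]
  by (simp add: M.M.r_neg add_eq_0_iff)

lemma module_hom_frac_minus:
  assumes "F \<in> module_hom type_ring M frac_module" "x \<in> carrier M" "y \<in> carrier M"
  shows "F (x \<ominus>\<^bsub>M\<^esub> y) = F x - F y"
  using module_homD(2)[OF assms(1), of x "\<ominus>\<^bsub>M\<^esub> y"] assms
  by (simp add: a_minus_def module_hom_frac_uminus)

text \<open>Together with generation of \<open>Omega\<close> by the differentials, this reduces a
  claim about all values of a linear map to its values on the db.\<close>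

lemma submodule_frac_preimage:
  assumes F: "F \<in> module_hom type_ring M frac_module"
    and H: "submodule H type_ring (frac_module :: ('c, 'c fract) module)"
  shows "submodule {x \<in> carrier M. F x \<in> H} type_ring M"
proof -
  interpret Q: module "type_ring :: 'c ring" "frac_module :: ('c, 'c fract) module"
    by (rule module_frac_module)
  note H_closed = Q.submoduleE(4,5)[OF H]
  show ?thesis
  proof (rule M.submoduleI)
    show "\<ominus>\<^bsub>M\<^esub> x \<in> {x \<in> carrier M. F x \<in> H}" if "x \<in> {x \<in> carrier M. F x \<in> H}" for x
      using that H_closed(1)[of "-1" "F x"] by (simp add: module_hom_frac_uminus[OF F])
  qed (use module_homD[OF F] H_closed Q.submodule_zero[OF H] module_hom_frac_zero[OF F] in auto)
qed

lemma submodule_frac_equaliser: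
  assumes F: "F \<in> module_hom type_ring M frac_module" and G: "G \<in> module_hom type_ring M frac_module"
  shows "submodule {x \<in> carrier M. F x = G x} type_ring M"
  by (rule M.submoduleI)
    (auto simp: module_homD[OF F] module_homD[OF G] module_hom_frac_zero[OF F]
      module_hom_frac_zero[OF G] module_hom_frac_uminus[OF F] module_hom_frac_uminus[OF G])

end

section \<open>Differentials\<close>

lemma free_module_simps [simp]:
  "\<zero>\<^bsub>free_module R B\<^esub> = (\<lambda>b. \<zero>\<^bsub>R\<^esub>)" "g \<oplus>\<^bsub>free_module R B\<^esub> h = (\<lambda>b. g b \<oplus>\<^bsub>R\<^esub> h b)"
  "a \<odot>\<^bsub>free_module R B\<^esub> g = (\<lambda>b. a \<otimes>\<^bsub>R\<^esub> g b)"
  by (simp_all add: free_module_def)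

abbreviation free_mod :: "('c::comm_ring_1, 'c \<Rightarrow> 'c) module" where
  "free_mod \<equiv> free_module type_ring UNIV"

lemma module_free_type: "module type_ring free_mod"
  by (rule module_free[OF cring_type_ring])

lemma free_type_carrier: "carrier free_mod = {g. finite {b. g b \<noteq> 0}}"
  by (simp add: free_module_def)

lemma free_gen_apply: "free_gen type_ring b x = (if x = b then 1 else 0)"
  by (simp add: free_gen_def)

lemma free_gen_carrier: "free_gen type_ring b \<in> carrier free_mod"
  by (simp add: free_type_carrier free_gen_apply)

text \<open>Induction on a finite set containing the support; one generator is split off by setting
  a single coordinate to 0.\<close>

lemma free_type_generated:
  fixes N :: "('c::comm_ring_1 \<Rightarrow> 'c) set"
  assumes N: "submodule N type_ring free_mod" and gen: "\<And>b. free_gen type_ring b \<in> N"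
  shows "carrier free_mod \<subseteq> N"
proof -
  interpret module "type_ring :: 'c ring" free_mod by (rule module_free_type)
  have "g \<in> N" if "finite T" "{b. g b \<noteq> 0} \<subseteq> T" for g T
    using that
  proof (induction T arbitrary: g)
    case empty
    then have "g = \<zero>\<^bsub>free_mod\<^esub>" by auto
    then show ?case using submodule_zero[OF N] by (simp del: free_module_simps)
  next
    case (insert c T)
    have "g(c := 0) \<in> N" using insert by (intro insert.IH) auto
    moreover have "g c \<odot>\<^bsub>free_mod\<^esub> free_gen type_ring c \<in> N"
      using gen submoduleE(4)[OF N, of "g c"] by (simp del: free_module_simps)
    ultimately have "g c \<odot>\<^bsub>free_mod\<^esub> free_gen type_ring c \<oplus>\<^bsub>free_mod\<^esub> g(c := 0) \<in> N"
      using submoduleE(5)[OF N] by blast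
    moreover have "g c \<odot>\<^bsub>free_mod\<^esub> free_gen type_ring c \<oplus>\<^bsub>free_mod\<^esub> g(c := 0) = g"
      by (auto simp: free_gen_apply)
    ultimately show ?case by metis
  qed
  then show ?thesis by (auto simp: free_type_carrier)
qed

text \<open>Universal property of the free module on the symbols db, with target Q(C).\<close>

lemma free_type_hom:
  fixes \<delta> :: "'c::idom \<Rightarrow> 'c fract"
  obtains H where "H \<in> module_hom type_ring free_mod frac_module"
    "\<And>b. H (free_gen type_ring b) = \<delta> b"
proof -
  define H where "H = (\<lambda>g\<in>carrier free_mod. \<Sum>b | g b \<noteq> 0. to_frac (g b) * \<delta> b)"
  \<comment> \<open>Any finite superset of the support may serve as the range of summation, which
    lets two functions be added over a common range.\<close>
  have H: "H g = (\<Sum>b\<in>T. to_frac (g b) * \<delta> b)" if "finite T" "{b. g b \<noteq> 0} \<subseteq> T" for g T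
    using that finite_subset by (auto simp: H_def free_type_carrier intro!: sum.mono_neutral_left)
  have "H (\<lambda>b. g b + h b) = H g + H h"
    if fin: "finite {b. g b \<noteq> 0}" "finite {b. h b \<noteq> 0}" for g h
  proof -
    let ?T = "{b. g b \<noteq> 0} \<union> {b. h b \<noteq> 0}"
    have T: "finite ?T" using fin by blast
    have "H (\<lambda>b. g b + h b) = (\<Sum>b\<in>?T. to_frac (g b + h b) * \<delta> b)" by (rule H[OF T]) auto
    moreover have "H g = (\<Sum>b\<in>?T. to_frac (g b) * \<delta> b)" by (rule H[OF T]) auto
    moreover have "H h = (\<Sum>b\<in>?T. to_frac (h b) * \<delta> b)" by (rule H[OF T]) auto
    ultimately show ?thesis by (simp add: algebra_simps sum.distrib)
  qed
  moreover have "H (\<lambda>b. a * g b) = to_frac a * H g" if fin: "finite {b. g b \<noteq> 0}" for a g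
  proof -
    have "H (\<lambda>b. a * g b) = (\<Sum>b | g b \<noteq> 0. to_frac (a * g b) * \<delta> b)" by (rule H[OF fin]) auto
    then show ?thesis using H[OF fin order_refl] by (simp add: sum_distrib_left mult.assoc)
  qed
  ultimately have "H \<in> module_hom type_ring free_mod frac_module"
    unfolding module_hom_def by (auto simp: free_type_carrier PiE_def) (simp add: H_def free_type_carrier)
  moreover have "H (free_gen type_ring b) = \<delta> b" for b
    using H[of "{b}" "free_gen type_ring b"] by (auto simp: free_gen_apply)
  ultimately show thesis using that by blast
qed

context
  fixes A :: "('a, 'r) ring_scheme" and f :: "'a \<Rightarrow> 'c::comm_ring_1"
begin

interpretation F: module "type_ring :: 'c ring" free_mod by (rule module_free_type)

private abbreviation (input) "d \<equiv> kaehler_d A type_ring f"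
private abbreviation (input) "\<Omega> \<equiv> kaehler A type_ring f"
private abbreviation (input) "K \<equiv> kaehler_kernel A type_ring f"

lemma kaehler_relations_carrier: "kaehler_relations A type_ring f \<subseteq> carrier free_mod"
  unfolding kaehler_relations_def Let_def type_ring_simps(1)
  using free_gen_carrier by (fastforce simp del: free_module_simps)

lemma submodule_kaehler_kernel: "submodule K type_ring free_mod"
  unfolding kaehler_kernel_def type_ring_simps(1)
  by (rule F.submodule_gen[OF kaehler_relations_carrier])

lemma kaehler_relations_kernel: "kaehler_relations A type_ring f \<subseteq> K"
  unfolding kaehler_kernel_def type_ring_simps(1) by (rule F.gen_submodule_incl)

lemma module_kaehler: "module type_ring \<Omega>"
  unfolding kaehler_def type_ring_simps(1) by (rule F.module_quot[OF submodule_kaehler_kernel])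

lemma module_derivation_kaehler: "module_derivation \<Omega> d"
proof -
  note g = free_gen_carrier
  note K = submodule_kaehler_kernel
  have add: "d (x + y) = d x \<oplus>\<^bsub>\<Omega>\<^esub> d y" for x y
  proof -
    have "free_gen type_ring (x + y) \<ominus>\<^bsub>free_mod\<^esub>
        (free_gen type_ring x \<oplus>\<^bsub>free_mod\<^esub> free_gen type_ring y) \<in> kaehler_relations A type_ring f"
      unfolding kaehler_relations_def Let_def type_ring_simps by blast
    then have "K +>\<^bsub>free_mod\<^esub> free_gen type_ring (x + y) = K +>\<^bsub>free_mod\<^esub>
        (free_gen type_ring x \<oplus>\<^bsub>free_mod\<^esub> free_gen type_ring y)"
      using kaehler_relations_kernel g F.coset_eq_iff[OF K] F.M.a_closed by blast
    then show ?thesis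
      unfolding kaehler_d_def kaehler_def type_ring_simps(1) F.quot_add[OF K g g] .
  qed
  have mult: "d (x * y) = x \<odot>\<^bsub>\<Omega>\<^esub> d y \<oplus>\<^bsub>\<Omega>\<^esub> y \<odot>\<^bsub>\<Omega>\<^esub> d x" for x y
  proof -
    have "free_gen type_ring (x * y) \<ominus>\<^bsub>free_mod\<^esub>
        (x \<odot>\<^bsub>free_mod\<^esub> free_gen type_ring y \<oplus>\<^bsub>free_mod\<^esub>
          y \<odot>\<^bsub>free_mod\<^esub> free_gen type_ring x) \<in> kaehler_relations A type_ring f"
      unfolding kaehler_relations_def Let_def type_ring_simps by blast
    moreover have sm: "c \<odot>\<^bsub>free_mod\<^esub> free_gen type_ring b \<in> carrier free_mod" for b c :: 'c
      by (intro F.smult_closed g) simp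
    ultimately have "K +>\<^bsub>free_mod\<^esub> free_gen type_ring (x * y) = K +>\<^bsub>free_mod\<^esub>
        (x \<odot>\<^bsub>free_mod\<^esub> free_gen type_ring y \<oplus>\<^bsub>free_mod\<^esub>
          y \<odot>\<^bsub>free_mod\<^esub> free_gen type_ring x)"
      using kaehler_relations_kernel g F.coset_eq_iff[OF K] F.M.a_closed by blast
    then show ?thesis
      unfolding kaehler_d_def kaehler_def type_ring_simps(1) F.quot_smult[OF K mem_type_ring g]
        F.quot_add[OF K sm sm] .
  qed
  have "d x \<in> carrier \<Omega>" for x
    using g by (auto simp: kaehler_d_def kaehler_def F.quot_carrier simp del: free_module_simps)
  with add mult show ?thesis by (simp add: module_derivation_def)
qed

lemma kaehler_d_base: "v \<in> carrier A \<Longrightarrow> d (f v) = \<zero>\<^bsub>\<Omega>\<^esub>"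
proof -
  assume "v \<in> carrier A"
  then have "free_gen type_ring (f v) \<in> K"
    using kaehler_relations_kernel unfolding kaehler_relations_def Let_def by blast
  then show ?thesis
    using F.coset_eq_zero_iff[OF submodule_kaehler_kernel free_gen_carrier]
    by (simp add: kaehler_d_def kaehler_def F.quot_zero[OF submodule_kaehler_kernel])
qed

text \<open>The preimage of \<open>N\<close> in the free module contains every basis symbol. The
  result replaces writing elements as sums of c db: a property that cuts out a submodule only has to
  be checked on differentials.\<close>

lemma kaehler_generated:
  assumes N: "submodule N type_ring \<Omega>" and d: "\<And>b. d b \<in> N"
  shows "carrier \<Omega> = N"
proof -
  interpret \<Omega>: module "type_ring :: 'c ring" \<Omega> by (rule module_kaehler)
  note K = submodule_kaehler_kernel
  let ?\<pi> = "\<lambda>g. K +>\<^bsub>free_mod\<^esub> g"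
  have \<Omega>: "\<Omega> = quot_module free_mod K" by (simp add: kaehler_def)
  let ?H = "{g \<in> carrier free_mod. ?\<pi> g \<in> N}"
  have "submodule ?H type_ring free_mod"
  proof (rule F.submoduleI)
    have "?\<pi> \<zero>\<^bsub>free_mod\<^esub> = \<zero>\<^bsub>\<Omega>\<^esub>"
      unfolding \<Omega> F.quot_zero[OF K] using F.coset_eq_zero_iff[OF K] F.submodule_zero[OF K] by blast
    then show "\<zero>\<^bsub>free_mod\<^esub> \<in> ?H"
      using \<Omega>.submodule_zero[OF N] F.M.zero_closed by (simp del: free_module_simps)
    have sm: "?\<pi> (a \<odot>\<^bsub>free_mod\<^esub> g) \<in> N" if "g \<in> carrier free_mod" "?\<pi> g \<in> N" for a g
      using \<Omega>.submoduleE(4)[OF N, of a "?\<pi> g"] that F.quot_smult[OF K, of a g]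
      by (simp add: \<Omega> del: free_module_simps)
    then show "\<And>a g. a \<in> carrier type_ring \<Longrightarrow> g \<in> ?H \<Longrightarrow>
      a \<odot>\<^bsub>free_mod\<^esub> g \<in> ?H"
      using F.smult_closed by blast
    show "\<ominus>\<^bsub>free_mod\<^esub> g \<in> ?H"
      if "g \<in> ?H" for g
      using that sm[of g "-1"] F.smult_l_minus[of 1 g] F.smult_one[of g]
      by (simp del: free_module_simps)
    show "g \<oplus>\<^bsub>free_mod\<^esub> h \<in> ?H"
      if "g \<in> ?H" "h \<in> ?H" for g h
      using that \<Omega>.submoduleE(5)[OF N, of "?\<pi> g" "?\<pi> h"] F.quot_add[OF K, of g h]
      by (simp add: \<Omega> del: free_module_simps)
  qed auto
  then have "carrier free_mod \<subseteq> ?H"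
    by (rule free_type_generated) (use d free_gen_carrier in \<open>auto simp: kaehler_d_def\<close>)
  then have "carrier \<Omega> \<subseteq> N" unfolding \<Omega> F.quot_carrier by blast
  with \<Omega>.submoduleE(1)[OF N] show ?thesis by blast
qed

end

text \<open>Universal property of the differentials, which shows that the description defining
  \<open>induced_map\<close> denotes. The derivation rules make the map from the free module vanish
  on the relations, and generation by the db gives uniqueness.\<close>

lemma induced_map_frac:
  fixes f :: "'a \<Rightarrow> 'c::idom"
  assumes \<delta>: "module_derivation frac_module \<delta>" "\<And>v. v \<in> carrier A \<Longrightarrow> \<delta> (f v) = 0"
  defines "F \<equiv> induced_map A type_ring f frac_module \<delta>"
  shows "F \<in> module_hom type_ring (kaehler A type_ring f) frac_module"
    and "F (kaehler_d A type_ring f b) = \<delta> b"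
proof -
  let ?d = "kaehler_d A type_ring f" and ?\<Omega> = "kaehler A type_ring f"
    and ?K = "kaehler_kernel A type_ring f"
  let ?\<pi> = "\<lambda>g. ?K +>\<^bsub>free_mod\<^esub> g"
  interpret \<Omega>: module "type_ring :: 'c ring" ?\<Omega> by (rule module_kaehler)
  interpret E: module "type_ring :: 'c ring" free_mod by (rule module_free_type)
  note K = submodule_kaehler_kernel[of A f]
  have \<Omega>: "?\<Omega> = quot_module free_mod ?K" by (simp add: kaehler_def)
  note \<delta>_simps = module_derivationD[OF \<delta>(1), unfolded frac_module_simps]
  obtain H where H: "H \<in> module_hom type_ring free_mod frac_module"
    "\<And>b. H (free_gen type_ring b) = \<delta> b" using free_type_hom[of \<delta>] by blast
  note H_simps = module_homD[OF H(1)] module_hom_frac_minus[OF module_free_type H(1)]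
  have "submodule {g \<in> carrier free_mod. H g \<in> {0}} type_ring free_mod"
    by (rule submodule_frac_preimage[OF module_free_type H(1) submodule_frac_moduleI]) auto
  moreover have "kaehler_relations A type_ring f \<subseteq> {g \<in> carrier free_mod. H g \<in> {0}}"
    using kaehler_relations_carrier[of A f] unfolding kaehler_relations_def Let_def type_ring_simps(1)
    using free_gen_carrier
    by (auto simp: H_simps H(2) \<delta>_simps \<delta>(2) simp del: free_module_simps)
  ultimately have H0: "?K \<subseteq> {g \<in> carrier free_mod. H g \<in> {0}}"
    unfolding kaehler_kernel_def type_ring_simps(1) by (rule E.gen_submodule_minimal)
  \<comment> \<open>A representative is chosen in each coset; the choice is harmless because
    \<open>H\<close> vanishes on the kernel.\<close>
  define G where "G = (\<lambda>A\<in>carrier ?\<Omega>. H (SOME g. g \<in> carrier free_mod \<and> ?\<pi> g = A))"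
  have G: "G (?\<pi> g) = H g" if g: "g \<in> carrier free_mod" for g
  proof -
    define h where "h = (SOME h. h \<in> carrier free_mod \<and> ?\<pi> h = ?\<pi> g)"
    have h: "h \<in> carrier free_mod" "?\<pi> h = ?\<pi> g"
      using someI[of "\<lambda>h. h \<in> carrier free_mod \<and> ?\<pi> h = ?\<pi> g" g, folded h_def] g by blast+
    then have "h \<ominus>\<^bsub>free_mod\<^esub> g \<in> ?K" using E.coset_eq_iff[OF K] g by blast
    then have "H (h \<ominus>\<^bsub>free_mod\<^esub> g) = 0" using H0 by blast
    then have "H h = H g" using H_simps(5)[OF h(1) g] by simp
    moreover have "?\<pi> g \<in> carrier ?\<Omega>" unfolding \<Omega> E.quot_carrier using g by blast
    ultimately show ?thesis by (simp add: G_def h_def)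
  qed
  have cases: P if "A' \<in> carrier ?\<Omega>" "\<And>x. x \<in> carrier free_mod \<Longrightarrow> A' = ?\<pi> x \<Longrightarrow> P" for A' P
    using that unfolding \<Omega> E.quot_carrier by (elim imageE)
  have G_hom: "G \<in> module_hom type_ring ?\<Omega> frac_module"
    unfolding module_hom_def mem_Collect_eq
  proof (intro conjI ballI)
    show "G \<in> carrier ?\<Omega> \<rightarrow>\<^sub>E carrier frac_module" by (simp add: G_def PiE_def)
    show "G (A1 \<oplus>\<^bsub>?\<Omega>\<^esub> A2) = G A1 \<oplus>\<^bsub>frac_module\<^esub> G A2"
      if A: "A1 \<in> carrier ?\<Omega>" "A2 \<in> carrier ?\<Omega>" for A1 A2
    proof (rule cases[OF A(1)], rule cases[OF A(2)])
      fix x y assume "x \<in> carrier free_mod" "y \<in> carrier free_mod" "A1 = ?\<pi> x" "A2 = ?\<pi> y"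
      then show ?thesis using E.quot_add[OF K, of x y] H_simps(2)[of x y] G[of x] G[of y]
          G[of "x \<oplus>\<^bsub>free_mod\<^esub> y"] E.M.a_closed[of x y] by (simp add: \<Omega> del: free_module_simps)
    qed
    show "G (a \<odot>\<^bsub>?\<Omega>\<^esub> A1) = a \<odot>\<^bsub>frac_module\<^esub> G A1" if A: "A1 \<in> carrier ?\<Omega>" for a A1
    proof (rule cases[OF A])
      fix x assume "x \<in> carrier free_mod" "A1 = ?\<pi> x"
      then show ?thesis using E.quot_smult[OF K, of a x] H_simps(3)[of a x] G[of x]
          G[of "a \<odot>\<^bsub>free_mod\<^esub> x"] E.smult_closed[of a x] by (simp add: \<Omega> del: free_module_simps)
    qed
  qed
  have Gd: "G (?d b) = \<delta> b" for b
    unfolding kaehler_d_def type_ring_simps(1) using G[OF free_gen_carrier] H(2) by simp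
  note d = module_derivationD(1)[OF module_derivation_kaehler[of A f]]
  have "F = G"
    unfolding F_def induced_map_def
  proof (rule the_equality)
    show "G \<in> module_hom type_ring ?\<Omega> frac_module \<and>
      (\<forall>c\<in>carrier type_ring. \<forall>b\<in>carrier type_ring.
        G (c \<odot>\<^bsub>?\<Omega>\<^esub> ?d b) = c \<odot>\<^bsub>frac_module\<^esub> \<delta> b)"
      using G_hom module_homD(3)[OF G_hom _ d] Gd by simp
    fix G' assume G': "G' \<in> module_hom type_ring ?\<Omega> frac_module \<and>
      (\<forall>c\<in>carrier type_ring. \<forall>b\<in>carrier type_ring.
        G' (c \<odot>\<^bsub>?\<Omega>\<^esub> ?d b) = c \<odot>\<^bsub>frac_module\<^esub> \<delta> b)"
    then have G'_hom: "G' \<in> module_hom type_ring ?\<Omega> frac_module" by blast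
    have "G' (1 \<odot>\<^bsub>?\<Omega>\<^esub> ?d b) = \<delta> b" for b using G' by simp
    moreover have "1 \<odot>\<^bsub>?\<Omega>\<^esub> ?d b = ?d b" for b using \<Omega>.smult_one[of "?d b"] d by simp
    ultimately have "G' (?d b) = \<delta> b" for b by metis
    then have "carrier ?\<Omega> = {x \<in> carrier ?\<Omega>. G' x = G x}"
      using Gd d by (intro kaehler_generated submodule_frac_equaliser[OF module_kaehler G'_hom G_hom]) auto
    then show "G' = G"
      by (intro extensionalityI[OF module_homD(4)[OF G'_hom] module_homD(4)[OF G_hom]]) blast
  qed
  with G_hom Gd show "F \<in> module_hom type_ring ?\<Omega> frac_module" "F (?d b) = \<delta> b" by simp_all
qed

section \<open>Continuous extensions to the completion\<close>

text \<open>\<open>P k\<close> is the image of m^k in \<open>C\<close>, and \<open>W k\<close> is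
  m^k C written out as combinations of the generators. The assumptions retain just two topological
  facts: \<open>S\<close> is complete, and m^k C has intersection 0.\<close>

locale adic_finite_extension = finite_subring_extension S B
  for S B :: "'c::idom set" +
  fixes R :: "('a, 'r) ring_scheme" and m :: "'a set" and \<phi> :: "'a \<Rightarrow> 'c"
    and P :: "nat \<Rightarrow> 'c set" and W :: "nat \<Rightarrow> 'c set"
  defines "P \<equiv> \<lambda>k. \<phi> ` ideal_power R m k"
    and "W \<equiv> \<lambda>k. {\<Sum>b\<in>B. r b * b | r. \<forall>b\<in>B. r b \<in> P k}"
  assumes P_zero: "0 \<in> P k"
    and P_add: "x \<in> P k \<Longrightarrow> y \<in> P k \<Longrightarrow> x + y \<in> P k"
    and P_mult: "s \<in> S \<Longrightarrow> x \<in> P k \<Longrightarrow> s * x \<in> P k"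
    and P_subset: "P k \<subseteq> S"
    and P_Suc: "P (Suc k) \<subseteq> P k"
    and P_complete: "(\<And>k. u k \<in> S) \<Longrightarrow> (\<And>k. u (Suc k) - u k \<in> P k) \<Longrightarrow>
      \<exists>y. \<forall>k. y - u k \<in> P k"
    and W_separated: "(\<And>k. w \<in> W k) \<Longrightarrow> w = 0"
begin

lemma W_I: "(\<And>b. b \<in> B \<Longrightarrow> r b \<in> P k) \<Longrightarrow> (\<Sum>b\<in>B. r b * b) \<in> W k"
  by (auto simp: W_def)

lemma W_zero: "0 \<in> W k"
  using W_I[of "\<lambda>_. 0" k] P_zero by simp

lemma W_add:
  assumes "v \<in> W k" "w \<in> W k"
  shows "v + w \<in> W k"
proof -
  obtain r s where rs: "v = (\<Sum>b\<in>B. r b * b)" "w = (\<Sum>b\<in>B. s b * b)" "\<forall>b\<in>B. r b \<in> P k" "\<forall>b\<in>B. s b \<in> P k"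
    using assms unfolding W_def by blast
  have "v + w = (\<Sum>b\<in>B. (r b + s b) * b)" by (simp add: rs algebra_simps sum.distrib)
  with rs show ?thesis using W_I[of "\<lambda>b. r b + s b" k] P_add by simp
qed

lemma W_sum: "(\<And>i. i \<in> I \<Longrightarrow> h i \<in> W k) \<Longrightarrow> sum h I \<in> W k"
  by (induction I rule: infinite_finite_induct) (auto intro: W_zero W_add)

text \<open>Expanding \<open>c\<close> in the generators absorbs \<open>x\<close> into the
  coefficients. Hence \<open>W k\<close>, defined by combinations of \<open>B\<close> only, is the
  whole ideal m^k C.\<close>

lemma P_times_W:
  assumes "x \<in> P k"
  shows "x * c \<in> W k"
proof -
  obtain r where r: "\<forall>b\<in>B. r b \<in> S" "c = (\<Sum>b\<in>B. r b * b)" using span by blast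
  have "x * c = (\<Sum>b\<in>B. (r b * x) * b)" by (simp add: r sum_distrib_left algebra_simps)
  with r show ?thesis using W_I[of "\<lambda>b. r b * x" k] P_mult assms by simp
qed

lemma W_mult:
  assumes "w \<in> W k"
  shows "c * w \<in> W k"
proof -
  obtain r where r: "w = (\<Sum>b\<in>B. r b * b)" "\<forall>b\<in>B. r b \<in> P k"
    using assms unfolding W_def by blast
  have "c * w = (\<Sum>b\<in>B. r b * (b * c))" by (simp add: r sum_distrib_left algebra_simps)
  with r(2) show ?thesis by (auto intro!: W_sum P_times_W)
qed

lemma W_minus: "v \<in> W k \<Longrightarrow> w \<in> W k \<Longrightarrow> v - w \<in> W k"
  using W_add[OF _ W_mult[of w k "-1"], of v] by simp

text \<open>A finite module over a complete ring is complete: coefficients with respect to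
  \<open>B\<close> are chosen as Cauchy sequences in \<open>S\<close>, and the limit is taken
  coefficient by coefficient.\<close>

lemma W_complete:
  assumes "\<And>k. c (Suc k) - c k \<in> W k"
  shows "\<exists>y. \<forall>k. y - c k \<in> W k"
proof -
  have "\<exists>d. (\<forall>b\<in>B. d b \<in> P k) \<and> c (Suc k) - c k = (\<Sum>b\<in>B. d b * b)" for k
    using assms[of k] unfolding W_def by blast
  then obtain d where d: "\<forall>b\<in>B. d k b \<in> P k" "c (Suc k) - c k = (\<Sum>b\<in>B. d k b * b)" for k by metis
  obtain r where r: "\<forall>b\<in>B. r b \<in> S" "c 0 = (\<Sum>b\<in>B. r b * b)" using span by blast
  \<comment> \<open>Expansions in \<open>B\<close> are not unique, so expanding each term of the
    sequence separately need not give convergent coefficients. Only the initial term and the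
    increments are expanded, and the coefficients of the increments are summed up.\<close>
  define x where "x k b = r b + (\<Sum>j<k. d j b)" for k b
  have c: "c k = (\<Sum>b\<in>B. x k b * b)" for k
  proof (induction k)
    case (Suc k)
    have "c (Suc k) = (\<Sum>b\<in>B. x k b * b) + (\<Sum>b\<in>B. d k b * b)"
      using d(2)[of k] Suc by (simp only: diff_eq_eq add.commute)
    then show ?case by (simp only: x_def distrib_right sum.distrib sum.lessThan_Suc add.assoc)
  qed (simp add: r x_def)
  have "\<exists>y. \<forall>k. y - x k b \<in> P k" if b: "b \<in> B" for b
  proof (rule P_complete)
    show "x k b \<in> S" for k
      unfolding x_def using r b d(1) P_subset
      by (intro is_subring_add[OF subring] is_subring_sum[OF subring]) blast+
    show "x (Suc k) b - x k b \<in> P k" for k using d(1) b by (simp add: x_def)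
  qed
  then obtain y where y: "\<And>b k. b \<in> B \<Longrightarrow> y b - x k b \<in> P k" by metis
  have "(\<Sum>b\<in>B. y b * b) - c k \<in> W k" for k
    using W_I[of "\<lambda>b. y b - x k b" k] y by (simp add: c algebra_simps sum_subtractf)
  then show ?thesis by blast
qed

section \<open>The m-adic filtration and computation with representatives in the completion\<close>

abbreviation "filt M \<equiv> adic_filtration R m \<phi> type_ring M"

lemma filt_alt: "filt M k = gen_submodule type_ring M {x \<odot>\<^bsub>M\<^esub> y | x y. x \<in> P k \<and> y \<in> carrier M}"
  unfolding adic_filtration_def P_def by (rule arg_cong[of _ _ "gen_submodule type_ring M"]) blast

context
  fixes M :: "('c, 'b, 'm) module_scheme"
  assumes M: "module type_ring M"
begin

interpretation M: module type_ring M by (rule M)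

lemma submodule_filt: "submodule (filt M k) type_ring M"
  unfolding filt_alt by (rule M.submodule_gen) auto

lemma filt_minimal:
  assumes "submodule N type_ring M" "\<And>x y. x \<in> P k \<Longrightarrow> y \<in> carrier M \<Longrightarrow> x \<odot>\<^bsub>M\<^esub> y \<in> N"
  shows "filt M k \<subseteq> N"
  unfolding filt_alt by (rule M.gen_submodule_minimal) (use assms in blast)+

lemma filt_gen: "x \<in> P k \<Longrightarrow> y \<in> carrier M \<Longrightarrow> x \<odot>\<^bsub>M\<^esub> y \<in> filt M k"
  unfolding filt_alt by (rule subsetD[OF M.gen_submodule_incl]) blast

lemma filt_Suc: "filt M (Suc k) \<subseteq> filt M k"
  using P_Suc by (intro filt_minimal submodule_filt filt_gen) auto

text \<open>The filtration is generated by products with elements of m^k only; a combination of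
  generators from \<open>B\<close> is handled by letting each b act on \<open>y\<close>
  first.\<close>

lemma W_smult_filt:
  assumes "w \<in> W k" and y: "y \<in> carrier M"
  shows "w \<odot>\<^bsub>M\<^esub> y \<in> filt M k"
proof -
  obtain r where r: "w = (\<Sum>b\<in>B. r b * b)" "\<forall>b\<in>B. r b \<in> P k"
    using assms unfolding W_def by blast
  note closed = M.submoduleE(4,5)[OF submodule_filt[of k]]
  have "(\<Sum>b\<in>B'. r b * b) \<odot>\<^bsub>M\<^esub> y \<in> filt M k" if "finite B'" "B' \<subseteq> B" for B'
    using that
  proof induction
    case empty
    then show ?case using M.smult_l_null[OF y] M.submodule_zero[OF submodule_filt] by simp
  next
    case (insert b B')
    have "(r b * b) \<odot>\<^bsub>M\<^esub> y = r b \<odot>\<^bsub>M\<^esub> (b \<odot>\<^bsub>M\<^esub> y)" using M.smult_assoc1[of "r b" b y] y by simp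
    also have "\<dots> \<in> filt M k" using insert r y by (intro filt_gen) auto
    finally show ?case
      using insert M.smult_l_distr[of "r b * b" "\<Sum>b\<in>B'. r b * b" y] y closed(2) by simp
  qed
  then show ?thesis using finite_B r by simp
qed

private abbreviation (input) "hat \<equiv> completion M (filt M)"

lemma hat_coset_ex:
  assumes "\<omega> \<in> carrier hat"
  obtains y where "y \<in> carrier M" "\<omega> k = filt M k +>\<^bsub>M\<^esub> y"
proof -
  have "\<omega> k \<in> (\<lambda>x. filt M k +>\<^bsub>M\<^esub> x) ` carrier M"
    using assms by (simp add: completion_def M.quot_carrier)
  then show thesis by (rule imageE) (rule that)
qed

text \<open>Every element of the set \<omega> k can serve as a k-th approximation of \<omega>; all
  later arguments work with such elements instead of cosets.\<close>

lemma hat_coset: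
  assumes "\<omega> \<in> carrier hat" "x \<in> \<omega> k"
  shows "x \<in> carrier M" "\<omega> k = filt M k +>\<^bsub>M\<^esub> x"
proof -
  note sub = submodule_filt[of k]
  obtain y where y: "y \<in> carrier M" "\<omega> k = filt M k +>\<^bsub>M\<^esub> y"
    using hat_coset_ex[OF assms(1)] by blast
  then show x: "x \<in> carrier M"
    using assms(2) M.a_r_coset_subset_G[OF M.submoduleE(1)[OF sub]] by blast
  show "\<omega> k = filt M k +>\<^bsub>M\<^esub> x"
    using assms(2) x y M.coset_eq_iff[OF sub x y(1)] M.mem_coset_iff[OF sub x y(1)] by simp
qed

lemma hat_nonempty:
  assumes "\<omega> \<in> carrier hat"
  shows "\<exists>x. x \<in> \<omega> k"
proof -
  note sub = submodule_filt[of k]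
  obtain y where y: "y \<in> carrier M" "\<omega> k = filt M k +>\<^bsub>M\<^esub> y"
    using hat_coset_ex[OF assms(1)] by blast
  then have "y \<in> \<omega> k"
    using M.mem_coset_iff[OF sub y(1) y(1)] M.submodule_zero[OF sub] by (simp add: a_minus_def M.M.r_neg)
  then show ?thesis by blast
qed

lemma hat_antimono:
  assumes "\<omega> \<in> carrier hat" "j \<le> k"
  shows "\<omega> k \<subseteq> \<omega> j"
  using assms(2) by (induction rule: dec_induct) (use assms(1) in \<open>auto simp: completion_def\<close>)

lemma hat_diff:
  assumes "\<omega> \<in> carrier hat" "x \<in> \<omega> k" "y \<in> \<omega> k"
  shows "x \<ominus>\<^bsub>M\<^esub> y \<in> filt M k"
  using hat_coset[OF assms(1,2)] hat_coset[OF assms(1,3)] M.coset_eq_iff[OF submodule_filt[of k]] by metis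

lemma coset_self: "x \<in> carrier M \<Longrightarrow> x \<in> filt M k +>\<^bsub>M\<^esub> x"
  using M.mem_coset_iff[OF submodule_filt[of k], of x x] M.submodule_zero[OF submodule_filt[of k]]
  by (simp add: a_minus_def M.M.r_neg)

text \<open>Cauchy sequences define points of the completion: y - x_k = (y - x_(k+1)) + (x_(k+1) -
  x_k) gives the inclusion between successive cosets.\<close>

lemma hatI:
  assumes "\<And>k. x k \<in> carrier M" "\<And>k. \<omega> k = filt M k +>\<^bsub>M\<^esub> x k" "\<And>k. x (Suc k) \<ominus>\<^bsub>M\<^esub> x k \<in> filt M k"
  shows "\<omega> \<in> carrier hat"
proof -
  have "\<omega> (Suc k) \<subseteq> \<omega> k" for k
  proof
    fix y assume y: "y \<in> \<omega> (Suc k)"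
    note sub = submodule_filt
    have yc: "y \<in> carrier M"
      using y assms M.a_r_coset_subset_G[OF M.submoduleE(1)[OF sub[of "Suc k"]]] by blast
    have "y \<ominus>\<^bsub>M\<^esub> x (Suc k) \<in> filt M (Suc k)"
      using y assms M.mem_coset_iff[OF sub yc] by blast
    then have "y \<ominus>\<^bsub>M\<^esub> x (Suc k) \<in> filt M k" by (rule subsetD[OF filt_Suc])
    then have "y \<ominus>\<^bsub>M\<^esub> x (Suc k) \<oplus>\<^bsub>M\<^esub> (x (Suc k) \<ominus>\<^bsub>M\<^esub> x k) \<in> filt M k"
      using assms(3) M.submoduleE(5)[OF sub] by blast
    moreover have "y \<ominus>\<^bsub>M\<^esub> x (Suc k) \<oplus>\<^bsub>M\<^esub> (x (Suc k) \<ominus>\<^bsub>M\<^esub> x k) = y \<ominus>\<^bsub>M\<^esub> x k"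
      using yc assms(1) by (simp add: a_minus_def M.M.a_assoc M.r_neg1)
    ultimately show "y \<in> \<omega> k"
      using M.mem_coset_iff[OF sub yc] assms by simp
  qed
  with assms show ?thesis by (auto simp: completion_def M.quot_carrier)
qed

lemma completion_map_hat: "x \<in> carrier M \<Longrightarrow> completion_map M (filt M) x \<in> carrier hat"
  by (rule hatI[of "\<lambda>_. x"])
    (auto simp: completion_map_def a_minus_def M.M.r_neg M.submodule_zero[OF submodule_filt])

lemma completion_map_mem: "x \<in> carrier M \<Longrightarrow> x \<in> completion_map M (filt M) x k"
  by (simp add: completion_map_def coset_self)

lemma hat_add:
  assumes "\<omega> \<in> carrier hat" "\<eta> \<in> carrier hat"
  shows "\<omega> \<oplus>\<^bsub>hat\<^esub> \<eta> \<in> carrier hat"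
    and "x \<in> \<omega> k \<Longrightarrow> y \<in> \<eta> k \<Longrightarrow> (\<omega> \<oplus>\<^bsub>hat\<^esub> \<eta>) k = filt M k +>\<^bsub>M\<^esub> (x \<oplus>\<^bsub>M\<^esub> y)"
proof -
  note sub = submodule_filt
  show eq: "(\<omega> \<oplus>\<^bsub>hat\<^esub> \<eta>) k = filt M k +>\<^bsub>M\<^esub> (x \<oplus>\<^bsub>M\<^esub> y)" if "x \<in> \<omega> k" "y \<in> \<eta> k" for x y k
    using hat_coset[OF assms(1) that(1)] hat_coset[OF assms(2) that(2)]
      M.quot_add[OF sub[of k], of x y] by (simp add: completion_def)
  obtain x where x: "\<And>k. x k \<in> \<omega> k" using hat_nonempty[OF assms(1)] by metis
  obtain y where y: "\<And>k. y k \<in> \<eta> k" using hat_nonempty[OF assms(2)] by metis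
  have xy: "x k \<in> carrier M" "y k \<in> carrier M" for k
    using hat_coset(1)[OF assms(1) x] hat_coset(1)[OF assms(2) y] by blast+
  show "\<omega> \<oplus>\<^bsub>hat\<^esub> \<eta> \<in> carrier hat"
  proof (rule hatI)
    show "x k \<oplus>\<^bsub>M\<^esub> y k \<in> carrier M" for k using xy by simp
    show "(\<omega> \<oplus>\<^bsub>hat\<^esub> \<eta>) k = filt M k +>\<^bsub>M\<^esub> (x k \<oplus>\<^bsub>M\<^esub> y k)" for k by (rule eq[OF x y])
    fix k
    have "x (Suc k) \<ominus>\<^bsub>M\<^esub> x k \<in> filt M k" "y (Suc k) \<ominus>\<^bsub>M\<^esub> y k \<in> filt M k"
      using hat_diff[OF assms(1), of _ k] hat_diff[OF assms(2), of _ k] x y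
        hat_antimono[OF assms(1), of k "Suc k"] hat_antimono[OF assms(2), of k "Suc k"]
      by (auto simp: subset_iff)
    then have "(x (Suc k) \<ominus>\<^bsub>M\<^esub> x k) \<oplus>\<^bsub>M\<^esub> (y (Suc k) \<ominus>\<^bsub>M\<^esub> y k) \<in> filt M k"
      by (rule M.submoduleE(5)[OF sub])
    moreover have "(x (Suc k) \<ominus>\<^bsub>M\<^esub> x k) \<oplus>\<^bsub>M\<^esub> (y (Suc k) \<ominus>\<^bsub>M\<^esub> y k) =
        (x (Suc k) \<oplus>\<^bsub>M\<^esub> y (Suc k)) \<ominus>\<^bsub>M\<^esub> (x k \<oplus>\<^bsub>M\<^esub> y k)"
      using xy by (simp add: a_minus_def M.minus_add M.M.a_ac)
    ultimately show "(x (Suc k) \<oplus>\<^bsub>M\<^esub> y (Suc k)) \<ominus>\<^bsub>M\<^esub> (x k \<oplus>\<^bsub>M\<^esub> y k) \<in> filt M k" by simp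
  qed
qed

lemma hat_smult:
  assumes "\<omega> \<in> carrier hat"
  shows "a \<odot>\<^bsub>hat\<^esub> \<omega> \<in> carrier hat"
    and "x \<in> \<omega> k \<Longrightarrow> (a \<odot>\<^bsub>hat\<^esub> \<omega>) k = filt M k +>\<^bsub>M\<^esub> (a \<odot>\<^bsub>M\<^esub> x)"
proof -
  note sub = submodule_filt
  show eq: "(a \<odot>\<^bsub>hat\<^esub> \<omega>) k = filt M k +>\<^bsub>M\<^esub> (a \<odot>\<^bsub>M\<^esub> x)" if "x \<in> \<omega> k" for x k
    using hat_coset[OF assms(1) that(1)] M.quot_smult[OF sub[of k], of a x] by (simp add: completion_def)
  obtain x where x: "\<And>k. x k \<in> \<omega> k" using hat_nonempty[OF assms(1)] by metis
  have xc: "x k \<in> carrier M" for k using hat_coset(1)[OF assms(1) x] by blast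
  show "a \<odot>\<^bsub>hat\<^esub> \<omega> \<in> carrier hat"
  proof (rule hatI)
    show "a \<odot>\<^bsub>M\<^esub> x k \<in> carrier M" for k using xc by simp
    show "(a \<odot>\<^bsub>hat\<^esub> \<omega>) k = filt M k +>\<^bsub>M\<^esub> (a \<odot>\<^bsub>M\<^esub> x k)" for k by (rule eq[OF x])
    fix k
    have "x (Suc k) \<ominus>\<^bsub>M\<^esub> x k \<in> filt M k"
      using hat_diff[OF assms(1), of _ k] x hat_antimono[OF assms(1), of k "Suc k"] by (auto simp: subset_iff)
    then have "a \<odot>\<^bsub>M\<^esub> (x (Suc k) \<ominus>\<^bsub>M\<^esub> x k) \<in> filt M k"
      by (intro M.submoduleE(4)[OF sub]) auto
    then show "a \<odot>\<^bsub>M\<^esub> x (Suc k) \<ominus>\<^bsub>M\<^esub> a \<odot>\<^bsub>M\<^esub> x k \<in> filt M k"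
      using xc by (simp add: a_minus_def M.smult_r_distr M.smult_r_minus)
  qed
qed

end

end

text \<open>For nonzero \<open>a\<close> this is the cyclic module of fractions with denominator
  \<open>a\<close>, the finitely generated module in which the extended map will take its
  values.\<close>

lemma submodule_denominator:
  "submodule {z. to_frac a * z \<in> range to_frac} type_ring (frac_module :: ('c::idom, 'c fract) module)"
proof (rule submodule_frac_moduleI)
  let ?H = "{z. to_frac a * z \<in> range to_frac}"
  note range_closed = module.submoduleE(4,5)[OF module_frac_module submodule_range_to_frac,
      unfolded frac_module_simps]
  show "x + y \<in> ?H"
    if "x \<in> ?H" "y \<in> ?H" for x y
    using that range_closed(2) unfolding mem_Collect_eq distrib_left by blast
  show "to_frac c * x \<in> ?H"
    if "x \<in> ?H" for c x
    using that range_closed(1)[OF mem_type_ring, of "to_frac a * x" c]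
    unfolding mem_Collect_eq by (simp only: mult.left_commute)
  show "0 \<in> ?H"
    by (auto intro: range_eqI[of _ _ 0])
qed

lemma submodule_typeI:
  assumes "module type_ring M" "H \<subseteq> carrier M" "\<zero>\<^bsub>M\<^esub> \<in> H"
    "\<And>x y. x \<in> H \<Longrightarrow> y \<in> H \<Longrightarrow> x \<oplus>\<^bsub>M\<^esub> y \<in> H" "\<And>c x. x \<in> H \<Longrightarrow> c \<odot>\<^bsub>M\<^esub> x \<in> H"
  shows "submodule H type_ring M"
proof -
  interpret module type_ring M by fact
  show ?thesis
  proof (rule submoduleI)
    show "\<ominus>\<^bsub>M\<^esub> x \<in> H" if "x \<in> H" for x
      using assms(2) assms(5)[OF that, of "-1"] that smult_l_minus[of 1 x] smult_one[of x] by auto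
  qed (use assms in auto)
qed

lemma to_frac_mem_image_iff: "to_frac x \<in> to_frac ` A \<longleftrightarrow> x \<in> A"
  by (rule inj_image_mem_iff) (simp add: inj_def)

lemma frac_common_denominator:
  "\<exists>d. d \<noteq> 0 \<and> to_frac d * z \<in> range to_frac"
proof (cases z)
  case (Fract a b)
  then have "to_frac b * z = to_frac a" by (simp add: to_frac_def eq_fract mult.commute)
  then have "to_frac b * z \<in> range to_frac" by (rule range_eqI)
  with Fract(2) show ?thesis by blast
qed

text \<open>The product of denominators of finitely many generators works for all of
  \<open>L\<close>. This makes the topology in the definition of continuity comparable with that of
  \<open>C\<close>.\<close>

lemma fin_gen_common_denominator:
  fixes L :: "'c::idom fract set"
  assumes L: "submodule L type_ring frac_module"
    and fin: "fin_gen_module type_ring ((frac_module :: ('c, 'c fract) module)\<lparr>carrier := L\<rparr>)"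
  obtains b where "b \<noteq> 0" "\<And>z. z \<in> L \<Longrightarrow> to_frac b * z \<in> range to_frac"
proof -
  let ?N = "(frac_module :: ('c, 'c fract) module)\<lparr>carrier := L\<rparr>"
  interpret F: module "type_ring :: 'c ring" "frac_module :: ('c, 'c fract) module"
    by (rule module_frac_module)
  interpret N: module "type_ring :: 'c ring" ?N
    by (rule submodule.submodule_is_module[OF L module_frac_module])
  note L_closed = F.submoduleE(4,5)[OF L] F.submodule_zero[OF L]
  note range_closed = F.submoduleE(4,5)[OF submodule_range_to_frac] F.submodule_zero[OF submodule_range_to_frac]
  obtain T where T: "finite T" "T \<subseteq> L" "gen_submodule type_ring ?N T = L"
    using fin by (auto simp: fin_gen_module_def)
  define d where "d z = (SOME d. d \<noteq> 0 \<and> to_frac d * z \<in> range to_frac)" for z :: "'c fract"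
  have d: "d z \<noteq> 0" "to_frac (d z) * z \<in> range to_frac" for z
    using someI_ex[OF frac_common_denominator[of z]] unfolding d_def by (rule conjunct1, rule conjunct2)
  define b where "b = prod d T"
  let ?H = "{z \<in> L. to_frac b * z \<in> range to_frac}"
  have "T \<subseteq> ?H"
  proof
    fix z assume z: "z \<in> T"
    have eq: "to_frac b * z = to_frac (prod d (T - {z})) * (to_frac (d z) * z)"
      using prod.remove[OF T(1) z, of d] by (simp add: b_def mult_ac)
    have "to_frac b * z \<in> range to_frac"
      unfolding eq by (rule range_closed(1)[OF mem_type_ring d(2), unfolded frac_module_simps])
    then show "z \<in> ?H"
      using T z by blast
  qed
  moreover have "submodule ?H type_ring ?N"
  proof (rule submodule_typeI[OF N.module_axioms])
    show "c \<odot>\<^bsub>?N\<^esub> x \<in> ?H"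
      if "x \<in> ?H" for c x
      using that L_closed(1)[of c x] range_closed(1)[of c "to_frac b * x"] by (simp add: mult_ac)
  qed (use L_closed range_closed in \<open>auto simp: algebra_simps\<close>)
  ultimately have "L \<subseteq> ?H"
    using N.gen_submodule_minimal T(3) by blast
  moreover have "b \<noteq> 0" using T(1) d(1) by (simp add: b_def)
  ultimately show thesis using that by blast
qed

section \<open>Existence and uniqueness of the continuous extension to the completion\<close>

context adic_finite_extension
begin

lemma to_frac_W_closed:
  shows "x \<in> to_frac ` W k \<Longrightarrow> y \<in> to_frac ` W k \<Longrightarrow> x + y \<in> to_frac ` W k"
    and "x \<in> to_frac ` W k \<Longrightarrow> to_frac c * x \<in> to_frac ` W k"
    and "0 \<in> to_frac ` W k"
proof -
  show "x + y \<in> to_frac ` W k" if xy: "x \<in> to_frac ` W k" "y \<in> to_frac ` W k"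
  proof -
    obtain v w where "x = to_frac v" "y = to_frac w" "v \<in> W k" "w \<in> W k" using xy by blast
    then show ?thesis by (intro image_eqI[of _ _ "v + w"]) (auto intro: W_add)
  qed
  show "to_frac c * x \<in> to_frac ` W k" if x: "x \<in> to_frac ` W k"
  proof -
    obtain v where "x = to_frac v" "v \<in> W k" using x by blast
    then show ?thesis by (intro image_eqI[of _ _ "c * v"]) (auto intro: W_mult)
  qed
  show "0 \<in> to_frac ` W k" by (intro image_eqI[of _ _ 0]) (auto intro: W_zero)
qed

lemma to_frac_W_minus:
  "x \<in> to_frac ` W k \<Longrightarrow> y \<in> to_frac ` W k \<Longrightarrow> x - y \<in> to_frac ` W k"
  using to_frac_W_closed(1)[OF _ to_frac_W_closed(2)[of y k "-1"], of x] by simp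

lemma submodule_frac_W: "submodule {z. to_frac b * z \<in> to_frac ` W k} type_ring frac_module"
proof (rule submodule_frac_moduleI)
  show "to_frac c * x \<in> {z. to_frac b * z \<in> to_frac ` W k}" if "x \<in> {z. to_frac b * z \<in> to_frac ` W k}" for c x
    using that to_frac_W_closed(2)[of "to_frac b * x" k c] by (simp add: mult_ac)
qed (use to_frac_W_closed in \<open>auto simp: algebra_simps\<close>)

text \<open>Multiplication by \<open>b\<close> is a linear map from \<open>L\<close> into
  \<open>C\<close>, so it carries m^k L into m^k C.\<close>

lemma filt_frac_restrict:
  assumes L: "submodule L type_ring (frac_module :: ('c, 'c fract) module)"
    and b: "\<And>z. z \<in> L \<Longrightarrow> to_frac b * z \<in> range to_frac"
    and z: "z \<in> filt ((frac_module :: ('c, 'c fract) module)\<lparr>carrier := L\<rparr>) k"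
  shows "to_frac b * z \<in> to_frac ` W k"
proof -
  let ?N = "(frac_module :: ('c, 'c fract) module)\<lparr>carrier := L\<rparr>"
  have N: "module type_ring ?N"
    by (rule submodule.submodule_is_module[OF L module_frac_module])
  interpret F: module "type_ring :: 'c ring" "frac_module :: ('c, 'c fract) module"
    by (rule module_frac_module)
  note L_closed = F.submoduleE(4,5)[OF L] F.submodule_zero[OF L]
  let ?H = "{z \<in> L. to_frac b * z \<in> to_frac ` W k}"
  have "filt ?N k \<subseteq> ?H"
  proof (rule filt_minimal[OF N])
    show "submodule ?H type_ring ?N"
    proof (rule submodule_typeI[OF N])
      show "c \<odot>\<^bsub>?N\<^esub> x \<in> ?H"
        if "x \<in> ?H" for c x
        using that L_closed(1)[of c x] to_frac_W_closed(2)[of "to_frac b * x" k c] by (simp add: mult_ac)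
    qed (use L_closed to_frac_W_closed in \<open>auto simp: algebra_simps\<close>)
    show "x \<odot>\<^bsub>?N\<^esub> y \<in> ?H" if x: "x \<in> P k" and y: "y \<in> carrier ?N" for x y
    proof -
      have yL: "y \<in> L" using y by simp
      then obtain c where c: "to_frac b * y = to_frac c" using b by blast
      have "to_frac b * (to_frac x * y) = to_frac (x * c)" by (simp add: mult_ac flip: c)
      then have "to_frac b * (to_frac x * y) \<in> to_frac ` W k"
        using P_times_W[OF x, of c] by (rule image_eqI)
      then show ?thesis using L_closed(1)[of x y] yL by simp
    qed
  qed
  with z show ?thesis by blast
qed

text \<open>After multiplication by \<open>a\<close> the map takes values in \<open>C\<close>, where
  Cauchy sequences converge; dividing the limit by \<open>a\<close> gives the extension. The second
  conclusion is the quantitative form of continuity that is used later: any approximation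
  \<open>x\<close> of \<omega> modulo m^k M determines the value up to m^k C divided by
  \<open>a\<close>.\<close>

theorem continuous_extension_frac:
  assumes M: "module type_ring M" and F: "F \<in> module_hom type_ring M frac_module"
    and a: "a \<noteq> 0" "\<And>x. x \<in> carrier M \<Longrightarrow> to_frac a * F x \<in> range to_frac"
  defines "G \<equiv> continuous_extension R m \<phi> type_ring M frac_module F"
  shows "G \<in> module_hom type_ring (completion M (filt M)) frac_module"
    and "\<omega> \<in> carrier (completion M (filt M)) \<Longrightarrow> x \<in> \<omega> k \<Longrightarrow>
      to_frac a * (G \<omega> - F x) \<in> to_frac ` W k"
proof -
  let ?hat = "completion M (filt M)"
  let ?a = "to_frac a"
  interpret M: module type_ring M by (rule M)
  note F_simps = module_homD[OF F] module_hom_frac_minus[OF M F] module_hom_frac_zero[OF M F]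
  note sub = submodule_filt[OF M]
  note coset = hat_coset[OF M] and nonempty = hat_nonempty[OF M] and antimono = hat_antimono[OF M]
  have a0: "?a \<noteq> 0" using a(1) by simp
  \<comment> \<open>The map aF, regarded as taking values in \<open>C\<close> instead of
    Q(C).\<close>
  define e where "e x = (SOME c. ?a * F x = to_frac c)" for x
  have e: "to_frac (e x) = ?a * F x" if "x \<in> carrier M" for x
    using someI_ex[of "\<lambda>c. ?a * F x = to_frac c"] a(2)[OF that] unfolding e_def by force
  have filt_W: "?a * F x \<in> to_frac ` W k" if "x \<in> filt M k" for x k
  proof -
    have "filt M k \<subseteq> {x \<in> carrier M. F x \<in> {z. ?a * z \<in> to_frac ` W k}}"
    proof (rule filt_minimal[OF M submodule_frac_preimage[OF M F submodule_frac_W]])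
      fix x y assume xy: "x \<in> P k" "y \<in> carrier M"
      have "?a * F (x \<odot>\<^bsub>M\<^esub> y) = to_frac (x * e y)" using xy by (simp add: e F_simps(3) mult_ac)
      then have "?a * F (x \<odot>\<^bsub>M\<^esub> y) \<in> to_frac ` W k"
        using P_times_W[OF xy(1), of "e y"] by (rule image_eqI)
      then show "x \<odot>\<^bsub>M\<^esub> y \<in> {x \<in> carrier M. F x \<in> {z. ?a * z \<in> to_frac ` W k}}"
        using xy by simp
    qed
    with that show ?thesis by blast
  qed
  have e_diff: "e x - e y \<in> W k" if "x \<ominus>\<^bsub>M\<^esub> y \<in> filt M k" "x \<in> carrier M" "y \<in> carrier M" for x y k
  proof -
    have "to_frac (e x - e y) = ?a * F (x \<ominus>\<^bsub>M\<^esub> y)" using that by (simp add: e F_simps algebra_simps)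
    with filt_W[OF that(1)] have "to_frac (e x - e y) \<in> to_frac ` W k" by (simp only:)
    then show ?thesis by (simp only: to_frac_mem_image_iff)
  qed
  have ex: "\<exists>y. \<forall>k. \<forall>x\<in>\<omega> k. y - e x \<in> W k" if \<omega>: "\<omega> \<in> carrier ?hat" for \<omega>
  proof -
    obtain x where x: "\<And>k. x k \<in> \<omega> k" using nonempty[OF \<omega>] by metis
    note xc = coset(1)[OF \<omega> x]
    have "e (x (Suc k)) - e (x k) \<in> W k" for k
      using x antimono[OF \<omega>, of k "Suc k"] xc
      by (intro e_diff hat_diff[OF M \<omega>]) (auto simp: subset_iff)
    then obtain y where y: "\<And>k. y - e (x k) \<in> W k" using W_complete[of "\<lambda>k. e (x k)"] by blast
    have "y - e z \<in> W k" if z: "z \<in> \<omega> k" for z k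
    proof -
      have "e (x k) - e z \<in> W k"
        using xc coset(1)[OF \<omega> z] by (intro e_diff hat_diff[OF M \<omega> x z])
      from W_add[OF y this] show ?thesis by simp
    qed
    then show ?thesis by blast
  qed
  \<comment> \<open>The limit is required to be close to the values at all representatives, not only
    along one chosen sequence. Separatedness then makes it unique, which yields additivity and
    linearity without tracking choices.\<close>
  define g where "g \<omega> = (SOME y. \<forall>k. \<forall>x\<in>\<omega> k. y - e x \<in> W k)" for \<omega>
  have g: "g \<omega> - e x \<in> W k" if "\<omega> \<in> carrier ?hat" "x \<in> \<omega> k" for \<omega> x k
    using someI_ex[OF ex[OF that(1)], folded g_def] that(2) by blast
  have g_eq: "y = g \<omega>" if \<omega>: "\<omega> \<in> carrier ?hat" and y: "\<And>k. \<exists>x\<in>\<omega> k. y - e x \<in> W k" for \<omega> y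
  proof -
    have "y - g \<omega> \<in> W k" for k
    proof -
      obtain x where x: "x \<in> \<omega> k" "y - e x \<in> W k" using y by blast
      from W_minus[OF x(2) g[OF \<omega> x(1)]] show ?thesis by simp
    qed
    then show ?thesis using W_separated[of "y - g \<omega>"] by simp
  qed
  have e_add: "e (x \<oplus>\<^bsub>M\<^esub> y) = e x + e y" if "x \<in> carrier M" "y \<in> carrier M" for x y
  proof -
    have "to_frac (e (x \<oplus>\<^bsub>M\<^esub> y)) = to_frac (e x + e y)" using that by (simp add: e F_simps algebra_simps)
    then show ?thesis by (simp only: to_frac_simps(8))
  qed
  have e_smult: "e (c \<odot>\<^bsub>M\<^esub> x) = c * e x" if "x \<in> carrier M" for x c
  proof -
    have "to_frac (e (c \<odot>\<^bsub>M\<^esub> x)) = to_frac (c * e x)" using that by (simp add: e F_simps algebra_simps)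
    then show ?thesis by (simp only: to_frac_simps(8))
  qed
  have g_add: "g (\<omega> \<oplus>\<^bsub>?hat\<^esub> \<eta>) = g \<omega> + g \<eta>" if \<omega>: "\<omega> \<in> carrier ?hat" and \<eta>: "\<eta> \<in> carrier ?hat" for \<omega> \<eta>
  proof (rule g_eq[symmetric, OF hat_add(1)[OF M \<omega> \<eta>]])
    fix k
    obtain x y where xy: "x \<in> \<omega> k" "y \<in> \<eta> k" using nonempty[OF \<omega>] nonempty[OF \<eta>] by blast
    note c = coset(1)[OF \<omega> xy(1)] coset(1)[OF \<eta> xy(2)]
    have "x \<oplus>\<^bsub>M\<^esub> y \<in> (\<omega> \<oplus>\<^bsub>?hat\<^esub> \<eta>) k"
      unfolding hat_add(2)[OF M \<omega> \<eta> xy] using c by (intro coset_self[OF M]) simp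
    moreover have "g \<omega> + g \<eta> - e (x \<oplus>\<^bsub>M\<^esub> y) \<in> W k"
      using W_add[OF g[OF \<omega> xy(1)] g[OF \<eta> xy(2)]] by (simp add: e_add c algebra_simps)
    ultimately show "\<exists>x\<in>(\<omega> \<oplus>\<^bsub>?hat\<^esub> \<eta>) k. g \<omega> + g \<eta> - e x \<in> W k" by blast
  qed
  have g_smult: "g (c \<odot>\<^bsub>?hat\<^esub> \<omega>) = c * g \<omega>" if \<omega>: "\<omega> \<in> carrier ?hat" for \<omega> c
  proof (rule g_eq[symmetric, OF hat_smult(1)[OF M \<omega>]])
    fix k
    obtain x where x: "x \<in> \<omega> k" using nonempty[OF \<omega>] by blast
    note xc = coset(1)[OF \<omega> x]
    have "c \<odot>\<^bsub>M\<^esub> x \<in> (c \<odot>\<^bsub>?hat\<^esub> \<omega>) k"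
      unfolding hat_smult(2)[OF M \<omega> x] using xc by (intro coset_self[OF M]) simp
    moreover have "c * g \<omega> - e (c \<odot>\<^bsub>M\<^esub> x) \<in> W k"
      using W_mult[OF g[OF \<omega> x], of c] by (simp add: e_smult xc algebra_simps)
    ultimately show "\<exists>x\<in>(c \<odot>\<^bsub>?hat\<^esub> \<omega>) k. c * g \<omega> - e x \<in> W k" by blast
  qed
  define G0 where "G0 = (\<lambda>\<omega>\<in>carrier ?hat. to_frac (g \<omega>) / ?a)"
  have G0: "?a * G0 \<omega> = to_frac (g \<omega>)" if "\<omega> \<in> carrier ?hat" for \<omega>
    using that a0 by (simp add: G0_def)
  have G0_hom: "G0 \<in> module_hom type_ring ?hat frac_module"
    unfolding module_hom_def
    by (auto simp: G0_def g_add g_smult hat_add(1)[OF M] hat_smult(1)[OF M] add_divide_distrib)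
  have G0_key: "?a * (G0 \<omega> - F x) \<in> to_frac ` W k" if \<omega>: "\<omega> \<in> carrier ?hat" and x: "x \<in> \<omega> k" for \<omega> x k
  proof -
    have "?a * (G0 \<omega> - F x) = to_frac (g \<omega> - e x)"
      by (simp add: G0[OF \<omega>] e[OF coset(1)[OF \<omega> x]] right_diff_distrib)
    then show ?thesis using g[OF \<omega> x] by (rule image_eqI)
  qed
  have G0_map: "G0 (completion_map M (filt M) x) = F x" if x: "x \<in> carrier M" for x
  proof -
    have "e x = g (completion_map M (filt M) x)"
    proof (rule g_eq[OF completion_map_hat[OF M x]])
      show "\<exists>z\<in>completion_map M (filt M) x k. e x - e z \<in> W k" for k
        using completion_map_mem[OF M x, of k] W_zero[of k] by force
    qed
    then have "?a * G0 (completion_map M (filt M) x) = ?a * F x"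
      using G0[OF completion_map_hat[OF M x]] e[OF x] by simp
    with a0 show ?thesis by simp
  qed
  \<comment> \<open>The module generated by 1/a, serving as the finitely generated target in the
    definition of continuity.\<close>
  define L where "L = {z. ?a * z \<in> range to_frac}"
  let ?N = "(frac_module :: ('c, 'c fract) module)\<lparr>carrier := L\<rparr>"
  have inv_L: "inverse ?a \<in> L"
    using a0 to_frac_simps(2)[symmetric] by (auto simp: L_def intro: range_eqI[of _ _ 1])
  have L_alt: "\<exists>c. z = to_frac c * inverse ?a" if z: "z \<in> L" for z
  proof -
    obtain c where "?a * z = to_frac c" using z unfolding L_def by blast
    then have "z = to_frac c * inverse ?a" using a0 by (simp add: field_simps)
    then show ?thesis by blast
  qed
  have L: "submodule L type_ring (frac_module :: ('c, 'c fract) module)"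
    unfolding L_def by (rule submodule_denominator)
  have N: "module type_ring ?N"
    by (rule submodule.submodule_is_module[OF L module_frac_module])
  interpret N: module "type_ring :: 'c ring" ?N by (rule N)
  have fin: "fin_gen_module type_ring ?N"
    unfolding fin_gen_module_def
  proof (intro exI[of _ "{inverse ?a}"] conjI)
    show "gen_submodule type_ring ?N {inverse ?a} = carrier ?N"
    proof
      show "gen_submodule type_ring ?N {inverse ?a} \<subseteq> carrier ?N"
        using inv_L by (intro N.gen_submodule_minimal N.carrier_is_submodule) simp
      show "carrier ?N \<subseteq> gen_submodule type_ring ?N {inverse ?a}"
      proof
        fix z assume "z \<in> carrier ?N"
        then obtain c where c: "z = c \<odot>\<^bsub>?N\<^esub> inverse ?a" using L_alt by auto
        have "submodule (gen_submodule type_ring ?N {inverse ?a}) type_ring ?N"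
          using inv_L by (intro N.submodule_gen) simp
        moreover have "inverse ?a \<in> gen_submodule type_ring ?N {inverse ?a}"
          using N.gen_submodule_incl by blast
        ultimately show "z \<in> gen_submodule type_ring ?N {inverse ?a}"
          unfolding c using N.submoduleE(4)[OF _ mem_type_ring] by blast
      qed
    qed
  qed (use inv_L in simp_all)
  have G0_cont: "adic_continuous R m \<phi> type_ring M frac_module G0"
    unfolding adic_continuous_def Let_def
  proof (intro exI[of _ L] conjI L fin allI)
    show "G0 ` carrier ?hat \<subseteq> L" using G0 unfolding L_def by blast
    fix k
    have "G0 \<omega> \<in> filt ?N k" if \<omega>: "\<omega> \<in> carrier ?hat" "\<omega> k = \<zero>\<^bsub>quot_module M (filt M k)\<^esub>" for \<omega>
    proof -
      \<comment> \<open>The modulus of continuity is the identity: 0 represents \<omega> at level k,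
        hence a times the value lies in m^k C.\<close>
      have z: "\<zero>\<^bsub>M\<^esub> \<in> \<omega> k" using \<omega>(2) M.submodule_zero[OF sub] by (simp add: M.quot_zero[OF sub])
      have "?a * G0 \<omega> \<in> to_frac ` W k" using G0_key[OF \<omega>(1) z] by (simp add: F_simps)
      then obtain w where w: "w \<in> W k" "?a * G0 \<omega> = to_frac w" by blast
      then have "G0 \<omega> = w \<odot>\<^bsub>?N\<^esub> inverse ?a" using a0 by (simp add: field_simps)
      with W_smult_filt[OF N w(1), of "inverse ?a"] inv_L show ?thesis by simp
    qed
    then show "\<exists>j. \<forall>\<omega>\<in>carrier ?hat. \<omega> j = \<zero>\<^bsub>quot_module M (filt M j)\<^esub> \<longrightarrow> G0 \<omega> \<in> filt ?N k" by blast
  qed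
  have "G = G0"
    unfolding G_def continuous_extension_def Let_def
  proof (rule the_equality)
    show "G0 \<in> module_hom type_ring ?hat frac_module \<and>
      (\<forall>x\<in>carrier M. G0 (completion_map M (filt M) x) = F x) \<and>
      adic_continuous R m \<phi> type_ring M frac_module G0"
      using G0_hom G0_map G0_cont by blast
    fix G' assume "G' \<in> module_hom type_ring ?hat frac_module \<and>
      (\<forall>x\<in>carrier M. G' (completion_map M (filt M) x) = F x) \<and>
      adic_continuous R m \<phi> type_ring M frac_module G'"
    then have G': "G' \<in> module_hom type_ring ?hat frac_module"
      "\<And>x. x \<in> carrier M \<Longrightarrow> G' (completion_map M (filt M) x) = F x"
      and "adic_continuous R m \<phi> type_ring M frac_module G'" by blast+
    then obtain L' where L': "submodule L' type_ring (frac_module :: ('c, 'c fract) module)"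
      "fin_gen_module type_ring ((frac_module :: ('c, 'c fract) module)\<lparr>carrier := L'\<rparr>)"
      "G' ` carrier ?hat \<subseteq> L'"
      "\<And>k. \<exists>j. \<forall>\<omega>\<in>carrier ?hat. \<omega> j = \<zero>\<^bsub>quot_module M (filt M j)\<^esub> \<longrightarrow>
        G' \<omega> \<in> filt ((frac_module :: ('c, 'c fract) module)\<lparr>carrier := L'\<rparr>) k"
      unfolding adic_continuous_def Let_def by blast
    obtain b where b: "b \<noteq> 0" "\<And>z. z \<in> L' \<Longrightarrow> to_frac b * z \<in> range to_frac"
      using fin_gen_common_denominator[OF L'(1,2)] by blast
    have "G' \<omega> = G0 \<omega>" if \<omega>: "\<omega> \<in> carrier ?hat" for \<omega>
    proof -
      \<comment> \<open>The difference of two continuous extensions, cleared of both denominators.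
        It will lie in m^k C for every k.\<close>
      define D where "D = to_frac b * (?a * (G' \<omega> - G0 \<omega>))"
      have D_W: "D \<in> to_frac ` W k" for k
      proof -
        obtain j where j: "\<And>\<eta>. \<eta> \<in> carrier ?hat \<Longrightarrow> \<eta> j = \<zero>\<^bsub>quot_module M (filt M j)\<^esub> \<Longrightarrow>
            G' \<eta> \<in> filt ((frac_module :: ('c, 'c fract) module)\<lparr>carrier := L'\<rparr>) k"
          using L'(4)[of k] by blast
        \<comment> \<open>Level j is needed for the continuity of G', level k for the explicit
          estimate on \<open>G0\<close>.\<close>
        obtain x where x: "x \<in> \<omega> (max j k)" using nonempty[OF \<omega>] by blast
        have xj: "x \<in> \<omega> j" and xk: "x \<in> \<omega> k"
          using x antimono[OF \<omega>, of j "max j k"] antimono[OF \<omega>, of k "max j k"] by auto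
        have xc: "x \<in> carrier M" by (rule coset(1)[OF \<omega> x])
        define \<xi> where "\<xi> = completion_map M (filt M) x"
        have \<xi>: "\<xi> \<in> carrier ?hat" "x \<in> \<xi> j" "G' \<xi> = F x"
          unfolding \<xi>_def using xc completion_map_hat[OF M] completion_map_mem[OF M] G'(2) by blast+
        \<comment> \<open>Subtracting the image of \<open>x\<close> makes the j-th component zero,
          so that continuity of G' at 0 applies.\<close>
        define \<eta> where "\<eta> = \<omega> \<oplus>\<^bsub>?hat\<^esub> ((-1) \<odot>\<^bsub>?hat\<^esub> \<xi>)"
        have m\<xi>: "(-1) \<odot>\<^bsub>?hat\<^esub> \<xi> \<in> carrier ?hat" by (rule hat_smult(1)[OF M \<xi>(1)])
        have \<eta>: "\<eta> \<in> carrier ?hat" unfolding \<eta>_def by (rule hat_add(1)[OF M \<omega> m\<xi>])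
        have mx: "(-1) \<odot>\<^bsub>M\<^esub> x = \<ominus>\<^bsub>M\<^esub> x" using M.smult_l_minus[of 1 x] M.smult_one[of x] xc by simp
        have "\<ominus>\<^bsub>M\<^esub> x \<in> ((-1) \<odot>\<^bsub>?hat\<^esub> \<xi>) j"
          unfolding hat_smult(2)[OF M \<xi>(1,2)] mx using xc by (intro coset_self[OF M]) simp
        from hat_add(2)[OF M \<omega> m\<xi> xj this] have "\<eta> j = filt M j +>\<^bsub>M\<^esub> \<zero>\<^bsub>M\<^esub>"
          using xc by (simp add: \<eta>_def M.M.r_neg)
        then have "\<eta> j = \<zero>\<^bsub>quot_module M (filt M j)\<^esub>"
          using M.coset_eq_zero_iff[OF sub[of j], of "\<zero>\<^bsub>M\<^esub>"] M.submodule_zero[OF sub[of j]]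
          by (simp add: M.quot_zero[OF sub])
        then have "to_frac b * G' \<eta> \<in> to_frac ` W k"
          by (intro filt_frac_restrict[OF L'(1) b(2) j[OF \<eta>]])
        moreover have "G' \<eta> = G' \<omega> - F x"
          using module_homD(2)[OF G'(1) \<omega> m\<xi>] module_homD(3)[OF G'(1) mem_type_ring \<xi>(1), of "-1"] \<xi>(3)
          by (simp add: \<eta>_def)
        ultimately have 1: "?a * (to_frac b * (G' \<omega> - F x)) \<in> to_frac ` W k"
          using to_frac_W_closed(2) by metis
        have 2: "to_frac b * (?a * (G0 \<omega> - F x)) \<in> to_frac ` W k"
          by (rule to_frac_W_closed(2)[OF G0_key[OF \<omega> xk]])
        have "D = ?a * (to_frac b * (G' \<omega> - F x)) - to_frac b * (?a * (G0 \<omega> - F x))"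
          by (simp add: D_def algebra_simps)
        with to_frac_W_minus[OF 1 2] show ?thesis by simp
      qed
      then obtain d where d: "D = to_frac d" by blast
      have "d \<in> W k" for k using D_W[of k] unfolding d by (simp only: to_frac_mem_image_iff)
      then have "D = 0" unfolding d using W_separated by simp
      then show ?thesis using b(1) a0 by (simp add: D_def)
    qed
    then show "G' = G0"
      by (rule extensionalityI[OF module_homD(4)[OF G'(1)] module_homD(4)[OF G0_hom]])
  qed
  then show "G \<in> module_hom type_ring ?hat frac_module"
    "\<omega> \<in> carrier ?hat \<Longrightarrow> x \<in> \<omega> k \<Longrightarrow> ?a * (G \<omega> - F x) \<in> to_frac ` W k"
    using G0_hom G0_key by simp_all
qed

end

section \<open>Power series\<close>

text \<open>A summand of \<alpha> is bounded by it in each coordinate and is determined on its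
  support. Finiteness matters because a sum over an infinite index set takes the default value
  0.\<close>

lemma finite_sum_pairs: "finite {(\<beta>, \<gamma>). \<beta> + \<gamma> = (\<alpha> :: nat \<Rightarrow>\<^sub>0 nat)}"
proof -
  let ?T = "Poly_Mapping.keys \<alpha>"
  let ?D = "{\<beta>. \<exists>\<gamma>. \<beta> + \<gamma> = \<alpha>}"
  have le: "Poly_Mapping.lookup \<beta> i \<le> Poly_Mapping.lookup \<alpha> i" if "\<beta> \<in> ?D" for \<beta> i
    using that by (auto simp: lookup_add)
  have "inj_on (\<lambda>\<beta>. restrict (Poly_Mapping.lookup \<beta>) ?T) ?D"
  proof (rule inj_onI, rule poly_mapping_eqI)
    fix \<beta> \<beta>' i assume *: "\<beta> \<in> ?D" "\<beta>' \<in> ?D"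
      "restrict (Poly_Mapping.lookup \<beta>) ?T = restrict (Poly_Mapping.lookup \<beta>') ?T"
    show "Poly_Mapping.lookup \<beta> i = Poly_Mapping.lookup \<beta>' i"
    proof (cases "i \<in> ?T")
      case True
      with fun_cong[OF *(3), of i] show ?thesis by simp
    next
      case False
      with le[OF *(1), of i] le[OF *(2), of i] show ?thesis by (simp add: in_keys_iff)
    qed
  qed
  moreover have "(\<lambda>\<beta>. restrict (Poly_Mapping.lookup \<beta>) ?T) ` ?D \<subseteq>
      (\<Pi>\<^sub>E i\<in>?T. {..Poly_Mapping.lookup \<alpha> i})"
    using le by fastforce
  ultimately have "finite ?D"
    by (rule inj_on_finite) (simp add: finite_PiE)
  moreover have "{(\<beta>, \<gamma>). \<beta> + \<gamma> = \<alpha>} \<subseteq> ?D \<times> ?D" by (auto intro: add.commute)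
  ultimately show ?thesis by (meson finite_SigmaI finite_subset)
qed

abbreviation mps :: "nat set \<Rightarrow> ((nat \<Rightarrow>\<^sub>0 nat) \<Rightarrow> 'v::comm_ring_1) ring" where
  "mps I \<equiv> mps_ring type_ring I"

abbreviation mps_C :: "'v::comm_ring_1 \<Rightarrow> (nat \<Rightarrow>\<^sub>0 nat) \<Rightarrow> 'v" where
  "mps_C \<equiv> mps_const type_ring"

lemma mps_simps [simp]:
  "f \<in> carrier (mps I) \<longleftrightarrow> (\<forall>\<alpha>. \<not> Poly_Mapping.keys \<alpha> \<subseteq> I \<longrightarrow> f \<alpha> = 0)"
  "f \<oplus>\<^bsub>mps I\<^esub> g = (\<lambda>\<alpha>. f \<alpha> + g \<alpha>)"
  "\<zero>\<^bsub>mps I\<^esub> = (\<lambda>\<alpha>. 0)"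
  "\<one>\<^bsub>mps I\<^esub> = mps_C 1"
  by (simp_all add: mps_ring_def mps_const_def fun_eq_iff)

lemma mps_mult:
  "(f \<otimes>\<^bsub>mps I\<^esub> g) \<alpha> = (\<Sum>(\<beta>, \<gamma>) | \<beta> + \<gamma> = \<alpha>. f \<beta> * g \<gamma>)"
  by (simp add: mps_ring_def)

lemma mps_const_apply: "mps_C v \<alpha> = (if \<alpha> = 0 then v else 0)"
  by (simp add: mps_const_def)

definition mps_X :: "nat \<Rightarrow> (nat \<Rightarrow>\<^sub>0 nat) \<Rightarrow> 'v::comm_ring_1" where
  "mps_X i = (\<lambda>\<alpha>. if \<alpha> = Poly_Mapping.single i 1 then 1 else 0)"

lemma mps_X_carrier: "i \<in> I \<Longrightarrow> mps_X i \<in> carrier (mps I)"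
  by (auto simp: mps_X_def)

lemma single_le_split:
  fixes \<alpha> :: "nat \<Rightarrow>\<^sub>0 nat"
  assumes "Poly_Mapping.lookup \<alpha> i \<noteq> 0"
  shows "\<alpha> - Poly_Mapping.single i 1 + Poly_Mapping.single i 1 = \<alpha>"
  using assms by (intro poly_mapping_eqI) (auto simp: lookup_add lookup_minus lookup_single when_def)

lemma mps_mult_const: "(f \<otimes>\<^bsub>mps I\<^esub> mps_C v) \<alpha> = f \<alpha> * v"
proof -
  have "(f \<otimes>\<^bsub>mps I\<^esub> mps_C v) \<alpha> =
      (\<Sum>\<beta>\<gamma> | fst \<beta>\<gamma> + snd \<beta>\<gamma> = \<alpha>. if \<beta>\<gamma> = (\<alpha>, 0) then f \<alpha> * v else 0)"
    unfolding mps_mult by (rule sum.cong) (auto simp: mps_const_apply split: if_splits)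
  also have "\<dots> = f \<alpha> * v"
    using finite_sum_pairs[of \<alpha>] by (subst sum.delta) (auto simp: case_prod_unfold)
  finally show ?thesis .
qed

lemma mps_mult_X:
  "(f \<otimes>\<^bsub>mps I\<^esub> mps_X i) \<alpha> =
    (if Poly_Mapping.lookup \<alpha> i = 0 then 0 else f (\<alpha> - Poly_Mapping.single i 1))"
proof (cases "Poly_Mapping.lookup \<alpha> i = 0")
  case True
  then have "\<gamma> \<noteq> Poly_Mapping.single i 1" if "\<beta> + \<gamma> = \<alpha>" for \<beta> \<gamma>
    using that by (auto simp: lookup_add)
  then show ?thesis
    unfolding mps_mult using True by (auto simp: mps_X_def intro!: sum.neutral)
next
  case False
  let ?e = "Poly_Mapping.single i 1 :: nat \<Rightarrow>\<^sub>0 nat"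
  have "(f \<otimes>\<^bsub>mps I\<^esub> mps_X i) \<alpha> =
      (\<Sum>\<beta>\<gamma> | fst \<beta>\<gamma> + snd \<beta>\<gamma> = \<alpha>. if \<beta>\<gamma> = (\<alpha> - ?e, ?e) then f (\<alpha> - ?e) else 0)"
    unfolding mps_mult by (rule sum.cong) (auto simp: mps_X_def split: if_splits)
  also have "\<dots> = f (\<alpha> - ?e)"
    using finite_sum_pairs[of \<alpha>] single_le_split[OF False]
    by (subst sum.delta) (auto simp: case_prod_unfold)
  finally show ?thesis using False by simp
qed

lemma mps_mult_comm: "f \<otimes>\<^bsub>mps I\<^esub> g = g \<otimes>\<^bsub>mps I\<^esub> f"
proof
  fix \<alpha>
  show "(f \<otimes>\<^bsub>mps I\<^esub> g) \<alpha> = (g \<otimes>\<^bsub>mps I\<^esub> f) \<alpha>"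
    unfolding mps_mult
    by (rule sum.reindex_bij_witness[of _ prod.swap prod.swap]) (auto simp: mult.commute add.commute)
qed

lemma keys_add_nat: "Poly_Mapping.keys (\<beta> + \<gamma> :: nat \<Rightarrow>\<^sub>0 nat) = Poly_Mapping.keys \<beta> \<union> Poly_Mapping.keys \<gamma>"
  by (auto simp: in_keys_iff lookup_add)

lemma mps_mult_carrier:
  assumes "f \<in> carrier (mps I)" "g \<in> carrier (mps I)"
  shows "f \<otimes>\<^bsub>mps I\<^esub> g \<in> carrier (mps I)"
proof -
  have "f \<beta> * g \<gamma> = 0" if "\<not> Poly_Mapping.keys (\<beta> + \<gamma>) \<subseteq> I" for \<beta> \<gamma>
    using assms that unfolding keys_add_nat mps_simps by (metis Un_least mult_zero_left mult_zero_right)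
  then show ?thesis by (auto simp: mps_mult intro!: sum.neutral)
qed

subsection \<open>Partial derivatives\<close>

lemma mps_deriv_apply:
  "mps_deriv type_ring i f \<alpha> =
    of_nat (Poly_Mapping.lookup \<alpha> i + 1) * f (\<alpha> + Poly_Mapping.single i 1)"
  unfolding mps_deriv_def type_ring_nat_mult ..

lemma mps_deriv_carrier:
  "f \<in> carrier (mps I) \<Longrightarrow> mps_deriv type_ring i f \<in> carrier (mps I)"
  by (auto simp: mps_deriv_apply keys_add_nat)

lemma mps_deriv_add:
  "mps_deriv type_ring i (\<lambda>\<alpha>. f \<alpha> + g \<alpha>) =
    (\<lambda>\<alpha>. mps_deriv type_ring i f \<alpha> + mps_deriv type_ring i g \<alpha>)"
  by (rule ext) (simp add: mps_deriv_apply algebra_simps)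

lemma mps_deriv_const: "mps_deriv type_ring i (mps_C v) = (\<lambda>\<alpha>. 0)"
proof
  fix \<alpha> :: "nat \<Rightarrow>\<^sub>0 nat"
  have "Poly_Mapping.lookup (\<alpha> + Poly_Mapping.single i 1) i \<noteq> 0" by (simp add: lookup_add)
  then have "\<alpha> + Poly_Mapping.single i 1 \<noteq> 0" by (metis lookup_zero)
  then show "mps_deriv type_ring i (mps_C v) \<alpha> = 0"
    by (simp add: mps_deriv_apply mps_const_apply)
qed

lemma mps_deriv_X:
  "mps_deriv type_ring i (mps_X j) = mps_C (if i = j then 1 else 0)"
proof
  fix \<alpha> :: "nat \<Rightarrow>\<^sub>0 nat"
  have "\<alpha> + Poly_Mapping.single i 1 = Poly_Mapping.single j 1 \<longleftrightarrow> i = j \<and> \<alpha> = 0"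
  proof
    assume eq: "\<alpha> + Poly_Mapping.single i 1 = Poly_Mapping.single j 1"
    have "Poly_Mapping.lookup \<alpha> i + 1 = (if i = j then 1 else 0)"
      using arg_cong[OF eq, of "\<lambda>\<alpha>. Poly_Mapping.lookup \<alpha> i"]
      by (auto simp: lookup_add lookup_single when_def)
    then have "i = j" by (simp split: if_splits)
    with eq show "i = j \<and> \<alpha> = 0" by simp
  qed auto
  then show "mps_deriv type_ring i (mps_X j) \<alpha> = mps_C (if i = j then 1 else 0) \<alpha>"
    by (auto simp: mps_deriv_apply mps_const_apply mps_X_def)
qed

text \<open>Shifting the first exponent by one in the i-th place turns the derivative of a factor
  into the weight \<beta>_i on the coefficients of the plain product. Terms of weight 0, which have
  no preimage under the shift, drop out.\<close>

lemma mps_mult_deriv: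
  "(mps_deriv type_ring i f \<otimes>\<^bsub>mps I\<^esub> g) \<alpha> =
    (\<Sum>(\<beta>, \<gamma>) | \<beta> + \<gamma> = \<alpha> + Poly_Mapping.single i 1. of_nat (Poly_Mapping.lookup \<beta> i) * f \<beta> * g \<gamma>)"
proof -
  let ?e = "Poly_Mapping.single i 1 :: nat \<Rightarrow>\<^sub>0 nat"
  let ?h = "\<lambda>(\<beta>, \<gamma>). of_nat (Poly_Mapping.lookup \<beta> i) * f \<beta> * g \<gamma>"
  let ?A = "{(\<beta>, \<gamma>). \<beta> + \<gamma> = \<alpha> + ?e}"
  have "sum ?h ?A = sum ?h {(\<beta>, \<gamma>) \<in> ?A. Poly_Mapping.lookup \<beta> i \<noteq> 0}"
    by (rule sum.mono_neutral_right[OF finite_sum_pairs]) (auto intro!: gr0I)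
  also have "\<dots> = (\<Sum>(\<beta>, \<gamma>) | \<beta> + \<gamma> = \<alpha>. of_nat (Poly_Mapping.lookup \<beta> i + 1) * f (\<beta> + ?e) * g \<gamma>)"
  proof (rule sum.reindex_bij_witness[of _ "\<lambda>(\<beta>, \<gamma>). (\<beta> + ?e, \<gamma>)" "\<lambda>(\<beta>, \<gamma>). (\<beta> - ?e, \<gamma>)"])
    fix x assume x: "x \<in> {(\<beta>, \<gamma>) \<in> ?A. Poly_Mapping.lookup \<beta> i \<noteq> 0}"
    obtain \<beta> \<gamma> where \<beta>: "x = (\<beta>, \<gamma>)" "\<beta> + \<gamma> = \<alpha> + ?e" "Poly_Mapping.lookup \<beta> i \<noteq> 0"
      using x by blast
    note split = single_le_split[OF \<beta>(3)]
    show "(case (case x of (\<beta>, \<gamma>) \<Rightarrow> (\<beta> - ?e, \<gamma>)) of (\<beta>, \<gamma>) \<Rightarrow> (\<beta> + ?e, \<gamma>)) = x"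
      using split by (simp add: \<beta>)
    have "\<beta> - ?e + \<gamma> + ?e = \<alpha> + ?e"
      using split \<beta>(2) by (metis add.assoc add.commute)
    then have "\<beta> - ?e + \<gamma> = \<alpha>" by simp
    then show "(case x of (\<beta>, \<gamma>) \<Rightarrow> (\<beta> - ?e, \<gamma>)) \<in> {(\<beta>, \<gamma>). \<beta> + \<gamma> = \<alpha>}"
      by (simp add: \<beta>)
    have "Poly_Mapping.lookup \<beta> i = Poly_Mapping.lookup (\<beta> - ?e) i + 1"
      using \<beta>(3) by (simp add: lookup_minus)
    then show "(case (case x of (\<beta>, \<gamma>) \<Rightarrow> (\<beta> - ?e, \<gamma>)) of (\<beta>, \<gamma>) \<Rightarrow>
        of_nat (Poly_Mapping.lookup \<beta> i + 1) * f (\<beta> + ?e) * g \<gamma>) = ?h x"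
      using split by (simp add: \<beta>)
  next
    fix x assume "x \<in> {(\<beta>, \<gamma>). \<beta> + \<gamma> = \<alpha>}"
    then obtain \<beta> \<gamma> where \<beta>: "x = (\<beta>, \<gamma>)" "\<beta> + \<gamma> = \<alpha>" by blast
    show "(case (case x of (\<beta>, \<gamma>) \<Rightarrow> (\<beta> + ?e, \<gamma>)) of (\<beta>, \<gamma>) \<Rightarrow> (\<beta> - ?e, \<gamma>)) = x"
      by (simp add: \<beta>)
    have "\<beta> + ?e + \<gamma> = \<alpha> + ?e" using \<beta>(2) by (metis add.assoc add.commute)
    then show "(case x of (\<beta>, \<gamma>) \<Rightarrow> (\<beta> + ?e, \<gamma>)) \<in> {(\<beta>, \<gamma>) \<in> ?A. Poly_Mapping.lookup \<beta> i \<noteq> 0}"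
      by (simp add: \<beta>(1) lookup_add)
  qed
  finally show ?thesis by (simp add: mps_mult mps_deriv_apply case_prod_unfold)
qed

text \<open>Differentiating either factor weights the same sum, by \<beta>_i and by \<gamma>_i; the
  two weights add up to the constant i-th exponent of the total monomial.\<close>

lemma mps_deriv_mult:
  "mps_deriv type_ring i (f \<otimes>\<^bsub>mps I\<^esub> g) =
    (\<lambda>\<alpha>. (mps_deriv type_ring i f \<otimes>\<^bsub>mps I\<^esub> g) \<alpha> +
      (mps_deriv type_ring i g \<otimes>\<^bsub>mps I\<^esub> f) \<alpha>)"
proof
  fix \<alpha> :: "nat \<Rightarrow>\<^sub>0 nat"
  let ?e = "Poly_Mapping.single i 1 :: nat \<Rightarrow>\<^sub>0 nat"
  let ?l = "\<lambda>\<beta>. of_nat (Poly_Mapping.lookup \<beta> i)"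
  have "(mps_deriv type_ring i g \<otimes>\<^bsub>mps I\<^esub> f) \<alpha> =
      (\<Sum>(\<beta>, \<gamma>) | \<beta> + \<gamma> = \<alpha> + ?e. ?l \<gamma> * f \<beta> * g \<gamma>)"
    unfolding mps_mult_deriv
    by (rule sum.reindex_bij_witness[of _ prod.swap prod.swap]) (auto simp: algebra_simps)
  then have "(mps_deriv type_ring i f \<otimes>\<^bsub>mps I\<^esub> g) \<alpha> +
      (mps_deriv type_ring i g \<otimes>\<^bsub>mps I\<^esub> f) \<alpha> =
      (\<Sum>(\<beta>, \<gamma>) | \<beta> + \<gamma> = \<alpha> + ?e. (?l \<beta> + ?l \<gamma>) * (f \<beta> * g \<gamma>))"
    unfolding mps_mult_deriv by (simp add: case_prod_unfold algebra_simps flip: sum.distrib)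
  also have "\<dots> = (\<Sum>(\<beta>, \<gamma>) | \<beta> + \<gamma> = \<alpha> + ?e. ?l (\<alpha> + ?e) * (f \<beta> * g \<gamma>))"
  proof (rule sum.cong)
    fix x assume "x \<in> {(\<beta>, \<gamma>). \<beta> + \<gamma> = \<alpha> + ?e}"
    then have "fst x + snd x = \<alpha> + ?e" by auto
    then have "Poly_Mapping.lookup (fst x) i + Poly_Mapping.lookup (snd x) i = Poly_Mapping.lookup (\<alpha> + ?e) i"
      by (metis lookup_add)
    then have "?l (fst x) + ?l (snd x) = (?l (\<alpha> + ?e) :: 'a)" by (metis of_nat_add)
    then show "(case x of (\<beta>, \<gamma>) \<Rightarrow> (?l \<beta> + ?l \<gamma>) * (f \<beta> * g \<gamma>)) =
        (case x of (\<beta>, \<gamma>) \<Rightarrow> ?l (\<alpha> + ?e) * (f \<beta> * g \<gamma>))"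
      by (simp only: case_prod_unfold)
  qed simp
  also have "\<dots> = mps_deriv type_ring i (f \<otimes>\<^bsub>mps I\<^esub> g) \<alpha>"
    by (simp add: mps_deriv_apply mps_mult case_prod_unfold sum_distrib_left lookup_add)
  finally show "mps_deriv type_ring i (f \<otimes>\<^bsub>mps I\<^esub> g) \<alpha> =
      (mps_deriv type_ring i f \<otimes>\<^bsub>mps I\<^esub> g) \<alpha> +
      (mps_deriv type_ring i g \<otimes>\<^bsub>mps I\<^esub> f) \<alpha>" by simp
qed

subsection \<open>The filtration by order\<close>

text \<open>\<open>mps_shift f i\<close> collects the monomials of \<open>f\<close> whose chosen variable is \<open>X\<^sub>i\<close>, divided by
  \<open>X\<^sub>i\<close>, so that \<open>f\<close> is its constant term plus the sum of the products
  \<open>mps_shift f i \<otimes> mps_X i\<close>.\<close>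

definition mps_shift :: "((nat \<Rightarrow>\<^sub>0 nat) \<Rightarrow> 'v::comm_ring_1) \<Rightarrow> nat \<Rightarrow> (nat \<Rightarrow>\<^sub>0 nat) \<Rightarrow> 'v" where
  "mps_shift f i = (\<lambda>\<beta>. if (SOME j. j \<in> Poly_Mapping.keys (\<beta> + Poly_Mapping.single i 1)) = i
     then f (\<beta> + Poly_Mapping.single i 1) else 0)"

lemma mps_shift_carrier:
  "f \<in> carrier (mps I) \<Longrightarrow> mps_shift f i \<in> carrier (mps I)"
  by (auto simp: mps_shift_def keys_add_nat)

text \<open>Each nonconstant monomial has exactly one chosen variable and is thus counted in exactly
  one summand.\<close>

lemma mps_decomp:
  assumes f: "f \<in> carrier (mps I)" and I: "finite I"
  shows "f = (\<lambda>\<alpha>. mps_C (f 0) \<alpha> +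
    (\<Sum>i\<in>I. (mps_shift f i \<otimes>\<^bsub>mps I\<^esub> mps_X i) \<alpha>))"
proof
  fix \<alpha> :: "nat \<Rightarrow>\<^sub>0 nat"
  define c where "c = (SOME j. j \<in> Poly_Mapping.keys \<alpha>)"
  show "f \<alpha> = mps_C (f 0) \<alpha> +
    (\<Sum>i\<in>I. (mps_shift f i \<otimes>\<^bsub>mps I\<^esub> mps_X i) \<alpha>)"
  proof (cases "\<alpha> = 0")
    case True
    then show ?thesis by (simp add: mps_const_apply mps_mult_X)
  next
    case False
    then have c: "c \<in> Poly_Mapping.keys \<alpha>"
      unfolding c_def by (metis keys_eq_empty some_in_eq)
    have "(mps_shift f i \<otimes>\<^bsub>mps I\<^esub> mps_X i) \<alpha> = (if i = c then f \<alpha> else 0)" for i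
    proof (cases "Poly_Mapping.lookup \<alpha> i = 0")
      case True
      then show ?thesis using c by (auto simp: mps_mult_X in_keys_iff)
    next
      case False
      then show ?thesis
        unfolding mps_mult_X mps_shift_def single_le_split[OF False] c_def[symmetric] by simp
    qed
    then have "(\<Sum>i\<in>I. (mps_shift f i \<otimes>\<^bsub>mps I\<^esub> mps_X i) \<alpha>) = (if c \<in> I then f \<alpha> else 0)"
      using I by simp
    also have "\<dots> = f \<alpha>" using f c by auto
    finally show ?thesis using False by (simp add: mps_const_apply)
  qed
qed

text \<open>An explicit form of the k-th power of the ideal generated by \<open>t\<close> and the
  variables: a monomial of degree e supplies e factors and its coefficient the remaining k - e. The
  truncated subtraction imposes no condition once e reaches k.\<close>

definition mps_order_ideal :: "nat set \<Rightarrow> 'v::comm_ring_1 \<Rightarrow> nat \<Rightarrow> ((nat \<Rightarrow>\<^sub>0 nat) \<Rightarrow> 'v) set" where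
  "mps_order_ideal I t k = {f \<in> carrier (mps I).
     \<forall>\<alpha>. t ^ (k - (\<Sum>i\<in>I. Poly_Mapping.lookup \<alpha> i)) dvd f \<alpha>}"

lemma mps_order_ideal_mult:
  assumes "f \<in> mps_order_ideal I t j" "g \<in> mps_order_ideal I t k"
  shows "f \<otimes>\<^bsub>mps I\<^esub> g \<in> mps_order_ideal I t (j + k)"
proof -
  let ?d = "\<lambda>\<alpha>. \<Sum>i\<in>I. Poly_Mapping.lookup \<alpha> i"
  have "t ^ (j + k - ?d \<alpha>) dvd (f \<otimes>\<^bsub>mps I\<^esub> g) \<alpha>" for \<alpha>
    unfolding mps_mult
  proof (rule dvd_sum)
    fix x assume "x \<in> {(\<beta>, \<gamma>). \<beta> + \<gamma> = \<alpha>}"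
    then obtain \<beta> \<gamma> where x: "x = (\<beta>, \<gamma>)" "\<beta> + \<gamma> = \<alpha>" by blast
    have "?d \<alpha> = ?d \<beta> + ?d \<gamma>" by (simp add: lookup_add sum.distrib flip: x(2))
    \<comment> \<open>Only an inequality holds for truncated subtraction, and divisibility by the
      larger power is what the factors provide.\<close>
    then have "j + k - ?d \<alpha> \<le> (j - ?d \<beta>) + (k - ?d \<gamma>)" by linarith
    then have "t ^ (j + k - ?d \<alpha>) dvd t ^ ((j - ?d \<beta>) + (k - ?d \<gamma>))" by (rule le_imp_power_dvd)
    also have "\<dots> dvd f \<beta> * g \<gamma>"
      using assms unfolding power_add mps_order_ideal_def by (intro mult_dvd_mono) auto
    finally show "t ^ (j + k - ?d \<alpha>) dvd (case x of (\<beta>, \<gamma>) \<Rightarrow> f \<beta> * g \<gamma>)" by (simp add: x)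
  qed
  moreover have "f \<otimes>\<^bsub>mps I\<^esub> g \<in> carrier (mps I)"
    using assms unfolding mps_order_ideal_def by (intro mps_mult_carrier) auto
  ultimately show ?thesis by (simp only: mps_order_ideal_def mem_Collect_eq simp_thms)
qed

lemma mps_order_ideal_0: "mps_order_ideal I t 0 = carrier (mps I)"
  by (intro Set.set_eqI) (simp add: mps_order_ideal_def)

lemma mps_order_ideal_add:
  "f \<in> mps_order_ideal I t k \<Longrightarrow> g \<in> mps_order_ideal I t k \<Longrightarrow> (\<lambda>\<alpha>. f \<alpha> + g \<alpha>) \<in> mps_order_ideal I t k"
  by (auto simp: mps_order_ideal_def)

lemma mps_order_ideal_zero: "(\<lambda>\<alpha>. 0) \<in> mps_order_ideal I t k"
  by (auto simp: mps_order_ideal_def)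

lemma mps_const_order_ideal: "t ^ k dvd v \<Longrightarrow> mps_C v \<in> mps_order_ideal I t k"
  by (auto simp: mps_order_ideal_def mps_const_apply)

lemma mps_X_order_ideal:
  assumes "i \<in> I" "finite I"
  shows "mps_X i \<in> mps_order_ideal I t 1"
proof -
  have "(\<Sum>j\<in>I. Poly_Mapping.lookup (Poly_Mapping.single i (1::nat)) j) = 1"
    using assms by (simp add: lookup_single when_def)
  then show ?thesis using assms(1) by (auto simp: mps_order_ideal_def mps_X_def)
qed

lemma mps_shift_order_ideal:
  assumes f: "f \<in> mps_order_ideal I t (Suc k)" and i: "i \<in> I" "finite I"
  shows "mps_shift f i \<in> mps_order_ideal I t k"
proof -
  let ?d = "\<lambda>\<alpha>. \<Sum>i\<in>I. Poly_Mapping.lookup \<alpha> i"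
  have "t ^ (k - ?d \<beta>) dvd f (\<beta> + Poly_Mapping.single i 1)" for \<beta>
  proof -
    have "(\<Sum>j\<in>I. Poly_Mapping.lookup (Poly_Mapping.single i (1::nat)) j) = 1"
      using i by (simp add: lookup_single when_def)
    then have "?d (\<beta> + Poly_Mapping.single i 1) = Suc (?d \<beta>)" by (simp add: lookup_add sum.distrib)
    moreover have "t ^ (Suc k - ?d (\<beta> + Poly_Mapping.single i 1)) dvd f (\<beta> + Poly_Mapping.single i 1)"
      using f unfolding mps_order_ideal_def by blast
    ultimately show ?thesis by simp
  qed
  moreover have "mps_shift f i \<in> carrier (mps I)"
    using f unfolding mps_order_ideal_def by (intro mps_shift_carrier) blast
  ultimately show ?thesis by (auto simp: mps_order_ideal_def mps_shift_def)
qed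

section \<open>Powers of the ideal generated by t and the variables, and completeness\<close>

lemma ideal_power_0: "ideal_power R m 0 = carrier R"
  by (simp add: nat_pow_def ideals_set_def)

lemma ideal_power_Suc: "ideal_power R m (Suc k) = ideal_prod R (ideal_power R m k) m"
  by (simp add: nat_pow_def ideals_set_def)

text \<open>Additivity of the order gives one inclusion. For the other, the constant term splits off
  a factor \<open>t\<close>, and every remaining part of the decomposition splits off a variable,
  leaving cofactors of order \<open>k\<close>.\<close>

lemma ideal_power_mps:
  assumes I: "finite I"
  shows "ideal_power (mps I) (mps_order_ideal I t 1) k = mps_order_ideal I t k"
proof (induction k)
  case 0
  then show ?case by (simp only: ideal_power_0 mps_order_ideal_0)
next
  case (Suc k)
  let ?P = "ideal_prod (mps I) (mps_order_ideal I t k) (mps_order_ideal I t 1)"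
  have "f \<in> mps_order_ideal I t (Suc k)" if "f \<in> ?P" for f
    using that
  proof induction
    case (prod f g)
    then show ?case using mps_order_ideal_mult[of f I t k g 1] by simp
  next
    case (sum f g)
    then show ?case using mps_order_ideal_add by simp
  qed
  moreover have "f \<in> ?P" if f: "f \<in> mps_order_ideal I t (Suc k)" for f
  proof -
    have add: "(\<lambda>\<alpha>. g \<alpha> + h \<alpha>) \<in> ?P" if "g \<in> ?P" "h \<in> ?P" for g h
      using ideal_prod.sum[OF that] by simp
    have prod: "g \<otimes>\<^bsub>mps I\<^esub> h \<in> ?P"
      if "g \<in> mps_order_ideal I t k" "h \<in> mps_order_ideal I t 1" for g h
      using ideal_prod.prod[OF that] .
    have zero: "(\<lambda>\<alpha>. 0) \<in> ?P"
    proof -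
      have "(\<lambda>\<alpha>. 0) \<otimes>\<^bsub>mps I\<^esub> (\<lambda>\<alpha>. 0) \<in> ?P"
        by (intro prod mps_order_ideal_zero)
      moreover have "(\<lambda>\<alpha>. 0) \<otimes>\<^bsub>mps I\<^esub> (\<lambda>\<alpha>. 0 :: 'a) = (\<lambda>\<alpha>. 0)"
        by (rule ext) (simp add: mps_mult case_prod_unfold)
      ultimately show ?thesis by (simp only:)
    qed
    have sum: "(\<lambda>\<alpha>. \<Sum>i\<in>I'. h i \<alpha>) \<in> ?P" if "finite I'" "\<And>i. i \<in> I' \<Longrightarrow> h i \<in> ?P" for I' :: "nat set" and h
      using that
    proof induction
      case empty
      show ?case using zero by simp
    next
      case (insert i I')
      then have "(\<lambda>\<alpha>. h i \<alpha> + (\<Sum>i\<in>I'. h i \<alpha>)) \<in> ?P" by (intro add) auto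
      with insert show ?case by simp
    qed
    have "t ^ Suc k dvd f 0" using f by (auto simp: mps_order_ideal_def dest: spec[of _ 0])
    then obtain v where v: "f 0 = t ^ Suc k * v" by blast
    have "mps_C (f 0) = mps_C (t ^ k * v) \<otimes>\<^bsub>mps I\<^esub> mps_C t"
      by (rule ext) (simp add: mps_mult_const mps_const_apply v mult_ac)
    also have "\<dots> \<in> ?P" by (intro prod mps_const_order_ideal) simp_all
    finally have "mps_C (f 0) \<in> ?P" .
    moreover have "(\<lambda>\<alpha>. \<Sum>i\<in>I. (mps_shift f i \<otimes>\<^bsub>mps I\<^esub> mps_X i) \<alpha>) \<in> ?P"
      using I f by (intro sum prod mps_shift_order_ideal mps_X_order_ideal)
    ultimately have "(\<lambda>\<alpha>. mps_C (f 0) \<alpha> +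
        (\<Sum>i\<in>I. (mps_shift f i \<otimes>\<^bsub>mps I\<^esub> mps_X i) \<alpha>)) \<in> ?P" by (rule add)
    moreover have "f \<in> carrier (mps I)" using f unfolding mps_order_ideal_def by blast
    ultimately show ?thesis by (subst mps_decomp[OF _ I])
  qed
  ultimately show ?case unfolding ideal_power_Suc Suc.IH by blast
qed

lemma ideal_power_type_ring:
  "ideal_power type_ring (PIdl\<^bsub>type_ring\<^esub> t) k = {v. t ^ k dvd (v :: 'v::comm_ring_1)}"
proof (induction k)
  case 0
  show ?case by (simp only: ideal_power_0) simp
next
  case (Suc k)
  let ?P = "ideal_prod type_ring {v. t ^ k dvd v} (PIdl\<^bsub>type_ring\<^esub> t)"
  have PIdl: "PIdl\<^bsub>type_ring\<^esub> t = {v. t dvd v}"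
    by (auto simp: cgenideal_def dvd_def mult.commute)
  have "t ^ Suc k dvd v" if "v \<in> ?P" for v
    using that
  proof induction
    case (prod i j)
    then show ?case using mult_dvd_mono[of "t ^ k" i t j] by (simp add: PIdl mult.commute)
  qed simp
  moreover have "v \<in> ?P" if v: "t ^ Suc k dvd v" for v
  proof -
    obtain u where u: "v = t ^ Suc k * u" using v by blast
    have "(t ^ k * u) \<otimes>\<^bsub>type_ring\<^esub> t \<in> ?P" by (rule ideal_prod.prod) (auto simp: PIdl)
    then show ?thesis by (simp add: u mult_ac)
  qed
  ultimately show ?case unfolding ideal_power_Suc Suc.IH by blast
qed

text \<open>Convergence is coefficientwise in the t-adic topology of \<open>V\<close>, with the rate
  of convergence depending on the degree of the monomial.\<close>

lemma mps_order_complete: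
  fixes x d :: "nat \<Rightarrow> (nat \<Rightarrow>\<^sub>0 nat) \<Rightarrow> 'v::comm_ring_1"
  assumes V: "adically_complete type_ring (PIdl\<^bsub>type_ring\<^esub> t)"
    and x: "\<And>k. x k \<in> carrier (mps I)"
    and d: "\<And>k. d k \<in> mps_order_ideal I t k" "\<And>k \<alpha>. x (Suc k) \<alpha> = x k \<alpha> + d k \<alpha>"
  obtains y where "y \<in> carrier (mps I)"
    "\<And>k. (\<lambda>\<alpha>. y \<alpha> - x k \<alpha>) \<in> mps_order_ideal I t k"
proof -
  let ?d = "\<lambda>\<alpha>. \<Sum>i\<in>I. Poly_Mapping.lookup \<alpha> i"
  have complete: "\<exists>y. \<forall>k. t ^ k dvd y - z k" if "\<And>k. t ^ k dvd z (Suc k) - z k" for z :: "nat \<Rightarrow> 'v"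
    using V that unfolding adically_complete_def ideal_power_type_ring by auto
  \<comment> \<open>The k-th increment controls a coefficient of degree e only modulo t^(k-e).
    Delaying the sequence by e gives a genuine t-adic Cauchy sequence.\<close>
  have "\<exists>y. \<forall>k. t ^ k dvd y - x (k + ?d \<alpha>) \<alpha>" for \<alpha>
  proof (rule complete)
    fix k
    have "t ^ (k + ?d \<alpha> - ?d \<alpha>) dvd d (k + ?d \<alpha>) \<alpha>"
      using d(1) unfolding mps_order_ideal_def by blast
    then show "t ^ k dvd x (Suc k + ?d \<alpha>) \<alpha> - x (k + ?d \<alpha>) \<alpha>" by (simp add: d(2))
  qed
  then obtain y0 where y0: "\<And>\<alpha> k. t ^ k dvd y0 \<alpha> - x (k + ?d \<alpha>) \<alpha>" by metis
  \<comment> \<open>Coefficients involving variables outside \<open>I\<close> are reset to 0 to stay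
    in the carrier.\<close>
  define y where "y \<alpha> = (if Poly_Mapping.keys \<alpha> \<subseteq> I then y0 \<alpha> else 0)" for \<alpha>
  have "t ^ (k - ?d \<alpha>) dvd y \<alpha> - x k \<alpha>" for k \<alpha>
  proof (cases "Poly_Mapping.keys \<alpha> \<subseteq> I \<and> ?d \<alpha> \<le> k")
    case True
    then show ?thesis using y0[of "k - ?d \<alpha>" \<alpha>] by (simp add: y_def)
  next
    case False
    then show ?thesis using x[of k] by (cases "Poly_Mapping.keys \<alpha> \<subseteq> I") (auto simp: y_def)
  qed
  moreover have "y \<in> carrier (mps I)" by (simp add: y_def)
  ultimately show thesis
    using x by (intro that[of y]) (auto simp: mps_order_ideal_def)
qed

section \<open>Power series extensions\<close>

text \<open>Zorn's lemma on the ideals that contain \<open>c\<close> but not 1; the principal ideal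
  of a nonunit is a starting point.\<close>

lemma (in cring) nonunit_in_maximalideal:
  assumes c: "c \<in> carrier R" "c \<notin> Units R"
  obtains M where "maximalideal M R" "c \<in> M"
proof -
  define \<A> where "\<A> = {J. ideal J R \<and> c \<in> J \<and> \<one> \<notin> J}"
  have "PIdl c \<in> \<A>"
    using c cgenideal_ideal[OF c(1)] cgenideal_self[OF c(1)]
    by (auto simp: \<A>_def cgenideal_def Units_def m_comm)
  moreover have "\<Union> \<C> \<in> \<A>" if \<C>: "\<C> \<noteq> {}" "subset.chain \<A> \<C>" for \<C>
  proof -
    have "subset.chain {I. ideal I R} \<C>" using \<C>(2) by (auto simp: subset_chain_def \<A>_def)
    then have "ideal (\<Union> \<C>) R" using chain_Union_is_ideal[of \<C>] \<C>(1) by simp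
    moreover have "\<C> \<subseteq> \<A>" using \<C>(2) by (simp add: subset_chain_def)
    ultimately show ?thesis using \<C>(1) by (auto simp: \<A>_def)
  qed
  ultimately obtain M where M: "M \<in> \<A>" "\<And>J. J \<in> \<A> \<Longrightarrow> M \<subseteq> J \<Longrightarrow> J = M"
    using subset_Zorn_nonempty[of \<A>] by (metis empty_iff)
  have "maximalideal M R"
  proof (rule maximalidealI)
    show "carrier R \<noteq> M" using M(1) by (auto simp: \<A>_def)
    show "J = M \<or> J = carrier R" if J: "ideal J R" "M \<subseteq> J" "J \<subseteq> carrier R" for J
      using M J ideal.one_imp_carrier[OF J(1)] by (auto simp: \<A>_def)
  qed (use M(1) in \<open>auto simp: \<A>_def\<close>)
  with M(1) show thesis by (intro that) (auto simp: \<A>_def)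
qed

lemma one_notin_maximalideal: "maximalideal M R \<Longrightarrow> \<one>\<^bsub>R\<^esub> \<notin> M"
  using ideal.one_imp_carrier[OF maximalideal.axioms(1)] maximalideal.I_notcarr by metis

lemma ideal_power_ideal: "cring R \<Longrightarrow> ideal m R \<Longrightarrow> ideal (ideal_power R m k) R"
proof (induction k)
  case 0
  then interpret cring R by blast
  show ?case unfolding ideal_power_0 by (rule oneideal)
next
  case (Suc k)
  then interpret cring R by blast
  show ?case unfolding ideal_power_Suc using Suc by (intro ideal_prod_is_ideal) blast+
qed

lemma type_ring_idealD:
  assumes "ideal J (type_ring :: 'c::comm_ring_1 ring)"
  shows "0 \<in> J" "x \<in> J \<Longrightarrow> y \<in> J \<Longrightarrow> x + y \<in> J" "x \<in> J \<Longrightarrow> c * x \<in> J" "x \<in> J \<Longrightarrow> - x \<in> J"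
  using additive_subgroup.zero_closed[OF ideal.axioms(1)[OF assms]]
    additive_subgroup.a_closed[OF ideal.axioms(1)[OF assms], of x y]
    ideal.I_l_closed[OF assms, of x c] ideal.I_l_closed[OF assms, of x "-1"] by auto

lemma type_ring_ideal_sum:
  assumes "ideal J (type_ring :: 'c::comm_ring_1 ring)" "\<And>i. i \<in> I \<Longrightarrow> h i \<in> J"
  shows "sum h I \<in> J"
  using assms(2) by (induction I rule: infinite_finite_induct) (auto intro: type_ring_idealD[OF assms(1)])

text \<open>The residue ring modulo \<open>t\<close> is a field: a nonmultiple of \<open>t\<close>
  generates, together with \<open>t\<close>, the unit ideal.\<close>

lemma maximal_principal_ideal_inverse:
  fixes t v :: "'v::comm_ring_1"
  assumes max: "maximalideal (PIdl\<^bsub>type_ring\<^esub> t) type_ring" and v: "\<not> t dvd v"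
  obtains u where "t dvd v * u - 1"
proof -
  interpret cring "type_ring :: 'v ring" by (rule cring_type_ring)
  let ?J = "PIdl\<^bsub>type_ring\<^esub> t <+>\<^bsub>type_ring\<^esub> PIdl\<^bsub>type_ring\<^esub> v"
  have J: "x \<in> ?J \<longleftrightarrow> (\<exists>a b. x = a * t + b * v)" for x
    by (auto simp: set_add_def' cgenideal_def)
  have "ideal ?J type_ring" by (intro add_ideals cgenideal_ideal) simp_all
  moreover have "PIdl\<^bsub>type_ring\<^esub> t \<subseteq> ?J"
  proof
    fix x assume "x \<in> PIdl\<^bsub>type_ring\<^esub> t"
    then obtain a where "x = a * t + 0 * v" by (auto simp: cgenideal_def)
    then show "x \<in> ?J" unfolding J by blast
  qed
  ultimately have "?J = PIdl\<^bsub>type_ring\<^esub> t \<or> ?J = carrier type_ring"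
    using maximalideal.I_maximal[OF max] by simp
  moreover have "v \<in> ?J" unfolding J by (intro exI[of _ 0] exI[of _ 1]) simp
  moreover have "v \<notin> PIdl\<^bsub>type_ring\<^esub> t" using v by (auto simp: cgenideal_def)
  ultimately have "1 \<in> ?J" by auto
  then obtain a b where "1 = a * t + b * v" unfolding J by blast
  then have "v * b - 1 = t * (- a)" by (simp add: algebra_simps)
  then show thesis by (intro that[of b]) simp
qed

text \<open>The setting of the theorem over types, with \<open>t\<close> in the role of p and a
  finite set \<open>I\<close> indexing the variables.\<close>

locale power_series_extension =
  fixes I :: "nat set" and t :: "'v::comm_ring_1" and MC :: "'c::idom set"
    and \<phi> :: "((nat \<Rightarrow>\<^sub>0 nat) \<Rightarrow> 'v) \<Rightarrow> 'c" and m :: "((nat \<Rightarrow>\<^sub>0 nat) \<Rightarrow> 'v) set"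
    and R :: "((nat \<Rightarrow>\<^sub>0 nat) \<Rightarrow> 'v) ring"
  defines "R \<equiv> mps I"
  assumes I: "finite I"
    and V_complete: "adically_complete type_ring (PIdl\<^bsub>type_ring\<^esub> t)"
    and V_maximal: "maximalideal (PIdl\<^bsub>type_ring\<^esub> t) type_ring"
    and C_local: "local_ring type_ring MC"
    and C_separated: "(\<Inter>k. ideal_power type_ring MC k) = {0}"
    and C_char_0: "of_nat k = (0::'c) \<Longrightarrow> k = 0"
    and m: "maximalideal m R"
    and hom: "\<phi> \<in> ring_hom R type_ring"
    and inj: "inj_on \<phi> (carrier R)"
    and finite_ext: "fin_gen_module R (restrict_scalars \<phi> type_ring)"
begin

definition "S \<equiv> \<phi> ` carrier R"

lemma R_simps: "f \<oplus>\<^bsub>R\<^esub> g = (\<lambda>\<alpha>. f \<alpha> + g \<alpha>)" "\<zero>\<^bsub>R\<^esub> = (\<lambda>\<alpha>. 0)" "\<one>\<^bsub>R\<^esub> = mps_C 1"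
  by (simp_all add: R_def)

text \<open>The predicate for ideals carries the ring axioms, so they are read off from
  \<open>m\<close>.\<close>

lemma ring_R: "ring R"
  using m by (intro ideal.axioms(2) maximalideal.axioms(1))

lemma cring_R: "cring R"
  using ring_R ring.ring_simprules(5) mps_mult_comm
  by (intro cring.intro comm_monoid.intro comm_monoid_axioms.intro ring.is_monoid) (auto simp: R_def)

lemma \<phi>_simps:
  assumes "f \<in> carrier R" "g \<in> carrier R"
  shows "\<phi> (\<lambda>\<alpha>. f \<alpha> + g \<alpha>) = \<phi> f + \<phi> g" "\<phi> (f \<otimes>\<^bsub>R\<^esub> g) = \<phi> f * \<phi> g"
  using ring_hom_add[OF hom assms] ring_hom_mult[OF hom assms] by (simp_all add: R_simps)

lemma \<phi>_one: "\<phi> (mps_C 1) = 1"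
  using ring_hom_one[OF hom] by (simp add: R_simps)

lemma R_closed:
  "f \<in> carrier R \<Longrightarrow> g \<in> carrier R \<Longrightarrow> (\<lambda>\<alpha>. f \<alpha> + g \<alpha>) \<in> carrier R"
  "f \<in> carrier R \<Longrightarrow> g \<in> carrier R \<Longrightarrow> (\<lambda>\<alpha>. f \<alpha> - g \<alpha>) \<in> carrier R"
  "f \<in> carrier R \<Longrightarrow> g \<in> carrier R \<Longrightarrow> f \<otimes>\<^bsub>R\<^esub> g \<in> carrier R"
  "(\<lambda>\<alpha>. 0) \<in> carrier R" "mps_C v \<in> carrier R"
  unfolding R_def by (simp_all add: mps_const_apply) (rule mps_mult_carrier[unfolded mps_simps]; blast)

lemma \<phi>_zero: "\<phi> (\<lambda>\<alpha>. 0) = 0"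
proof -
  have "\<phi> (\<lambda>\<alpha>. 0) = \<phi> (\<lambda>\<alpha>. 0) + \<phi> (\<lambda>\<alpha>. 0)"
    using \<phi>_simps(1)[OF R_closed(4) R_closed(4)] by (simp only: add_0)
  then show ?thesis by (metis add_cancel_right_right)
qed

lemma \<phi>_diff:
  assumes "f \<in> carrier R" "g \<in> carrier R"
  shows "\<phi> (\<lambda>\<alpha>. f \<alpha> - g \<alpha>) = \<phi> f - \<phi> g"
  using \<phi>_simps(1)[OF R_closed(2)[OF assms] assms(2)] by simp

lemma \<phi>_sum:
  assumes "finite A" "\<And>i. i \<in> A \<Longrightarrow> h i \<in> carrier R"
  shows "(\<lambda>\<alpha>. \<Sum>i\<in>A. h i \<alpha>) \<in> carrier R \<and> \<phi> (\<lambda>\<alpha>. \<Sum>i\<in>A. h i \<alpha>) = (\<Sum>i\<in>A. \<phi> (h i))"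
  using assms
proof induction
  case empty
  show ?case using R_closed(4) \<phi>_zero by simp
next
  case (insert i A)
  then have "(\<lambda>\<alpha>. \<Sum>i\<in>A. h i \<alpha>) \<in> carrier R" "h i \<in> carrier R" by auto
  from R_closed(1)[OF this(2,1)] \<phi>_simps(1)[OF this(2,1)] insert show ?case by simp
qed

lemma is_subring_S: "is_subring S"
  unfolding is_subring_def S_def
proof (intro conjI ballI)
  show "1 \<in> \<phi> ` carrier R" using \<phi>_one R_closed(5)[of 1] by (metis imageI)
  fix x y assume "x \<in> \<phi> ` carrier R" "y \<in> \<phi> ` carrier R"
  then obtain f g where fg: "x = \<phi> f" "y = \<phi> g" "f \<in> carrier R" "g \<in> carrier R" by blast
  show "x - y \<in> \<phi> ` carrier R" "x * y \<in> \<phi> ` carrier R"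
    unfolding fg(1,2) \<phi>_diff[OF fg(3,4), symmetric] \<phi>_simps(2)[OF fg(3,4), symmetric]
    by (rule imageI[OF R_closed(2)[OF fg(3,4)]], rule imageI[OF R_closed(3)[OF fg(3,4)]])
qed

text \<open>The combinations of \<open>B\<close> with coefficients in \<open>S\<close> form an
  \<open>R\<close>-submodule containing \<open>B\<close>. This turns generation, stated as an
  intersection of submodules, into explicit expansions.\<close>

lemma finite_subring_extension_ex: "\<exists>B. finite_subring_extension S B"
proof -
  let ?N = "restrict_scalars \<phi> type_ring"
  interpret R: cring R by (rule cring_R)
  have N: "carrier ?N = UNIV" "\<zero>\<^bsub>?N\<^esub> = 0" "x \<oplus>\<^bsub>?N\<^esub> y = x + y" "f \<odot>\<^bsub>?N\<^esub> x = \<phi> f * x" for x y f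
    by (simp_all add: restrict_scalars_def)
  interpret N: module R ?N
  proof (rule moduleI[OF cring_R])
    show "abelian_group ?N"
      by (rule abelian_groupI) (auto simp: N algebra_simps intro: exI[of _ "- _"])
  qed (auto simp: N R_simps \<phi>_simps \<phi>_one algebra_simps)
  have minus: "\<ominus>\<^bsub>?N\<^esub> x = - x" for x
    using N.M.minus_equality[of "- x" x] by (simp add: N)
  obtain B where B: "finite B" "gen_submodule R ?N B = UNIV"
    using finite_ext by (auto simp: fin_gen_module_def N)
  let ?H = "{\<Sum>b\<in>B. r b * b | r. \<forall>b\<in>B. r b \<in> S}"
  have H: "x \<in> ?H \<longleftrightarrow> (\<exists>r. (\<forall>b\<in>B. r b \<in> S) \<and> x = (\<Sum>b\<in>B. r b * b))" for x by blast
  note S = is_subring_S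
  have smult: "s * x \<in> ?H" if s: "s \<in> S" and x: "x \<in> ?H" for s x
  proof -
    obtain r where r: "\<forall>b\<in>B. r b \<in> S" "x = (\<Sum>b\<in>B. r b * b)" using x unfolding H by blast
    have "s * x = (\<Sum>b\<in>B. (s * r b) * b)" by (simp add: r sum_distrib_left mult.assoc)
    moreover have "\<forall>b\<in>B. s * r b \<in> S" using r s is_subring_mult[OF S] by blast
    ultimately show ?thesis unfolding H by (intro exI[of _ "\<lambda>b. s * r b"] conjI)
  qed
  have "submodule ?H R ?N"
  proof (rule N.submoduleI)
    show "?H \<subseteq> carrier ?N" by (simp add: N)
    show "\<zero>\<^bsub>?N\<^esub> \<in> ?H" unfolding N H
      by (intro exI[of _ "\<lambda>_. 0"]) (simp add: is_subring_zero[OF S])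
    show "x \<oplus>\<^bsub>?N\<^esub> y \<in> ?H" if xy: "x \<in> ?H" "y \<in> ?H" for x y
    proof -
      obtain r q where rq: "\<forall>b\<in>B. r b \<in> S" "x = (\<Sum>b\<in>B. r b * b)" "\<forall>b\<in>B. q b \<in> S" "y = (\<Sum>b\<in>B. q b * b)"
        using xy unfolding H by blast
      have "x + y = (\<Sum>b\<in>B. (r b + q b) * b)" by (simp add: rq distrib_right sum.distrib)
      moreover have "\<forall>b\<in>B. r b + q b \<in> S" using rq is_subring_add[OF S] by blast
      ultimately show ?thesis unfolding H N by (intro exI[of _ "\<lambda>b. r b + q b"] conjI)
    qed
    show "\<ominus>\<^bsub>?N\<^esub> x \<in> ?H" if x: "x \<in> ?H" for x
      using smult[OF is_subring_uminus[OF S is_subring_one[OF S]] x] by (simp add: minus)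
    show "f \<odot>\<^bsub>?N\<^esub> x \<in> ?H" if "f \<in> carrier R" "x \<in> ?H" for f x
      unfolding N using that by (intro smult) (auto simp: S_def)
  qed
  moreover have "B \<subseteq> ?H"
  proof
    fix c assume c: "c \<in> B"
    have "c = (\<Sum>b\<in>B. (if b = c then 1 else 0) * b)"
      using B(1) c by (simp add: if_distrib[of "\<lambda>x. x * _"] cong: if_cong)
    moreover have "\<forall>b\<in>B. (if b = c then 1 else 0) \<in> S"
      using is_subring_one[OF S] is_subring_zero[OF S] by simp
    ultimately show "c \<in> ?H" unfolding H by (intro exI[of _ "\<lambda>b. if b = c then 1 else 0"] conjI)
  qed
  ultimately have "UNIV \<subseteq> ?H" using N.gen_submodule_minimal B(2) by blast
  then have "\<exists>r. (\<forall>b\<in>B. r b \<in> S) \<and> x = (\<Sum>b\<in>B. r b * b)" for x using H by blast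
  then have "finite_subring_extension S B"
    using S B(1) C_char_0 by unfold_locales blast+
  then show ?thesis by blast
qed

definition "B \<equiv> SOME B. finite_subring_extension S B"

sublocale finite_subring_extension S B
  unfolding B_def using finite_subring_extension_ex by (rule someI_ex)

section \<open>The maximal ideal of R and its image in C\<close>

lemma MC_maximal: "maximalideal MC type_ring"
  using C_local unfolding local_ring_def by blast

lemma nonunit_in_MC:
  assumes "\<And>d. c * d \<noteq> 1"
  shows "c \<in> MC"
proof -
  interpret cring "type_ring :: 'c ring" by (rule cring_type_ring)
  obtain M where "maximalideal M type_ring" "c \<in> M"
    using nonunit_in_maximalideal[of c] assms by (auto simp: Units_def)
  then show ?thesis using C_local unfolding local_ring_def by blast
qed

text \<open>Otherwise the image of \<open>f\<close> is a unit of \<open>C\<close>. By integrality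
  its inverse lies in \<open>S\<close>, so by injectivity \<open>f\<close> is a unit of
  \<open>R\<close> inside a proper ideal.\<close>

lemma proper_ideal_into_MC:
  assumes J: "ideal J R" "\<one>\<^bsub>R\<^esub> \<notin> J" and f: "f \<in> J"
  shows "\<phi> f \<in> MC"
proof (rule nonunit_in_MC, rule notI)
  fix d assume d: "\<phi> f * d = 1"
  have fc: "f \<in> carrier R" using ideal.Icarr[OF J(1) f] .
  then have "\<phi> f \<in> S" unfolding S_def by (rule imageI)
  then have "d \<in> S" using d by (rule unit_of_subring)
  then obtain g where g: "g \<in> carrier R" "d = \<phi> g" unfolding S_def by blast
  have "\<phi> (f \<otimes>\<^bsub>R\<^esub> g) = \<phi> \<one>\<^bsub>R\<^esub>" using d fc g by (simp add: \<phi>_simps \<phi>_one R_simps)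
  then have "f \<otimes>\<^bsub>R\<^esub> g = \<one>\<^bsub>R\<^esub>"
    using R_closed(3)[OF fc g(1)] R_closed(5)[of 1] by (intro inj_onD[OF inj]) (simp_all add: R_simps(3))
  with ideal.I_r_closed[OF J(1) f g(1)] J(2) show False by simp
qed

abbreviation "J \<equiv> mps_order_ideal I t"

lemma J_subset: "J k \<subseteq> carrier R"
  unfolding mps_order_ideal_def R_def by blast

text \<open>At order 1 a monomial of positive degree already satisfies its condition, so the
  constant term alone decides.\<close>

lemma J_1_I:
  assumes "f \<in> carrier R" "t dvd f 0"
  shows "f \<in> J 1"
proof -
  have "t ^ (1 - (\<Sum>i\<in>I. Poly_Mapping.lookup \<alpha> i)) dvd f \<alpha>" for \<alpha>
  proof (cases "\<alpha> = 0 \<or> \<not> Poly_Mapping.keys \<alpha> \<subseteq> I")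
    case True
    then show ?thesis using assms by (auto simp: R_def)
  next
    case False
    then obtain i where "i \<in> I" "Poly_Mapping.lookup \<alpha> i \<noteq> 0"
      by (metis in_keys_iff keys_eq_empty subsetD ex_in_conv)
    then have "(\<Sum>i\<in>I. Poly_Mapping.lookup \<alpha> i) \<noteq> 0" using I by auto
    then show ?thesis by simp
  qed
  with assms(1) show ?thesis unfolding mps_order_ideal_def R_def by blast
qed

lemma t_not_dvd_1: "\<not> t dvd 1"
  using one_notin_maximalideal[OF V_maximal] by (auto simp: cgenideal_def dvd_def mult.commute)

lemma m_into_MC: "f \<in> m \<Longrightarrow> \<phi> f \<in> MC"
  using proper_ideal_into_MC[OF maximalideal.axioms(1)[OF m] one_notin_maximalideal[OF m]] .

text \<open>Proper ideals of \<open>R\<close> map into the maximal ideal of \<open>C\<close>, so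
  \<open>m\<close> equals the preimage of that ideal and contains \<open>J 1\<close>. Conversely, an
  element of \<open>m\<close> whose constant term is prime to \<open>t\<close> would, after
  inverting that term modulo \<open>t\<close>, put 1 into \<open>m\<close>.\<close>

lemma m_eq: "m = J 1"
proof
  have m_ideal: "ideal m R" using m by (rule maximalideal.axioms)
  interpret R: cring R by (rule cring_R)
  have J_ideal: "ideal (J 1) R"
  proof (rule idealI[OF ring_R])
    show "subgroup (J 1) (add_monoid R)"
    proof (rule R.add.subgroupI)
      show "J 1 \<subseteq> carrier R" by (rule J_subset)
      show "J 1 \<noteq> {}" using mps_order_ideal_zero by blast
      show "f \<oplus>\<^bsub>R\<^esub> g \<in> J 1" if "f \<in> J 1" "g \<in> J 1" for f g
        using mps_order_ideal_add[OF that] by (simp add: R_simps)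
      show "\<ominus>\<^bsub>R\<^esub> f \<in> J 1" if f: "f \<in> J 1" for f
      proof -
        have fc: "f \<in> carrier R" using f J_subset by blast
        have "(\<lambda>\<alpha>. - f \<alpha>) \<in> carrier R" using R_closed(2)[OF R_closed(4) fc] by simp
        then have "\<ominus>\<^bsub>R\<^esub> f = (\<lambda>\<alpha>. - f \<alpha>)"
          using fc by (intro R.minus_equality) (simp_all add: R_simps)
        then show ?thesis using f by (auto simp: mps_order_ideal_def)
      qed
    qed
    show "g \<otimes>\<^bsub>R\<^esub> f \<in> J 1" "f \<otimes>\<^bsub>R\<^esub> g \<in> J 1" if "f \<in> J 1" "g \<in> carrier R" for f g
      using that mps_order_ideal_mult[of f I t 1 g 0] unfolding R_def mps_order_ideal_0
      by (auto simp: mps_mult_comm[of I g])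
  qed
  have "\<one>\<^bsub>R\<^esub> \<notin> J 1"
    using t_not_dvd_1 by (auto simp: R_simps mps_order_ideal_def mps_const_apply dest: spec[of _ 0])
  have MC_ideal: "ideal MC type_ring" by (rule maximalideal.axioms[OF MC_maximal])
  let ?K = "{f \<in> carrier R. \<phi> f \<in> MC}"
  interpret h: ring_hom_ring R "type_ring :: 'c ring" \<phi>
    using ring_R cring_type_ring hom by (intro ring_hom_ringI2) (auto simp: cring_def)
  have "ideal ?K R" using h.ideal_vimage[OF MC_ideal] by simp
  moreover have "m \<subseteq> ?K" using m_into_MC ideal.Icarr[OF m_ideal] by blast
  moreover have "\<one>\<^bsub>R\<^esub> \<notin> ?K"
    using one_notin_maximalideal[OF MC_maximal] by (simp add: R_simps \<phi>_one)
  \<comment> \<open>The preimage of the maximal ideal of \<open>C\<close> is proper and contains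
    \<open>m\<close>, hence equals it by maximality.\<close>
  ultimately have "?K = m" using maximalideal.I_maximal[OF m, of ?K] R.one_closed by blast
  then show "J 1 \<subseteq> m"
    using proper_ideal_into_MC[OF J_ideal \<open>\<one>\<^bsub>R\<^esub> \<notin> J 1\<close>] J_subset[of 1] by blast
  show "m \<subseteq> J 1"
  proof
    fix f assume f: "f \<in> m"
    have fc: "f \<in> carrier R" using ideal.Icarr[OF m_ideal f] .
    show "f \<in> J 1"
    proof (rule ccontr)
      assume "f \<notin> J 1"
      then have "\<not> t dvd f 0" using J_1_I fc by blast
      then obtain u where u: "t dvd f 0 * u - 1" using maximal_principal_ideal_inverse[OF V_maximal] by blast
      let ?g = "f \<otimes>\<^bsub>R\<^esub> mps_C u"
      have g: "?g \<in> m" using ideal.I_r_closed[OF m_ideal f R_closed(5)] .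
      \<comment> \<open>The constant term of 1 - fu is divisible by \<open>t\<close>, so this
        difference lies in \<open>J 1\<close>, which is already known to be inside
        \<open>m\<close>.\<close>
      let ?h = "\<lambda>\<alpha>. mps_C 1 \<alpha> - ?g \<alpha>"
      have hc: "?h \<in> carrier R" using fc by (intro R_closed)
      have "?h 0 = - (f 0 * u - 1)" by (simp add: R_def mps_mult_const mps_const_apply)
      then have "t dvd ?h 0" using u by (simp only: dvd_minus_iff)
      then have h: "?h \<in> m" using J_1_I[OF hc] \<open>J 1 \<subseteq> m\<close> by blast
      have "\<one>\<^bsub>R\<^esub> = ?g \<oplus>\<^bsub>R\<^esub> ?h" by (simp add: R_simps)
      moreover have "?g \<oplus>\<^bsub>R\<^esub> ?h \<in> m"
        by (rule additive_subgroup.a_closed[OF ideal.axioms(1)[OF m_ideal] g h])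
      ultimately show False using one_notin_maximalideal[OF m] by simp
    qed
  qed
qed

lemma ideal_power_m: "ideal_power R m k = J k"
  unfolding m_eq R_def by (rule ideal_power_mps[OF I])

text \<open>This transfers separatedness from the powers of the maximal ideal of \<open>C\<close> to
  the coarser-indexed filtration by m^k C.\<close>

lemma ideal_power_into_MC:
  assumes "f \<in> ideal_power R m k"
  shows "\<phi> f \<in> ideal_power type_ring MC k"
  using assms
proof (induction k arbitrary: f)
  case 0
  then show ?case by (simp only: ideal_power_0) simp
next
  case (Suc k)
  have sub: "ideal_power R m k \<subseteq> carrier R" using ideal_power_m J_subset by blast
  have msub: "m \<subseteq> carrier R" using m_eq J_subset by blast
  have prod_sub: "ideal_power R m (Suc k) \<subseteq> carrier R" using ideal_power_m J_subset by blast
  from Suc.prems show ?case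
    unfolding ideal_power_Suc
  proof induction
    case (prod f g)
    then show ?case
      using ideal_prod.prod[OF Suc.IH[OF prod(1)] m_into_MC[OF prod(2)], of type_ring] \<phi>_simps(2)[of f g] sub msub
      by (auto simp: subset_iff)
  next
    case (sum f g)
    then have "f \<in> carrier R" "g \<in> carrier R" using prod_sub unfolding ideal_power_Suc by blast+
    then show ?case using ideal_prod.sum[OF sum.IH] \<phi>_simps(1)[of f g] by (simp add: R_simps)
  qed
qed

lemma adic: "adic_finite_extension S B R m \<phi>"
proof (intro adic_finite_extension.intro finite_subring_extension_axioms
    adic_finite_extension_axioms.intro)
  show "0 \<in> \<phi> ` ideal_power R m k" for k
    unfolding ideal_power_m using \<phi>_zero mps_order_ideal_zero by (metis image_eqI)
  show "x + y \<in> \<phi> ` ideal_power R m k" if xy: "x \<in> \<phi> ` ideal_power R m k" "y \<in> \<phi> ` ideal_power R m k" for x y k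
  proof -
    obtain f g where fg: "x = \<phi> f" "y = \<phi> g" "f \<in> J k" "g \<in> J k" using xy unfolding ideal_power_m by blast
    have "x + y = \<phi> (\<lambda>\<alpha>. f \<alpha> + g \<alpha>)"
      using \<phi>_simps(1)[OF subsetD[OF J_subset fg(3)] subsetD[OF J_subset fg(4)]] by (simp only: fg(1,2))
    then show ?thesis unfolding ideal_power_m using mps_order_ideal_add[OF fg(3,4)] by (rule image_eqI)
  qed
  show "s * x \<in> \<phi> ` ideal_power R m k" if sx: "s \<in> S" "x \<in> \<phi> ` ideal_power R m k" for s x k
  proof -
    obtain f g where fg: "x = \<phi> f" "s = \<phi> g" "f \<in> J k" "g \<in> carrier R" using sx unfolding ideal_power_m S_def by blast
    have "s * x = \<phi> (f \<otimes>\<^bsub>R\<^esub> g)"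
      using \<phi>_simps(2)[OF subsetD[OF J_subset fg(3)] fg(4)] by (simp only: fg(1,2) mult.commute)
    moreover have "f \<otimes>\<^bsub>R\<^esub> g \<in> J k"
      using mps_order_ideal_mult[of f I t k g 0] fg unfolding mps_order_ideal_0 R_def by simp
    ultimately show ?thesis unfolding ideal_power_m by (rule image_eqI)
  qed
  show "\<phi> ` ideal_power R m k \<subseteq> S" for k unfolding ideal_power_m S_def using J_subset by blast
  show "\<phi> ` ideal_power R m (Suc k) \<subseteq> \<phi> ` ideal_power R m k" for k
    unfolding ideal_power_m
  proof (rule image_mono, rule subsetI)
    fix f assume f: "f \<in> J (Suc k)"
    have "t ^ (k - d) dvd f \<alpha>" if "t ^ (Suc k - d) dvd f \<alpha>" for d \<alpha>
      by (rule dvd_trans[OF le_imp_power_dvd that]) simp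
    with f show "f \<in> J k" unfolding mps_order_ideal_def by blast
  qed
  show "\<exists>y. \<forall>k. y - u k \<in> \<phi> ` ideal_power R m k"
    if u: "\<And>k. u k \<in> S" "\<And>k. u (Suc k) - u k \<in> \<phi> ` ideal_power R m k" for u
  proof -
    have "\<exists>f. f \<in> carrier R \<and> u k = \<phi> f" for k using u(1)[of k] unfolding S_def by blast
    then obtain x where x: "\<And>k. x k \<in> carrier R" "\<And>k. u k = \<phi> (x k)" by metis
    have "\<exists>f. f \<in> J k \<and> u (Suc k) - u k = \<phi> f" for k using u(2)[of k] unfolding ideal_power_m by blast
    then obtain d where d: "\<And>k. d k \<in> J k" "\<And>k. u (Suc k) - u k = \<phi> (d k)" by metis
    \<comment> \<open>Injectivity pulls the Cauchy condition in \<open>S\<close> back to the power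
      series themselves.\<close>
    have "x (Suc k) = (\<lambda>\<alpha>. x k \<alpha> + d k \<alpha>)" for k
    proof (rule inj_onD[OF inj])
      have dk: "d k \<in> carrier R" using d(1) J_subset by blast
      show "\<phi> (x (Suc k)) = \<phi> (\<lambda>\<alpha>. x k \<alpha> + d k \<alpha>)"
        unfolding \<phi>_simps(1)[OF x(1) dk] using d(2)[of k] by (simp add: x(2)[symmetric] algebra_simps)
      show "(\<lambda>\<alpha>. x k \<alpha> + d k \<alpha>) \<in> carrier R" by (rule R_closed(1)[OF x(1) dk])
    qed (rule x(1))
    then have step: "x (Suc k) \<alpha> = x k \<alpha> + d k \<alpha>" for k \<alpha> by simp
    obtain y where y: "y \<in> carrier R" "\<And>k. (\<lambda>\<alpha>. y \<alpha> - x k \<alpha>) \<in> J k"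
      using mps_order_complete[OF V_complete, of x I d] x(1) d(1) step unfolding R_def by blast
    have "\<phi> y - u k \<in> \<phi> ` J k" for k
      unfolding x(2) \<phi>_diff[OF y(1) x(1), symmetric] using y(2) by (rule imageI)
    then show ?thesis unfolding ideal_power_m by blast
  qed
  \<comment> \<open>Each m^k C lies in the k-th power of the maximal ideal of \<open>C\<close>, and
    these powers intersect in 0.\<close>
  show "w = 0" if w: "\<And>k. w \<in> {\<Sum>b\<in>B. r b * b | r. \<forall>b\<in>B. r b \<in> \<phi> ` ideal_power R m k}" for w
  proof -
    have "w \<in> ideal_power type_ring MC k" for k
    proof -
      have id: "ideal (ideal_power type_ring MC k) type_ring"
        by (rule ideal_power_ideal[OF cring_type_ring maximalideal.axioms(1)[OF MC_maximal]])
      obtain r where r: "w = (\<Sum>b\<in>B. r b * b)" "\<forall>b\<in>B. r b \<in> \<phi> ` ideal_power R m k" using w[of k] by blast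
      have "r b * b \<in> ideal_power type_ring MC k" if "b \<in> B" for b
        using type_ring_idealD(3)[OF id, of "r b" b] ideal_power_into_MC r(2) that by (auto simp: mult.commute)
      then show ?thesis unfolding r(1) by (intro type_ring_ideal_sum[OF id])
    qed
    with C_separated show ?thesis by blast
  qed
qed

end

text \<open>The difference is a derivation vanishing on \<open>S\<close>; the torsion lemma with N =
  0 and torsion-freeness of Q(C) make it vanish on \<open>C\<close>. Clearing denominators passes
  from \<open>C\<close> to Q(C).\<close>

lemma (in finite_subring_extension) derivation_unique:
  assumes D: "derivation D1" "derivation D2" and eq: "\<And>s. s \<in> S \<Longrightarrow> D1 (to_frac s) = D2 (to_frac s)"
  shows "D1 = D2"
proof -
  have add: "D1 (x + y) = D1 x + D1 y" "D2 (x + y) = D2 x + D2 y"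
    and mult: "D1 (x * y) = x * D1 y + y * D1 x" "D2 (x * y) = x * D2 y + y * D2 x" for x y
    using D unfolding derivation_def by blast+
  define \<delta> where "\<delta> c = D1 (to_frac c) - D2 (to_frac c)" for c
  have "module_derivation frac_module \<delta>"
    by (simp add: module_derivation_def \<delta>_def add mult algebra_simps)
  moreover have "submodule {0} type_ring (frac_module :: ('c, 'c fract) module)"
    by (rule submodule_frac_moduleI) auto
  moreover have "\<delta> ` S \<subseteq> {0}" using eq by (auto simp: \<delta>_def)
  ultimately obtain b where b: "b \<noteq> 0" "\<And>c. b \<odot>\<^bsub>frac_module\<^esub> \<delta> c \<in> {0}"
    using module_derivation_torsion[OF module_frac_module] by metis
  then have base: "D1 (to_frac c) = D2 (to_frac c)" for c
    using b(2)[of c] by (simp add: \<delta>_def)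
  show ?thesis
  proof
    fix x :: "'c fract"
    obtain d where d: "d \<noteq> 0" "to_frac d * x \<in> range to_frac" using frac_common_denominator by blast
    then obtain c where c: "to_frac d * x = to_frac c" by blast
    have "D1 (to_frac d * x) = D2 (to_frac d * x)" unfolding c by (rule base)
    then have "to_frac d * D1 x = to_frac d * D2 x" by (simp add: mult base)
    with d(1) show "D1 x = D2 x" by simp
  qed
qed

context power_series_extension
begin

lemma \<phi>_const_0: "\<phi> (mps_C 0) = 0"
proof -
  have "mps_C 0 = (\<lambda>\<alpha>. 0 :: 'v)" by (rule ext) (simp add: mps_const_apply)
  then show ?thesis by (simp only: \<phi>_zero)
qed

abbreviation "\<delta> i \<equiv> D_map type_ring I \<phi> i"

text \<open>The description defining \<open>frac_deriv\<close> denotes: the partial derivative is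
  transported to \<open>S\<close>, extended to \<open>C\<close> by adjoining generators and to Q(C)
  by the quotient rule, and such an extension is unique.\<close>

lemma D_map_derivation:
  shows "module_derivation frac_module (\<delta> i)"
    and "f \<in> carrier R \<Longrightarrow> \<delta> i (\<phi> f) = to_frac (\<phi> (mps_deriv type_ring i f))"
proof -
  let ?\<Delta> = "mps_deriv type_ring i"
  have \<partial>: "?\<Delta> f \<in> carrier R" if "f \<in> carrier R" for f
    using that unfolding R_def by (rule mps_deriv_carrier)
  \<comment> \<open>Injectivity of \<phi> allows the formal derivative to be read as a function on
    the image \<open>S\<close>.\<close>
  define D0 where "D0 x = to_frac (\<phi> (?\<Delta> (inv_into (carrier R) \<phi> x)))" for x
  have D0: "D0 (\<phi> f) = to_frac (\<phi> (?\<Delta> f))" if "f \<in> carrier R" for f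
    using that inv_into_f_f[OF inj] by (simp add: D0_def)
  have "derivation_on S D0"
    unfolding derivation_on_def
  proof (intro ballI)
    fix x y assume "x \<in> S" "y \<in> S"
    then obtain f g where fg: "x = \<phi> f" "y = \<phi> g" "f \<in> carrier R" "g \<in> carrier R"
      unfolding S_def by blast
    have "D0 (x + y) = to_frac (\<phi> (?\<Delta> (\<lambda>\<alpha>. f \<alpha> + g \<alpha>)))"
      unfolding fg(1,2) \<phi>_simps(1)[OF fg(3,4), symmetric] by (rule D0[OF R_closed(1)[OF fg(3,4)]])
    then have 1: "D0 (x + y) = D0 x + D0 y"
      by (simp add: mps_deriv_add \<phi>_simps \<partial> fg D0)
    have "D0 (x * y) = to_frac (\<phi> (?\<Delta> (f \<otimes>\<^bsub>R\<^esub> g)))"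
      unfolding fg(1,2) \<phi>_simps(2)[OF fg(3,4), symmetric] by (rule D0[OF R_closed(3)[OF fg(3,4)]])
    also have "?\<Delta> (f \<otimes>\<^bsub>R\<^esub> g) = (\<lambda>\<alpha>. (?\<Delta> f \<otimes>\<^bsub>R\<^esub> g) \<alpha> + (?\<Delta> g \<otimes>\<^bsub>R\<^esub> f) \<alpha>)"
      unfolding R_def by (rule mps_deriv_mult)
    finally have "D0 (x * y) = to_frac x * D0 y + to_frac y * D0 x"
      by (simp add: \<phi>_simps R_closed(3) \<partial> fg D0 algebra_simps)
    with 1 show "D0 (x + y) = D0 x + D0 y \<and> D0 (x * y) = to_frac x * D0 y + to_frac y * D0 x" by blast
  qed
  then obtain D1 where D1: "derivation_on UNIV D1" "\<And>x. x \<in> S \<Longrightarrow> D1 x = D0 x"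
    using derivation_on_extend by blast
  obtain D where D: "derivation D" "\<And>c. D (to_frac c) = D1 c"
    using derivation_fract_ex[OF D1(1)] by blast
  have DS: "D (to_frac (\<phi> f)) = to_frac (\<phi> (?\<Delta> f))" if "f \<in> carrier R" for f
    using that D1(2)[of "\<phi> f"] by (simp add: D(2) D0 S_def)
  have "frac_deriv type_ring I \<phi> i = D"
    unfolding frac_deriv_def R_def[symmetric]
  proof (rule the_equality)
    show "derivation D \<and> (\<forall>r\<in>carrier R. D (to_frac (\<phi> r)) = to_frac (\<phi> (?\<Delta> r)))"
      using D(1) DS by blast
    fix D' assume D': "derivation D' \<and> (\<forall>r\<in>carrier R. D' (to_frac (\<phi> r)) = to_frac (\<phi> (?\<Delta> r)))"
    show "D' = D"
    proof (rule derivation_unique)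
      fix s assume "s \<in> S"
      then show "D' (to_frac s) = D (to_frac s)" using D' DS unfolding S_def by auto
    qed (use D' D in blast)+
  qed
  then have eq: "\<delta> i c = D1 c" for c by (simp add: D_map_def D(2))
  show "module_derivation frac_module (\<delta> i)"
    using derivation_onD[OF D1(1) UNIV_I UNIV_I] by (simp add: module_derivation_def eq)
  show "\<delta> i (\<phi> f) = to_frac (\<phi> (?\<Delta> f))" if "f \<in> carrier R"
    using that D1(2)[of "\<phi> f"] by (simp add: eq D0 S_def)
qed

text \<open>On \<open>S\<close> the derivatives already lie in \<open>C\<close>, so the torsion
  lemma with N = C inside Q(C) gives a denominator for each i; their product over the finite set
  \<open>I\<close> serves all i.\<close>

lemma D_map_common_denominator:
  obtains a where "a \<noteq> 0" "\<And>i c. i \<in> I \<Longrightarrow> to_frac a * \<delta> i c \<in> range to_frac"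
proof -
  have "\<exists>b. b \<noteq> 0 \<and> (\<forall>c. to_frac b * \<delta> i c \<in> range to_frac)" for i
  proof -
    have "\<delta> i ` S \<subseteq> range to_frac"
      using D_map_derivation(2)[of _ i] unfolding S_def by blast
    then obtain b where "b \<noteq> 0" "\<And>c. b \<odot>\<^bsub>frac_module\<^esub> \<delta> i c \<in> range to_frac"
      using module_derivation_torsion[OF module_frac_module submodule_range_to_frac D_map_derivation(1)]
      by metis
    then show ?thesis by auto
  qed
  then obtain b where b: "\<And>i. b i \<noteq> 0" "\<And>i c. to_frac (b i) * \<delta> i c \<in> range to_frac"
    by metis
  have "to_frac (prod b I) * \<delta> i c \<in> range to_frac" if i: "i \<in> I" for i c
  proof -
    have eq: "to_frac (prod b I) * \<delta> i c =
        to_frac (prod b (I - {i})) * (to_frac (b i) * \<delta> i c)"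
      using prod.remove[OF I i, of b] by (simp add: mult_ac)
    show ?thesis unfolding eq
      by (rule module.submoduleE(4)[OF module_frac_module submodule_range_to_frac mem_type_ring b(2),
            unfolded frac_module_simps])
  qed
  moreover have "prod b I \<noteq> 0" using I b(1) by simp
  ultimately show thesis using that by blast
qed

section \<open>The torsion criterion for the completed differentials\<close>

definition "P \<equiv> \<lambda>k. \<phi> ` ideal_power R m k"
definition "W \<equiv> \<lambda>k. {\<Sum>b\<in>B. r b * b | r. \<forall>b\<in>B. r b \<in> P k}"

sublocale adic: adic_finite_extension S B R m \<phi> P W
proof -
  show "adic_finite_extension S B R m \<phi>" by (rule adic)
qed (rule P_def, rule W_def)

abbreviation "\<Omega> \<equiv> Omega type_ring type_ring \<phi>"
abbreviation "d \<equiv> kaehler_d type_ring type_ring (\<lambda>v. \<phi> (mps_C v))"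
abbreviation "F i \<equiv> induced_map type_ring type_ring (\<lambda>v. \<phi> (mps_C v)) frac_module (\<delta> i)"
abbreviation "filt \<equiv> adic_filtration R m \<phi> type_ring \<Omega>"

lemma Omega_hat_eq: "Omega_hat type_ring I m type_ring \<phi> = completion \<Omega> filt"
  by (simp add: Omega_hat_def R_def)

lemma D_tilde_eq: "D_tilde type_ring I m type_ring \<phi> i = continuous_extension R m \<phi> type_ring \<Omega> frac_module (F i)"
  by (simp add: D_tilde_def R_def)

lemma module_\<Omega>: "module type_ring \<Omega>"
  unfolding Omega_def by (rule module_kaehler)

sublocale \<Omega>: module "type_ring :: 'c ring" \<Omega>
  by (rule module_\<Omega>)

lemma d_derivation: "module_derivation \<Omega> d"
  unfolding Omega_def by (rule module_derivation_kaehler)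

lemma \<Omega>_generated: "submodule N type_ring \<Omega> \<Longrightarrow> (\<And>b. d b \<in> N) \<Longrightarrow> carrier \<Omega> = N"
  unfolding Omega_def by (rule kaehler_generated)

lemma F_props:
  shows "F i \<in> module_hom type_ring \<Omega> frac_module" and "F i (d c) = \<delta> i c"
proof -
  have "\<delta> i (\<phi> (mps_C v)) = 0" for v
    using D_map_derivation(2)[OF R_closed(5)] by (simp add: mps_deriv_const \<phi>_zero)
  then show "F i \<in> module_hom type_ring \<Omega> frac_module" "F i (d c) = \<delta> i c"
    unfolding Omega_def by (rule induced_map_frac[OF D_map_derivation(1)])+
qed

abbreviation "G i \<equiv> D_tilde type_ring I m type_ring \<phi> i"

text \<open>Up to \<open>\<Inter> m\<^sup>k \<Omega>\<close> and a nonzero factor \<open>b\<close>, multiplication by \<open>a\<close> on \<open>\<Omega>\<close> is the map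
  \<open>x \<mapsto> \<Sum> a D\<^sub>i(x) dX\<^sub>i\<close>; their difference is the map \<open>E\<close> of the proof.\<close>

theorem torsion_iff_D_tilde_zero:
  assumes \<omega>: "\<omega> \<in> carrier (Omega_hat type_ring I m type_ring \<phi>)"
  shows "\<omega> \<in> torsion_submodule type_ring (Omega_hat type_ring I m type_ring \<phi>) \<longleftrightarrow>
    (\<forall>i\<in>I. G i \<omega> = 0)"
proof -
  let ?hat = "completion \<Omega> filt"
  note sub = adic.submodule_filt[OF module_\<Omega>]
  note sub_closed = \<Omega>.submoduleE(4,5)[OF sub]
  note F_simps = module_homD[OF F_props(1)]
  note d_simps = module_derivationD[OF d_derivation]
  have \<omega>: "\<omega> \<in> carrier ?hat" using \<omega> by (simp add: Omega_hat_eq)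
  obtain a where a: "a \<noteq> 0" "\<And>i c. i \<in> I \<Longrightarrow> to_frac a * \<delta> i c \<in> range to_frac"
    using D_map_common_denominator by blast
  \<comment> \<open>The elements with this property form a submodule, and all differentials satisfy
    it by the choice of a.\<close>
  have aF: "to_frac a * F i x \<in> range to_frac" if i: "i \<in> I" and x: "x \<in> carrier \<Omega>" for i x
  proof -
    from submodule_frac_preimage[OF module_\<Omega> F_props(1)[of i] submodule_denominator]
    have "carrier \<Omega> = {x \<in> carrier \<Omega>. F i x \<in> {z. to_frac a * z \<in> range to_frac}}"
      by (rule \<Omega>_generated) (use d_simps(1) a(2)[OF i] F_props(2) in auto)
    with x show ?thesis by blast
  qed
  have G_hom: "G i \<in> module_hom type_ring ?hat frac_module" if "i \<in> I" for i
    unfolding D_tilde_eq by (rule adic.continuous_extension_frac(1)[OF module_\<Omega> F_props(1) a(1) aF[OF that]])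
  have G_key: "to_frac a * (G i \<omega> - F i x) \<in> to_frac ` W k"
    if "i \<in> I" "x \<in> \<omega> k" for i x k
    unfolding D_tilde_eq
    by (rule adic.continuous_extension_frac(2)[OF module_\<Omega> F_props(1) a(1) aF[OF that(1)] \<omega> that(2)])
  \<comment> \<open>The map a F_i with values in \<open>C\<close>, so that its values can act as
    scalars on \<open>Omega\<close>.\<close>
  define h where "h i x = (SOME c. to_frac a * F i x = to_frac c)" for i x
  have h: "to_frac (h i x) = to_frac a * F i x" if "i \<in> I" "x \<in> carrier \<Omega>" for i x
    using someI_ex[of "\<lambda>c. to_frac a * F i x = to_frac c"] aF[OF that] unfolding h_def by force
  have h_add: "h i (x \<oplus>\<^bsub>\<Omega>\<^esub> y) = h i x + h i y" if "i \<in> I" "x \<in> carrier \<Omega>" "y \<in> carrier \<Omega>" for i x y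
  proof -
    have "to_frac (h i (x \<oplus>\<^bsub>\<Omega>\<^esub> y)) = to_frac (h i x + h i y)" using that by (simp add: h F_simps distrib_left)
    then show ?thesis by (simp only: to_frac_simps(8))
  qed
  have h_smult: "h i (c \<odot>\<^bsub>\<Omega>\<^esub> x) = c * h i x" if "i \<in> I" "x \<in> carrier \<Omega>" for i x c
  proof -
    have "to_frac (h i (c \<odot>\<^bsub>\<Omega>\<^esub> x)) = to_frac (c * h i x)" using that by (simp add: h F_simps mult_ac)
    then show ?thesis by (simp only: to_frac_simps(8))
  qed
  define dX where "dX i = d (\<phi> (mps_X i))" for i
  have dX: "dX i \<in> carrier \<Omega>" for i unfolding dX_def by (rule d_simps(1))
  \<comment> \<open>The sign is built into the coefficients, so that the map \<open>E\<close> below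
    is a plain sum.\<close>
  define T where "T x = (\<Oplus>\<^bsub>\<Omega>\<^esub>i\<in>I. (- h i x) \<odot>\<^bsub>\<Omega>\<^esub> dX i)" for x
  have summand: "(\<lambda>i. c i \<odot>\<^bsub>\<Omega>\<^esub> dX i) \<in> I \<rightarrow> carrier \<Omega>" for c using dX by auto
  have T_carrier: "T x \<in> carrier \<Omega>" for x unfolding T_def by (rule \<Omega>.M.finsum_closed[OF summand])
  have T_add: "T (x \<oplus>\<^bsub>\<Omega>\<^esub> y) = T x \<oplus>\<^bsub>\<Omega>\<^esub> T y" if "x \<in> carrier \<Omega>" "y \<in> carrier \<Omega>" for x y
  proof -
    have "(- h i (x \<oplus>\<^bsub>\<Omega>\<^esub> y)) \<odot>\<^bsub>\<Omega>\<^esub> dX i = (- h i x) \<odot>\<^bsub>\<Omega>\<^esub> dX i \<oplus>\<^bsub>\<Omega>\<^esub> (- h i y) \<odot>\<^bsub>\<Omega>\<^esub> dX i" if "i \<in> I" for i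
      using \<Omega>.smult_l_distr[of "- h i x" "- h i y" "dX i"] dX h_add[OF that] \<open>x \<in> _\<close> \<open>y \<in> _\<close> by simp
    then have "T (x \<oplus>\<^bsub>\<Omega>\<^esub> y) = (\<Oplus>\<^bsub>\<Omega>\<^esub>i\<in>I. (- h i x) \<odot>\<^bsub>\<Omega>\<^esub> dX i \<oplus>\<^bsub>\<Omega>\<^esub> (- h i y) \<odot>\<^bsub>\<Omega>\<^esub> dX i)"
      unfolding T_def using dX by (intro \<Omega>.M.finsum_cong') auto
    then show ?thesis unfolding T_def by (simp only: \<Omega>.M.finsum_addf[OF summand summand])
  qed
  have T_smult: "T (c \<odot>\<^bsub>\<Omega>\<^esub> x) = c \<odot>\<^bsub>\<Omega>\<^esub> T x" if "x \<in> carrier \<Omega>" for c x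
  proof -
    have "(- h i (c \<odot>\<^bsub>\<Omega>\<^esub> x)) \<odot>\<^bsub>\<Omega>\<^esub> dX i = c \<odot>\<^bsub>\<Omega>\<^esub> ((- h i x) \<odot>\<^bsub>\<Omega>\<^esub> dX i)" if "i \<in> I" for i
      using \<Omega>.smult_assoc1[of c "- h i x" "dX i"] dX h_smult[OF that] \<open>x \<in> _\<close> by simp
    then have "T (c \<odot>\<^bsub>\<Omega>\<^esub> x) = (\<Oplus>\<^bsub>\<Omega>\<^esub>i\<in>I. c \<odot>\<^bsub>\<Omega>\<^esub> ((- h i x) \<odot>\<^bsub>\<Omega>\<^esub> dX i))"
      unfolding T_def using dX by (intro \<Omega>.M.finsum_cong') auto
    then show ?thesis unfolding T_def by (simp only: \<Omega>.finsum_smult_ldistr[OF I mem_type_ring summand])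
  qed
  define E where "E x = a \<odot>\<^bsub>\<Omega>\<^esub> x \<oplus>\<^bsub>\<Omega>\<^esub> T x" for x
  have E_carrier: "E x \<in> carrier \<Omega>" if "x \<in> carrier \<Omega>" for x using that T_carrier by (simp add: E_def)
  have E_add: "E (x \<oplus>\<^bsub>\<Omega>\<^esub> y) = E x \<oplus>\<^bsub>\<Omega>\<^esub> E y" if "x \<in> carrier \<Omega>" "y \<in> carrier \<Omega>" for x y
    using that T_carrier by (simp add: E_def T_add \<Omega>.smult_r_distr \<Omega>.M.a_ac)
  have E_smult: "E (c \<odot>\<^bsub>\<Omega>\<^esub> x) = c \<odot>\<^bsub>\<Omega>\<^esub> E x" if "x \<in> carrier \<Omega>" for c x
    using that T_carrier \<Omega>.smult_assoc1[of a c x] \<Omega>.smult_assoc1[of c a x]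
    by (simp add: E_def T_smult \<Omega>.smult_r_distr mult.commute)
  have E_derivation: "module_derivation \<Omega> (\<lambda>c. E (d c))"
    using d_simps(1) by (simp add: module_derivation_def d_simps(2,3) E_carrier E_add E_smult)
  note Ed_simps = module_derivationD[OF E_derivation]
  have E_zero: "E \<zero>\<^bsub>\<Omega>\<^esub> = \<zero>\<^bsub>\<Omega>\<^esub>"
    using E_smult[of "\<zero>\<^bsub>\<Omega>\<^esub>" 0] \<Omega>.smult_l_null[OF E_carrier, of "\<zero>\<^bsub>\<Omega>\<^esub>"] \<Omega>.smult_r_null[of 0] by simp
  have E_const: "E (d (\<phi> (mps_C v))) = \<zero>\<^bsub>\<Omega>\<^esub>" for v
    using kaehler_d_base[of v type_ring "\<lambda>v. \<phi> (mps_C v)"] E_zero by (simp add: Omega_def)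
  have E_X: "E (dX j) = \<zero>\<^bsub>\<Omega>\<^esub>" if j: "j \<in> I" for j
  proof -
    have XR: "mps_X j \<in> carrier R" unfolding R_def by (rule mps_X_carrier[OF j])
    \<comment> \<open>The partial derivatives of the variables are 0 or 1, so the sum over i reduces
      to -a dX_j and cancels a dX_j.\<close>
    have "h i (dX j) = (if j = i then a else 0)" if i: "i \<in> I" for i
    proof -
      have "\<delta> i (\<phi> (mps_X j)) = to_frac (if i = j then 1 else 0)"
        using D_map_derivation(2)[OF XR, of i] \<phi>_one \<phi>_const_0
        by (simp add: mps_deriv_X)
      then have "to_frac (h i (dX j)) = to_frac (if j = i then a else 0)"
        using h[OF i dX] by (simp add: dX_def F_props(2))
      then show ?thesis by (simp only: to_frac_simps(8))
    qed
    then have "(- h i (dX j)) \<odot>\<^bsub>\<Omega>\<^esub> dX i = (if j = i then (- a) \<odot>\<^bsub>\<Omega>\<^esub> dX i else \<zero>\<^bsub>\<Omega>\<^esub>)" if "i \<in> I" for i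
      using that \<Omega>.smult_l_null[OF dX[of i]] by simp
    then have "T (dX j) = (\<Oplus>\<^bsub>\<Omega>\<^esub>i\<in>I. if j = i then (- a) \<odot>\<^bsub>\<Omega>\<^esub> dX i else \<zero>\<^bsub>\<Omega>\<^esub>)"
      unfolding T_def using dX by (intro \<Omega>.M.finsum_cong') auto
    also have "\<dots> = (- a) \<odot>\<^bsub>\<Omega>\<^esub> dX j" by (rule \<Omega>.M.finsum_singleton[OF j I summand])
    finally have "E (dX j) = (a + - a) \<odot>\<^bsub>\<Omega>\<^esub> dX j"
      using \<Omega>.smult_l_distr[of a "- a" "dX j"] dX by (simp add: E_def)
    then show ?thesis using \<Omega>.smult_l_null[OF dX[of j]] by simp
  qed
  \<comment> \<open>Multiplication by a variable gains one step in the filtration; it suffices to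
    see this on the generating products.\<close>
  have X_filt: "\<phi> (mps_X i) \<odot>\<^bsub>\<Omega>\<^esub> x \<in> filt (Suc k)" if i: "i \<in> I" and x: "x \<in> filt k" for i x k
  proof -
    have XR: "mps_X i \<in> carrier R" unfolding R_def by (rule mps_X_carrier[OF i])
    let ?H = "{x \<in> carrier \<Omega>. \<phi> (mps_X i) \<odot>\<^bsub>\<Omega>\<^esub> x \<in> filt (Suc k)}"
    have "filt k \<subseteq> ?H"
    proof (rule adic.filt_minimal[OF module_\<Omega> submodule_typeI[OF module_\<Omega>]])
      fix p y assume p: "p \<in> P k" and y: "y \<in> carrier \<Omega>"
      obtain f where f: "p = \<phi> f" "f \<in> J k" using p unfolding P_def ideal_power_m by blast
      have "f \<otimes>\<^bsub>R\<^esub> mps_X i \<in> J (k + 1)"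
        unfolding R_def by (rule mps_order_ideal_mult[OF f(2) mps_X_order_ideal[OF i I]])
      then have "\<phi> (f \<otimes>\<^bsub>R\<^esub> mps_X i) \<in> P (Suc k)" unfolding P_def ideal_power_m by simp
      moreover have "\<phi> (f \<otimes>\<^bsub>R\<^esub> mps_X i) = \<phi> (mps_X i) * p"
        using \<phi>_simps(2)[OF subsetD[OF J_subset f(2)] XR] by (simp add: f(1) mult.commute)
      ultimately have "(\<phi> (mps_X i) * p) \<odot>\<^bsub>\<Omega>\<^esub> y \<in> filt (Suc k)"
        using adic.filt_gen[OF module_\<Omega> _ y] by simp
      then show "p \<odot>\<^bsub>\<Omega>\<^esub> y \<in> ?H"
        using y \<Omega>.smult_assoc1[of "\<phi> (mps_X i)" p y] by simp
    next
      show "\<zero>\<^bsub>\<Omega>\<^esub> \<in> ?H"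
        using \<Omega>.submodule_zero[OF sub] \<Omega>.smult_r_null[of "\<phi> (mps_X i)"] by simp
      show "c \<odot>\<^bsub>\<Omega>\<^esub> x \<in> ?H"
        if "x \<in> ?H" for c x
        using that sub_closed(1)[of c "\<phi> (mps_X i) \<odot>\<^bsub>\<Omega>\<^esub> x" "Suc k"]
          \<Omega>.smult_assoc1[of c "\<phi> (mps_X i)" x] \<Omega>.smult_assoc1[of "\<phi> (mps_X i)" c x]
        by (simp add: mult.commute)
    qed (use sub_closed(2) in \<open>auto simp: \<Omega>.smult_r_distr\<close>)
    with x show ?thesis by blast
  qed
  have E_R: "E (d (\<phi> f)) \<in> filt k" if "f \<in> carrier R" for f k
    using that
  proof (induction k arbitrary: f)
    case 0
    have "1 \<in> P 0" unfolding P_def ideal_power_0 using \<phi>_one R_closed(5)[of 1] by (metis imageI)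
    then have "1 \<odot>\<^bsub>\<Omega>\<^esub> E (d (\<phi> f)) \<in> filt 0" using Ed_simps(1) by (rule adic.filt_gen[OF module_\<Omega>])
    then show ?case using \<Omega>.smult_one[OF Ed_simps(1)] by simp
  next
    case (Suc k)
    have sum: "E (d (\<Sum>i\<in>A. c i)) \<in> filt (Suc k)" if "finite A" "\<And>i. i \<in> A \<Longrightarrow> E (d (c i)) \<in> filt (Suc k)"
      for A :: "nat set" and c
      using that
    proof induction
      case empty
      show ?case using E_const[of 0] \<Omega>.submodule_zero[OF sub]
        by (simp add: \<phi>_const_0)
    qed (simp add: Ed_simps(2) sub_closed(2))
    let ?g = "\<lambda>i. mps_shift f i \<otimes>\<^bsub>R\<^esub> mps_X i"
    have shift: "mps_shift f i \<in> carrier R" for i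
      using mps_shift_carrier Suc.prems unfolding R_def by blast
    have X: "mps_X i \<in> carrier R" if "i \<in> I" for i using mps_X_carrier[OF that] unfolding R_def .
    \<comment> \<open>In the Leibniz rule the term with E(dX_i) vanishes. What remains is X_i times
      a value already known to be in step k, hence in step k + 1.\<close>
    have "E (d (\<phi> (?g i))) \<in> filt (Suc k)" if i: "i \<in> I" for i
    proof -
      have "E (d (\<phi> (?g i))) = \<phi> (mps_shift f i) \<odot>\<^bsub>\<Omega>\<^esub> \<zero>\<^bsub>\<Omega>\<^esub> \<oplus>\<^bsub>\<Omega>\<^esub> \<phi> (mps_X i) \<odot>\<^bsub>\<Omega>\<^esub> E (d (\<phi> (mps_shift f i)))"
        unfolding \<phi>_simps(2)[OF shift X[OF i]] Ed_simps(3) using E_X[OF i] by (simp add: dX_def)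
      also have "\<dots> = \<phi> (mps_X i) \<odot>\<^bsub>\<Omega>\<^esub> E (d (\<phi> (mps_shift f i)))"
        using Ed_simps(1) by simp
      also have "\<dots> \<in> filt (Suc k)" by (rule X_filt[OF i Suc.IH[OF shift]])
      finally show ?thesis .
    qed
    then have "E (d (\<Sum>i\<in>I. \<phi> (?g i))) \<in> filt (Suc k)" by (rule sum[OF I])
    then have "E (d (\<phi> (mps_C (f 0)) + (\<Sum>i\<in>I. \<phi> (?g i)))) \<in> filt (Suc k)"
      using Ed_simps(1) by (simp add: Ed_simps(2) E_const)
    moreover have "\<phi> f = \<phi> (mps_C (f 0)) + (\<Sum>i\<in>I. \<phi> (?g i))"
    proof -
      have g: "?g i \<in> carrier R" if "i \<in> I" for i by (rule R_closed(3)[OF shift X[OF that]])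
      have "\<phi> f = \<phi> (\<lambda>\<alpha>. mps_C (f 0) \<alpha> + (\<Sum>i\<in>I. ?g i \<alpha>))"
        unfolding R_def by (rule arg_cong[OF mps_decomp[OF _ I]]) (use Suc.prems in \<open>simp only: R_def\<close>)
      then show ?thesis
        using \<phi>_simps(1)[OF R_closed(5) conjunct1[OF \<phi>_sum[OF I g]]] conjunct2[OF \<phi>_sum[OF I g]] by simp
    qed
    ultimately show ?case by simp
  qed
  have sub_Inf: "submodule {x \<in> carrier \<Omega>. \<forall>k. x \<in> filt k} type_ring \<Omega>"
    by (rule submodule_typeI[OF module_\<Omega>]) (use sub_closed \<Omega>.submodule_zero[OF sub] in auto)
  have E_S: "(\<lambda>c. E (d c)) ` S \<subseteq> {x \<in> carrier \<Omega>. \<forall>k. x \<in> filt k}"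
    using E_R Ed_simps(1) unfolding S_def by blast
  \<comment> \<open>The torsion lemma with N the intersection of the filtration, which need not be 0
    in \<open>Omega\<close>.\<close>
  obtain b where b: "b \<noteq> 0" "\<And>c. b \<odot>\<^bsub>\<Omega>\<^esub> E (d c) \<in> {x \<in> carrier \<Omega>. \<forall>k. x \<in> filt k}"
    by (rule module_derivation_torsion[OF module_\<Omega> sub_Inf E_derivation E_S]) (rule that)
  have bE: "b \<odot>\<^bsub>\<Omega>\<^esub> E x \<in> filt k" if x: "x \<in> carrier \<Omega>" for x k
  proof -
    let ?H = "{x \<in> carrier \<Omega>. b \<odot>\<^bsub>\<Omega>\<^esub> E x \<in> filt k}"
    have "submodule ?H type_ring \<Omega>"
    proof (rule submodule_typeI[OF module_\<Omega>])
      show "c \<odot>\<^bsub>\<Omega>\<^esub> x \<in> ?H"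
        if "x \<in> ?H" for c x
        using that sub_closed(1)[of c "b \<odot>\<^bsub>\<Omega>\<^esub> E x" k] E_carrier
          \<Omega>.smult_assoc1[of c b "E x"] \<Omega>.smult_assoc1[of b c "E x"]
        by (simp add: E_smult mult.commute)
    qed (use sub_closed(2) \<Omega>.submodule_zero[OF sub] E_carrier \<Omega>.smult_r_null[of b] in
        \<open>auto simp: E_add E_zero \<Omega>.smult_r_distr\<close>)
    then have "carrier \<Omega> = ?H"
      by (rule \<Omega>_generated) (use b(2) d_simps(1) in blast)
    with x show ?thesis by blast
  qed
  \<comment> \<open>The zero of the completion is the sequence of trivial cosets, that is, the
    filtration itself as a function of k.\<close>
  have hat_zero: "\<zero>\<^bsub>?hat\<^esub> = filt"
    using \<Omega>.quot_zero[OF sub] by (simp add: completion_def)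
  have torsion: "\<omega> \<in> torsion_submodule type_ring ?hat \<longleftrightarrow> (\<exists>c. c \<noteq> 0 \<and> c \<odot>\<^bsub>?hat\<^esub> \<omega> = filt)"
    using \<omega> by (auto simp: torsion_submodule_def hat_zero)
  show ?thesis
    unfolding Omega_hat_eq torsion
  proof
    assume "\<exists>c. c \<noteq> 0 \<and> c \<odot>\<^bsub>?hat\<^esub> \<omega> = filt"
    then obtain c where c: "c \<noteq> 0" "c \<odot>\<^bsub>?hat\<^esub> \<omega> = filt" by blast
    \<comment> \<open>Writing the zero of the completion as a multiple by 0 lets C-linearity of
      \<open>G i\<close> be applied to both sides of the torsion equation.\<close>
    have "0 \<odot>\<^bsub>?hat\<^esub> \<omega> = filt"
    proof
      fix k
      obtain x where x: "x \<in> \<omega> k" using adic.hat_nonempty[OF module_\<Omega> \<omega>] by blast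
      have xc: "x \<in> carrier \<Omega>" by (rule adic.hat_coset(1)[OF module_\<Omega> \<omega> x])
      have "(0 \<odot>\<^bsub>?hat\<^esub> \<omega>) k = filt k +>\<^bsub>\<Omega>\<^esub> \<zero>\<^bsub>\<Omega>\<^esub>"
        using adic.hat_smult(2)[OF module_\<Omega> \<omega> x, of 0] \<Omega>.smult_l_null[OF xc] by simp
      then show "(0 \<odot>\<^bsub>?hat\<^esub> \<omega>) k = filt k"
        using \<Omega>.coset_eq_zero_iff[OF sub, of "\<zero>\<^bsub>\<Omega>\<^esub>" k] \<Omega>.submodule_zero[OF sub] by simp
    qed
    with c(2) have eq: "c \<odot>\<^bsub>?hat\<^esub> \<omega> = 0 \<odot>\<^bsub>?hat\<^esub> \<omega>" by simp
    show "\<forall>i\<in>I. G i \<omega> = 0"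
    proof
      fix i assume i: "i \<in> I"
      have smult: "G i (c \<odot>\<^bsub>?hat\<^esub> \<omega>) = to_frac c * G i \<omega>" for c
        using module_homD(3)[OF G_hom[OF i] mem_type_ring \<omega>] by simp
      have "to_frac c * G i \<omega> = to_frac 0 * G i \<omega>"
        unfolding smult[symmetric] eq ..
      with c(1) show "G i \<omega> = 0" by simp
    qed
  next
    assume zero: "\<forall>i\<in>I. G i \<omega> = 0"
    \<comment> \<open>The factor a comes from the denominators of the D_i, the factor b from moving
      \<open>E\<close> into the intersection of the filtration.\<close>
    have "(b * a) \<odot>\<^bsub>?hat\<^esub> \<omega> = filt"
    proof
      fix k
      obtain x where x: "x \<in> \<omega> k" using adic.hat_nonempty[OF module_\<Omega> \<omega>] by blast
      have xc: "x \<in> carrier \<Omega>" by (rule adic.hat_coset(1)[OF module_\<Omega> \<omega> x])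
      \<comment> \<open>As the value at \<omega> is 0, the approximation estimate at level k bounds
        a F_i(x) itself.\<close>
      have hW: "- h i x \<in> W k" if i: "i \<in> I" for i
      proof -
        have "to_frac a * (0 - F i x) \<in> to_frac ` W k"
          using G_key[OF i x] zero i by simp
        moreover have "to_frac a * (0 - F i x) = to_frac (- h i x)" using h[OF i xc] by simp
        ultimately show ?thesis by (simp only: to_frac_mem_image_iff)
      qed
      have "(\<Oplus>\<^bsub>\<Omega>\<^esub>i\<in>A. (- h i x) \<odot>\<^bsub>\<Omega>\<^esub> dX i) \<in> filt k" if "finite A" "A \<subseteq> I" for A
        using that
      proof induction
        case empty
        show ?case using \<Omega>.submodule_zero[OF sub] by simp
      next
        case (insert i A)
        have "(- h i x) \<odot>\<^bsub>\<Omega>\<^esub> dX i \<in> filt k"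
          using insert by (intro adic.W_smult_filt[OF module_\<Omega> hW dX]) simp
        then show ?case using insert dX sub_closed(2) by (simp add: Pi_def)
      qed
      then have T: "T x \<in> filt k" using I unfolding T_def by blast
      \<comment> \<open>Both terms on the right lie in step k after multiplication by b: the first
        by the choice of b, the second because its coefficients lie in m^k C.\<close>
      have "a \<odot>\<^bsub>\<Omega>\<^esub> x = E x \<ominus>\<^bsub>\<Omega>\<^esub> T x"
        using xc T_carrier by (simp add: E_def a_minus_def \<Omega>.M.a_assoc \<Omega>.M.r_neg)
      then have "(b * a) \<odot>\<^bsub>\<Omega>\<^esub> x = b \<odot>\<^bsub>\<Omega>\<^esub> E x \<ominus>\<^bsub>\<Omega>\<^esub> b \<odot>\<^bsub>\<Omega>\<^esub> T x"
        using \<Omega>.smult_assoc1[of b a x] xc T_carrier E_carrier[OF xc]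
        by (simp add: a_minus_def \<Omega>.smult_r_distr \<Omega>.smult_r_minus)
      also have "\<dots> \<in> filt k"
        using bE[OF xc] sub_closed(1)[OF mem_type_ring T] by (intro \<Omega>.submodule_minus[OF sub])
      finally have "filt k +>\<^bsub>\<Omega>\<^esub> ((b * a) \<odot>\<^bsub>\<Omega>\<^esub> x) = filt k"
        using \<Omega>.coset_eq_zero_iff[OF sub, of "(b * a) \<odot>\<^bsub>\<Omega>\<^esub> x"] xc by simp
      then show "((b * a) \<odot>\<^bsub>?hat\<^esub> \<omega>) k = filt k"
        unfolding adic.hat_smult(2)[OF module_\<Omega> \<omega> x] .
    qed
    with a(1) b(1) show "\<exists>c. c \<noteq> 0 \<and> c \<odot>\<^bsub>?hat\<^esub> \<omega> = filt" by (intro exI[of _ "b * a"]) simp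
  qed
qed

end

theorem theorem4p5:
  fixes n p :: nat
    and V :: "'v::idom ring" and C :: "'c::idom ring"
    and R :: "((nat \<Rightarrow>\<^sub>0 nat) \<Rightarrow> 'v) ring" and \<phi> :: "((nat \<Rightarrow>\<^sub>0 nat) \<Rightarrow> 'v) \<Rightarrow> 'c"
    and m :: "((nat \<Rightarrow>\<^sub>0 nat) \<Rightarrow> 'v) set" and M\<^sub>C :: "'c set"
    and \<omega> :: "nat \<Rightarrow> ('c \<Rightarrow> 'c) set set"
  assumes V: "V = ring_of_type_algebra"
    and C: "C = ring_of_type_algebra"
    and V_dvr: "discrete_valuation_ring V (PIdl\<^bsub>V\<^esub> ([p] \<cdot>\<^bsub>V\<^esub> \<one>\<^bsub>V\<^esub>))"
    and V_complete: "adically_complete V (PIdl\<^bsub>V\<^esub> ([p] \<cdot>\<^bsub>V\<^esub> \<one>\<^bsub>V\<^esub>))"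
    and V_mixed: "mixed_char V (PIdl\<^bsub>V\<^esub> ([p] \<cdot>\<^bsub>V\<^esub> \<one>\<^bsub>V\<^esub>)) p"
    and V_perfect: "perfect_field (V Quot (PIdl\<^bsub>V\<^esub> ([p] \<cdot>\<^bsub>V\<^esub> \<one>\<^bsub>V\<^esub>))) p"
    and C_local_domain: "domain C" "local_ring C M\<^sub>C"
    and C_complete: "adically_complete C M\<^sub>C"
    and C_mixed: "mixed_char C M\<^sub>C p"
    and n: "n \<ge> 1"
    and R: "R = mps_ring V {1..<n}"
    and m: "maximalideal m R"
    and hom: "\<phi> \<in> ring_hom R C"
    and inj: "inj_on \<phi> (carrier R)"
    and finite_ext: "fin_gen_module R (restrict_scalars \<phi> C)"
    and \<omega>: "\<omega> \<in> carrier (Omega_hat V {1..<n} m C \<phi>)"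
  shows "\<omega> \<in> torsion_submodule C (Omega_hat V {1..<n} m C \<phi>) \<longleftrightarrow>
    (\<forall>i\<in>{1..<n}. D_tilde V {1..<n} m C \<phi> i \<omega> = 0)"
proof -
  let ?t = "of_nat p :: 'v"
  have t: "[p] \<cdot>\<^bsub>type_ring\<^esub> \<one>\<^bsub>type_ring\<^esub> = ?t" by simp
  \<comment> \<open>The parameter \<open>t\<close> is p regarded as an element of \<open>V\<close>.
    For n = 1 there are no variables and \<open>R\<close> consists of constant series.\<close>
  have "power_series_extension {1..<n} ?t M\<^sub>C \<phi> m"
  proof (rule power_series_extension.intro)
    show "adically_complete type_ring (PIdl\<^bsub>type_ring\<^esub> ?t)" using V_complete unfolding V t .
    have "local_ring type_ring (PIdl\<^bsub>type_ring\<^esub> ?t)"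
      using V_dvr unfolding V t discrete_valuation_ring_def by blast
    then show "maximalideal (PIdl\<^bsub>type_ring\<^esub> ?t) type_ring" unfolding local_ring_def by blast
    show "local_ring type_ring M\<^sub>C" using C_local_domain(2) unfolding C .
    show "(\<Inter>k. ideal_power type_ring M\<^sub>C k) = {0}"
      using C_complete unfolding C adically_complete_def by simp
    show "k = 0" if "of_nat k = (0 :: 'c)" for k
      using C_mixed that unfolding C mixed_char_def has_char_def by simp
    show "maximalideal m (mps_ring type_ring {1..<n})" using m unfolding R V .
    show "\<phi> \<in> ring_hom (mps_ring type_ring {1..<n}) type_ring" using hom unfolding R V C .
    show "inj_on \<phi> (carrier (mps_ring type_ring {1..<n}))" using inj unfolding R V .
    show "fin_gen_module (mps_ring type_ring {1..<n}) (restrict_scalars \<phi> type_ring)"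
      using finite_ext unfolding R V C .
  qed simp
  from power_series_extension.torsion_iff_D_tilde_zero[OF this \<omega>[unfolded V C]]
  show ?thesis unfolding V C .
qed

end
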